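(* Let $T>0$. Let $s\in(0,1)$, $\alpha\in[0,1)$ be such that $\alpha+2s\notin\{1,2\}$, and let $f\in C^{\alpha+2s}_b(\mathbb{R}^N)$, $g\in C^{0,\alpha}_b([0,T]\times\mathbb{R}^N)$. Then the mild solution $v$ to $$v_t(t,x)+(-\Delta)^sv(t,\cdot)(x)=g(t,x),\quad 0\le t\le T,\ x\in\mathbb{R}^N;\qquad v(0,x)=f(x),\quad x\in\mathbb{R}^N,\qquad( * )$$ belongs to $C^{0,\alpha+2s}_b([0,T]\times\mathbb{R}^N)$, and there is $C>0$, independent of $f$ and $g$, such that $$\|v\|_{C^{0,\alpha+2s}_b([0,T]\times\mathbb{R}^N)}\le C\big(\|f\|_{C^{\alpha+2s}_b(\mathbb{R}^N)}+\|g\|_{C^{0,\alpha}_b([0,T]\times\mathbb{R}^N)}\big).$$ Let $s\in(0,1)$, $\alpha\in[0,1)$ be such that $\alpha+2s=:k\in\{1,2\}$. Then for every $f\in Z^k_b(\mathbb{R}^N)$, $g\in C^{0,\alpha}_b([0,T]\times\mathbb{R}^N)$ the mild solution to $( * )$ belongs to $Z^{0,k}_b([0,T]\times\mathbb{R}^N)$, and there is $C>0$, independent of $f$ and $g$, such that $$\|v\|_{Z^{0,k}_b([0,T]\times\mathbb{R}^N)}\le C\big(\|f\|_{Z^k_b(\mathbb{R}^N)}+\|g\|_{C^{0,\alpha}_b([0,T]\times\mathbb{R}^N)}\big).$$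
   Context: The semigroup. Let $T_\sigma$ be the heat semigroup on $\mathbb{R}^N$ with kernel $(4\pi\sigma)^{-N/2}e^{-|x|^2/4\sigma}$, and for $t>0$ let $\eta^{(s)}_t:(0,\infty)\to\mathbb{R}$ be the inverse Laplace transform of $\lambda\mapsto e^{-t\lambda^s}$, i.e. $\int_0^\infty e^{-\lambda\sigma}\eta^{(s)}_t(\sigma)\,d\sigma=e^{-t\lambda^s}$. Set $P_tf=e^{-t(-\Delta)^s}f:=\int_0^\infty T_\sigma f\,\eta^{(s)}_t(\sigma)\,d\sigma$, $t>0$, $f\in C_b(\mathbb{R}^N)$, $P_0=I$. The mild solution of the Cauchy problem $( * )$ is by definition $v(t,x)=P_tf(x)+\int_0^tP_{t-r}g(r,\cdot)(x)\,dr$, $t\in[0,T]$, $x\in\mathbb{R}^N$. Function spaces. $C_b$: bounded continuous functions with sup norm. For $\sigma\in(0,1)$, $C^\sigma_b(\mathbb{R}^N)$: bounded $\sigma$-Hölder continuous functions, norm $\|f\|_\infty+\sup_{x,\,h\ne0}|f(x+h)-f(x)|/|h|^\sigma$. For $n\in\mathbb{N}$, $C^n_b(\mathbb{R}^N)$: functions with bounded continuous derivatives up to order $n$, norm given by sum of sup norms; $C^{n+\sigma}_b(\mathbb{R}^N)$: $f\in C^n_b$ whose $n$-th order derivative is $\sigma$-Hölder, norm $\|f\|_{C^n_b}$ plus the $\sigma$-Hölder seminorm of $D^nf$. $Z^1_b(\mathbb{R}^N)$: bounded continuous $f$ with $[f]_{Z^1}=\sup_{x,\,h\ne0}|f(x+2h)-2f(x+h)+f(x)|/|h|<\infty$,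 norm $\|f\|_\infty+[f]_{Z^1}$. $Z^2_b(\mathbb{R}^N)$: $f\in C^1_b$ with $[Df]_{Z^1}<\infty$, norm $\|f\|_{C^1_b}+[Df]_{Z^1}$. For $\gamma>0$, $C^{0,\gamma}_b([0,T]\times\mathbb{R}^N)$: bounded continuous $g$ with $g(t,\cdot)\in C^\gamma_b(\mathbb{R}^N)$ for all $t$, norm $\sup_t\|g(t,\cdot)\|_{C^\gamma_b}<\infty$, and, if $\gamma\ge1$, all space derivatives of order $\le[\gamma]$ continuous on $[0,T]\times\mathbb{R}^N$. $C^{0,0}_b([0,T]\times\mathbb{R}^N):=C_b([0,T]\times\mathbb{R}^N)$. $Z^{0,k}_b([0,T]\times\mathbb{R}^N)$: bounded continuous $g$ with $g(t,\cdot)\in Z^k_b(\mathbb{R}^N)$ for all $t$, norm $\sup_t\|g(t,\cdot)\|_{Z^k_b}<\infty$, and, if $k\ge2$, $g\in C^{0,k-1}_b([0,T]\times\mathbb{R}^N)$. *)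

theory Defs
  imports "HOL-Analysis.Analysis"
begin

section \<open>The semigroup generated by the fractional Laplacian\<close>

definition heat_semigroup :: "real \<Rightarrow> (real ^ 'n \<Rightarrow> real) \<Rightarrow> real ^ 'n \<Rightarrow> real" where
  "heat_semigroup \<sigma> f x =
     (LINT y|lborel. (4 * pi * \<sigma>) powr (- real CARD('n) / 2)
                       * exp (- (norm (x - y))\<^sup>2 / (4 * \<sigma>)) * f y)"

text \<open>
  Only the values of \<^term>\<open>\<eta>\<close> on the open half-line matter. Continuity there selects the unique
  pointwise representative; the Laplace transform alone determines \<^term>\<open>\<eta>\<close> only almost everywhere.
\<close>
definition is_inverse_laplace :: "(real \<Rightarrow> real) \<Rightarrow> (real \<Rightarrow> real) \<Rightarrow> bool" where
  "is_inverse_laplace \<eta> F \<longleftrightarrow>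
     continuous_on {0<..} \<eta> \<and>
     (\<forall>\<mu>>0. set_integrable lborel {0<..} (\<lambda>\<sigma>. exp (- \<mu> * \<sigma>) * \<eta> \<sigma>) \<and>
            (LINT \<sigma>:{0<..}|lborel. exp (- \<mu> * \<sigma>) * \<eta> \<sigma>) = F \<mu>)"

definition stable_density :: "real \<Rightarrow> real \<Rightarrow> real \<Rightarrow> real" where
  "stable_density s t = (SOME \<eta>. is_inverse_laplace \<eta> (\<lambda>\<mu>. exp (- t * \<mu> powr s)))"

definition frac_semigroup :: "real \<Rightarrow> real \<Rightarrow> (real ^ 'n \<Rightarrow> real) \<Rightarrow> real ^ 'n \<Rightarrow> real" where
  "frac_semigroup s t f x =
     (if t = 0 then f x
      else (LINT \<sigma>:{0<..}|lborel. heat_semigroup \<sigma> f x * stable_density s t \<sigma>))"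

definition mild_solution ::
  "real \<Rightarrow> (real ^ 'n \<Rightarrow> real) \<Rightarrow> (real \<Rightarrow> real ^ 'n \<Rightarrow> real) \<Rightarrow> real \<Rightarrow> real ^ 'n \<Rightarrow> real" where
  "mild_solution s f g t x =
     frac_semigroup s t f x + (LINT r:{0..t}|lborel. frac_semigroup s (t - r) (g r) x)"

section \<open>Hoelder and Zygmund spaces on the whole space\<close>

text \<open>
  The components of the \<open>k\<close>-th derivative are indexed by the lists of \<open>k\<close> coordinate directions,
  and the norms and seminorms of the \<open>k\<close>-th derivative are the sums of those of its components.
  All norms and seminorms take values in \<^typ>\<open>ennreal\<close>, so that they are meaningful (possibly
  infinite) for every function.
\<close>
primrec partial_deriv :: "'n list \<Rightarrow> (real ^ 'n \<Rightarrow> real) \<Rightarrow> real ^ 'n \<Rightarrow> real" where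
  "partial_deriv [] f = f"
| "partial_deriv (i # is) f = (\<lambda>x. frechet_derivative (partial_deriv is f) (at x) (axis i 1))"

definition sup_norm :: "(real ^ 'n \<Rightarrow> real) \<Rightarrow> ennreal" where
  "sup_norm f = (SUP x. ennreal \<bar>f x\<bar>)"

definition holder_seminorm :: "real \<Rightarrow> (real ^ 'n \<Rightarrow> real) \<Rightarrow> ennreal" where
  "holder_seminorm \<sigma> f = (SUP x. SUP h\<in>-{0}. ennreal (\<bar>f (x + h) - f x\<bar> / norm h powr \<sigma>))"

definition zygmund_seminorm :: "(real ^ 'n \<Rightarrow> real) \<Rightarrow> ennreal" where
  "zygmund_seminorm f =
     (SUP x. SUP h\<in>-{0}. ennreal (\<bar>f (x + 2 *\<^sub>R h) - 2 * f (x + h) + f x\<bar> / norm h))"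

definition Cn_space :: "nat \<Rightarrow> (real ^ 'n \<Rightarrow> real) set" where
  "Cn_space n = {f.
     (\<forall>is. length is < n \<longrightarrow> partial_deriv is f differentiable_on UNIV) \<and>
     (\<forall>is. length is \<le> n \<longrightarrow>
        continuous_on UNIV (partial_deriv is f) \<and> bounded (range (partial_deriv is f)))}"

definition Cn_norm :: "nat \<Rightarrow> (real ^ 'n \<Rightarrow> real) \<Rightarrow> ennreal" where
  "Cn_norm n f = (\<Sum>is | length is \<le> n. sup_norm (partial_deriv is f))"

definition holder_space :: "real \<Rightarrow> (real ^ 'n \<Rightarrow> real) set" where
  "holder_space \<gamma> = (let n = nat \<lfloor>\<gamma>\<rfloor> in
     if \<gamma> = real n then Cn_space n
     else {f \<in> Cn_space n. \<forall>is. length is = n \<longrightarrow>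
             holder_seminorm (\<gamma> - real n) (partial_deriv is f) < \<infinity>})"

definition holder_norm :: "real \<Rightarrow> (real ^ 'n \<Rightarrow> real) \<Rightarrow> ennreal" where
  "holder_norm \<gamma> f = (let n = nat \<lfloor>\<gamma>\<rfloor> in
     if \<gamma> = real n then Cn_norm n f
     else Cn_norm n f
       + (\<Sum>is | length is = n. holder_seminorm (\<gamma> - real n) (partial_deriv is f)))"

text \<open>The Zygmund spaces below are meant for \<^prop>\<open>k \<ge> 1\<close>.\<close>
definition zygmund_space :: "nat \<Rightarrow> (real ^ 'n \<Rightarrow> real) set" where
  "zygmund_space k = {f \<in> Cn_space (k - 1). \<forall>is. length is = k - 1 \<longrightarrow>
     zygmund_seminorm (partial_deriv is f) < \<infinity>}"

definition zygmund_norm :: "nat \<Rightarrow> (real ^ 'n \<Rightarrow> real) \<Rightarrow> ennreal" where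
  "zygmund_norm k f = Cn_norm (k - 1) f
     + (\<Sum>is | length is = k - 1. zygmund_seminorm (partial_deriv is f))"

section \<open>Spaces of functions of time and space\<close>

text \<open>
  Functions on \<open>[0,T] \<times> \<real>\<^sup>N\<close> are represented by curried total functions; their values at
  times outside \<open>[0,T]\<close> are irrelevant.
\<close>
definition holder_norm_time ::
  "real \<Rightarrow> real \<Rightarrow> (real \<Rightarrow> real ^ 'n \<Rightarrow> real) \<Rightarrow> ennreal" where
  "holder_norm_time T \<gamma> g = (SUP t\<in>{0..T}. holder_norm \<gamma> (g t))"

text \<open>
  The empty list of directions accounts for the continuity of \<open>g\<close> itself; its boundedness is part
  of the finiteness of the norm. For \<^prop>\<open>\<gamma> = 0\<close> this is the space of bounded continuous functions.
\<close>
definition holder_space_time :: "real \<Rightarrow> real \<Rightarrow> (real \<Rightarrow> real ^ 'n \<Rightarrow> real) set" where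
  "holder_space_time T \<gamma> = {g.
     (\<forall>t\<in>{0..T}. g t \<in> holder_space \<gamma>) \<and>
     holder_norm_time T \<gamma> g < \<infinity> \<and>
     (\<forall>is. length is \<le> nat \<lfloor>\<gamma>\<rfloor> \<longrightarrow>
        continuous_on ({0..T} \<times> UNIV) (\<lambda>(t, x). partial_deriv is (g t) x))}"

definition zygmund_norm_time ::
  "real \<Rightarrow> nat \<Rightarrow> (real \<Rightarrow> real ^ 'n \<Rightarrow> real) \<Rightarrow> ennreal" where
  "zygmund_norm_time T k g = (SUP t\<in>{0..T}. zygmund_norm k (g t))"

definition zygmund_space_time :: "real \<Rightarrow> nat \<Rightarrow> (real \<Rightarrow> real ^ 'n \<Rightarrow> real) set" where
  "zygmund_space_time T k = {g.
     continuous_on ({0..T} \<times> UNIV) (\<lambda>(t, x). g t x) \<and>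
     (\<forall>t\<in>{0..T}. g t \<in> zygmund_space k) \<and>
     zygmund_norm_time T k g < \<infinity> \<and>
     (k \<ge> 2 \<longrightarrow> g \<in> holder_space_time T (real (k - 1)))}"

end

theory Submission
  imports Defs "HOL-Probability.Probability" "HOL-Complex_Analysis.Complex_Analysis"
    "HOL-Real_Asymp.Real_Asymp"
begin

text \<open>
  The inverse Laplace transform \<open>\<eta>\<close> of \<open>exp (- t \<mu>\<^sup>s)\<close> is given by Bromwich's integral along the imaginary axis;
  it is unique and nonnegative because the transform has alternating finite differences. Uniqueness
  gives the scaling in \<open>t\<close>, so that \<open>P\<^sub>t f (x)\<close> is the average of \<open>f (x - t\<^bsup>1/2s\<^esup> \<surd>\<rho> z)\<close> over a Gaussian
  \<open>z\<close> and a stable variable \<open>\<rho>\<close> all of whose negative moments of order at most 2 are finite. Hence \<open>P\<^sub>t\<close>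
  commutes with derivatives and does not increase bounds on differences, and a derivative of order \<open>j \<ge> 1\<close> of
  \<open>P\<^sub>\<tau> g\<close> is at most a multiple of \<open>\<tau>\<^bsup>-(j - \<alpha>)/2s\<^esup>\<close> if \<open>g\<close> is \<open>\<alpha>\<close>-Hoelder.

  The first (Hoelder case) or second (Zygmund case) difference with step \<open>h\<close> of an \<open>n\<close>-th derivative of
  \<open>\<integral> P\<^sub>\<tau> g(t - \<tau>) d\<tau>\<close> is estimated by the bound for order \<open>n\<close> when \<open>\<tau> < |h|\<^bsup>2s\<^esup>\<close> and by the mean value theorem
  with the bound for order \<open>n + 1\<close> or \<open>n + 2\<close> when \<open>\<tau> > |h|\<^bsup>2s\<^esup>\<close>; both parts contribute \<open>|h|\<^bsup>\<alpha> + 2s - n\<^esup>\<close>.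
\<close>

section \<open>Integrals depending on a parameter\<close>

text \<open>The time exponent (j - \<alpha>)/2s is below 1 exactly when j < \<alpha> + 2s and above
  1 exactly when j > \<alpha> + 2s. A lower order is thus integrable at time 0, a higher one at
  infinity, and the splitting of the integral needs one of each. If \<alpha> + 2s is not an integer,
  the two orders enclosing it serve. If it equals k, order k gives 1/\<tau> and a logarithm on both
  sides; the orders k - 1 and k + 1 remain. They differ by two, so the mean value theorem pairs them
  with a second difference, and this is where the Zygmund seminorm comes from. The definition of
  \<eta> offers nothing but its Laplace transform, so nonnegativity has to be extracted from it. In
  the variable x = exp (-\<sigma>) this is Hausdorff's moment criterion. Nonnegativity is what turns
  the stable law into a probability measure and the semigroup into an average, and uniqueness
  follows by applying it to a difference of two candidates and to its negative.\<close>

lemma continuous_on_LINT: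
  fixes F :: "'p::metric_space \<Rightarrow> 'a \<Rightarrow> real"
  assumes meas: "\<And>p. p \<in> S \<Longrightarrow> F p \<in> borel_measurable M"
    and bnd: "\<And>p. p \<in> S \<Longrightarrow> AE \<omega> in M. \<bar>F p \<omega>\<bar> \<le> w \<omega>"
    and w: "integrable M w"
    and cont: "\<And>p. p \<in> S \<Longrightarrow> AE \<omega> in M. continuous (at p within S) (\<lambda>p. F p \<omega>)"
  shows "continuous_on S (\<lambda>p. LINT \<omega>|M. F p \<omega>)"
  unfolding continuous_on_sequentially
proof safe
  fix x a assume a: "a \<in> S" and x: "\<forall>n. x n \<in> S" and lim: "x \<longlonglongrightarrow> a"
  show "((\<lambda>p. LINT \<omega>|M. F p \<omega>) \<circ> x) \<longlonglongrightarrow> (LINT \<omega>|M. F a \<omega>)"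
    unfolding o_def
  proof (rule integral_dominated_convergence[where w=w])
    show "AE \<omega> in M. (\<lambda>n. F (x n) \<omega>) \<longlonglongrightarrow> F a \<omega>"
      using cont[OF a]
    proof eventually_elim
      case (elim \<omega>)
      then show ?case using x lim
        by (auto simp: continuous_within_sequentially o_def)
    qed
    show "AE \<omega> in M. norm (F (x n) \<omega>) \<le> w \<omega>" for n
      using bnd[of "x n"] x by simp
  qed (use meas x a w in auto)
qed

text \<open>Dominated convergence for the first-order remainder divided by the increment: the mean
  value inequality bounds it by \<open>2 * w \<omega>\<close>. Measurability of the derivative comes
  from writing it as a limit of difference quotients along 1/(n+1).\<close>

lemma has_derivative_LINT:
  fixes F :: "'a \<Rightarrow> 'b::real_normed_vector \<Rightarrow> real"
  assumes r: "r > 0"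
    and meas: "\<And>x. (\<lambda>\<omega>. F \<omega> x) \<in> borel_measurable M"
    and int: "\<And>x. x \<in> ball x0 r \<Longrightarrow> integrable M (\<lambda>\<omega>. F \<omega> x)"
    and der: "\<And>\<omega> x. \<omega> \<in> space M \<Longrightarrow> x \<in> ball x0 r \<Longrightarrow> (F \<omega> has_derivative F' \<omega> x) (at x)"
    and bnd: "\<And>\<omega> x h. \<omega> \<in> space M \<Longrightarrow> x \<in> ball x0 r \<Longrightarrow> \<bar>F' \<omega> x h\<bar> \<le> w \<omega> * norm h"
    and w: "integrable M w"
  shows "((\<lambda>x. LINT \<omega>|M. F \<omega> x) has_derivative (\<lambda>h. LINT \<omega>|M. F' \<omega> x0 h)) (at x0)"
    and "\<And>h. integrable M (\<lambda>\<omega>. F' \<omega> x0 h)"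
proof -
  have x0: "x0 \<in> ball x0 r" using r by simp
  have meas': "(\<lambda>\<omega>. F' \<omega> x0 h) \<in> borel_measurable M" for h
  proof (rule borel_measurable_LIMSEQ_real)
    fix \<omega> assume \<omega>: "\<omega> \<in> space M"
    have "((\<lambda>t. F \<omega> (x0 + t *\<^sub>R h)) has_derivative (\<lambda>t. F' \<omega> x0 (t *\<^sub>R h))) (at 0)"
      by (rule derivative_eq_intros has_derivative_compose[where g="F \<omega>", of "\<lambda>t. x0 + t *\<^sub>R h"] | simp add: der[OF \<omega> x0])+
    moreover have "(\<lambda>t. F' \<omega> x0 (t *\<^sub>R h)) = (\<lambda>t. F' \<omega> x0 h * t)"
      using linear_scale[OF has_derivative_linear[OF der[OF \<omega> x0]]] by (auto simp: mult.commute)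
    ultimately have "((\<lambda>t. F \<omega> (x0 + t *\<^sub>R h)) has_field_derivative F' \<omega> x0 h) (at 0)"
      by (simp add: has_field_derivative_def)
    then have *: "((\<lambda>t. (F \<omega> (x0 + t *\<^sub>R h) - F \<omega> x0) / t) \<longlongrightarrow> F' \<omega> x0 h) (at 0)"
      by (simp add: DERIV_def)
    have "filterlim (\<lambda>n. 1 / real (Suc n)) (at 0) sequentially"
      by (auto simp: filterlim_at) real_asymp
    from filterlim_compose[OF * this]
    show "(\<lambda>n. (F \<omega> (x0 + (1 / real (Suc n)) *\<^sub>R h) - F \<omega> x0) / (1 / real (Suc n))) \<longlonglongrightarrow> F' \<omega> x0 h" .
  qed (use meas in measurable)
  show int': "\<And>h. integrable M (\<lambda>\<omega>. F' \<omega> x0 h)"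
  proof -
    fix h show "integrable M (\<lambda>\<omega>. F' \<omega> x0 h)"
      by (rule Bochner_Integration.integrable_bound[of _ "\<lambda>\<omega>. w \<omega> * norm h"])
        (use w meas' bnd[OF _ x0] in \<open>auto intro!: AE_I2 intro: order_trans[OF _ abs_ge_self]\<close>)
  qed
  have lin: "linear (F' \<omega> x0)" if "\<omega> \<in> space M" for \<omega>
    using has_derivative_linear[OF der[OF that x0]] .
  \<comment> \<open>The bound at a nonzero vector forces \<open>w \<omega> \<ge> 0\<close>; at the
    zero vector it says nothing, hence the guard.\<close>
  have w0: "\<omega> \<in> space M \<Longrightarrow> 0 \<le> w \<omega>" if "(h::'b) \<noteq> 0" for \<omega> h
  proof -
    assume "\<omega> \<in> space M"
    then have "0 \<le> w \<omega> * norm h" using bnd[OF _ x0, of \<omega> h] by linarith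
    with that show ?thesis by (simp add: zero_le_mult_iff)
  qed
  show "((\<lambda>x. LINT \<omega>|M. F \<omega> x) has_derivative (\<lambda>h. LINT \<omega>|M. F' \<omega> x0 h)) (at x0)"
    unfolding has_derivative_at_within
  proof (intro conjI)
    show "bounded_linear (\<lambda>h. LINT \<omega>|M. F' \<omega> x0 h)"
    proof (rule bounded_linear_intro[where K="integral\<^sup>L M w"])
      fix x y :: 'b and c :: real
      show "(LINT \<omega>|M. F' \<omega> x0 (x + y)) = (LINT \<omega>|M. F' \<omega> x0 x) + (LINT \<omega>|M. F' \<omega> x0 y)"
        unfolding Bochner_Integration.integral_add[OF int' int', symmetric]
        by (rule Bochner_Integration.integral_cong) (simp_all add: linear_add[OF lin])
      show "(LINT \<omega>|M. F' \<omega> x0 (c *\<^sub>R x)) = c *\<^sub>R (LINT \<omega>|M. F' \<omega> x0 x)"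
        unfolding integral_scaleR_right[symmetric]
        by (rule Bochner_Integration.integral_cong) (simp_all add: linear_scale[OF lin])
      have "\<bar>LINT \<omega>|M. F' \<omega> x0 x\<bar> \<le> (LINT \<omega>|M. w \<omega> * norm x)"
        by (rule order_trans[OF integral_abs_bound], rule integral_mono) (use int' w bnd[OF _ x0] in auto)
      then show "norm (LINT \<omega>|M. F' \<omega> x0 x) \<le> norm x * integral\<^sup>L M w"
        by (simp add: mult.commute)
    qed
    show "((\<lambda>y. ((LINT \<omega>|M. F \<omega> y) - (LINT \<omega>|M. F \<omega> x0) - (LINT \<omega>|M. F' \<omega> x0 (y - x0))) /\<^sub>R norm (y - x0)) \<longlongrightarrow> 0) (at x0)"
      unfolding tendsto_at_iff_sequentially o_def
    proof safe
      fix X assume X0: "\<forall>i. X i \<in> UNIV - {x0}" and X: "X \<longlonglongrightarrow> x0"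
      define Q where "Q y \<omega> = (F \<omega> y - F \<omega> x0 - F' \<omega> x0 (y - x0)) /\<^sub>R norm (y - x0)" for y \<omega>
      have "eventually (\<lambda>i. X i \<in> ball x0 r) sequentially"
        using X r by (metis centre_in_ball open_ball topological_tendstoD)
      then obtain N where N: "\<And>i. i \<ge> N \<Longrightarrow> X i \<in> ball x0 r" by (auto simp: eventually_sequentially)
      \<comment> \<open>The majorant is available only in the ball, so the sequence is shifted until
        all its terms lie there.\<close>
      have "(\<lambda>i. LINT \<omega>|M. Q (X (i + N)) \<omega>) \<longlonglongrightarrow> (LINT \<omega>|M. 0)"
      proof (rule integral_dominated_convergence[where w="\<lambda>\<omega>. 2 * w \<omega>"])
        show "(\<lambda>\<omega>. Q (X (i + N)) \<omega>) \<in> borel_measurable M" for i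
          unfolding Q_def using meas meas' by measurable
        show "AE \<omega> in M. (\<lambda>i. Q (X (i + N)) \<omega>) \<longlonglongrightarrow> 0"
        proof (rule AE_I2)
          fix \<omega> assume "\<omega> \<in> space M"
          from der[OF this x0] have "((\<lambda>y. Q y \<omega>) \<longlongrightarrow> 0) (at x0)"
            unfolding has_derivative_at_within Q_def by simp
          moreover have "filterlim (\<lambda>i. X (i + N)) (at x0) sequentially"
            using X0 X by (auto simp: filterlim_at intro!: LIMSEQ_ignore_initial_segment)
          ultimately show "(\<lambda>i. Q (X (i + N)) \<omega>) \<longlonglongrightarrow> 0"
            by (rule filterlim_compose)
        qed
        show "AE \<omega> in M. norm (Q (X (i + N)) \<omega>) \<le> 2 * w \<omega>" for i
        proof (rule AE_I2)
          fix \<omega> assume \<omega>: "\<omega> \<in> space M"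
          let ?y = "X (i + N)"
          have y: "?y \<in> ball x0 r" "?y \<noteq> x0" using N X0 by auto
          then have yp: "norm (?y - x0) > 0" by simp
          have ond: "onorm (F' \<omega> z) \<le> w \<omega>" if "z \<in> ball x0 r" for z
            by (rule onorm_bound) (use bnd[OF \<omega> that] w0[of "X (i + N) - x0", OF _ \<omega>] y in auto)
          have "norm (F \<omega> ?y - F \<omega> x0) \<le> w \<omega> * norm (?y - x0)"
            by (rule differentiable_bound[of "ball x0 r" "F \<omega>" "F' \<omega>"])
              (use y x0 ond der[OF \<omega>] in \<open>auto intro: has_derivative_at_withinI\<close>)
          moreover have "\<bar>F' \<omega> x0 (?y - x0)\<bar> \<le> w \<omega> * norm (?y - x0)" by (rule bnd[OF \<omega> x0])
          ultimately have "\<bar>F \<omega> ?y - F \<omega> x0 - F' \<omega> x0 (?y - x0)\<bar> \<le> 2 * w \<omega> * norm (?y - x0)"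
            by simp
          then show "norm (Q ?y \<omega>) \<le> 2 * w \<omega>"
            using yp by (simp add: Q_def field_simps)
        qed
      qed (use w in auto)
      then have "(\<lambda>i. LINT \<omega>|M. Q (X i) \<omega>) \<longlonglongrightarrow> 0"
        using LIMSEQ_offset[of "\<lambda>i. LINT \<omega>|M. Q (X i) \<omega>" N] by simp
      moreover have "eventually (\<lambda>i. (LINT \<omega>|M. Q (X i) \<omega>) = ((LINT \<omega>|M. F \<omega> (X i)) - (LINT \<omega>|M. F \<omega> x0) - (LINT \<omega>|M. F' \<omega> x0 (X i - x0))) /\<^sub>R norm (X i - x0)) sequentially"
        unfolding eventually_sequentially
      proof (intro exI allI impI)
        fix i assume "i \<ge> N"
        from int[OF N[OF this]] int[OF x0] int' show "(LINT \<omega>|M. Q (X i) \<omega>) = ((LINT \<omega>|M. F \<omega> (X i)) - (LINT \<omega>|M. F \<omega> x0) - (LINT \<omega>|M. F' \<omega> x0 (X i - x0))) /\<^sub>R norm (X i - x0)"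
          by (simp add: Q_def)
      qed
      ultimately show "(\<lambda>i. ((LINT \<omega>|M. F \<omega> (X i)) - (LINT \<omega>|M. F \<omega> x0) - (LINT \<omega>|M. F' \<omega> x0 (X i - x0))) /\<^sub>R norm (X i - x0)) \<longlonglongrightarrow> 0"
        by (rule Lim_transform_eventually)
    qed
  qed
qed

section \<open>Bounds in terms of coordinate derivatives\<close>

lemma frechet_derivative_sum_axis:
  fixes u :: "real ^ 'n \<Rightarrow> real"
  assumes "u differentiable at x"
  shows "frechet_derivative u (at x) h = (\<Sum>i\<in>UNIV. h $ i * frechet_derivative u (at x) (axis i 1))"
proof -
  have lin: "linear (frechet_derivative u (at x))"
    using assms by (rule linear_frechet_derivative)
  have "frechet_derivative u (at x) h = frechet_derivative u (at x) (\<Sum>i\<in>UNIV. (h $ i) *\<^sub>R axis i 1)"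
    by (simp add: basis_expansion scalar_mult_eq_scaleR[symmetric])
  also have "\<dots> = (\<Sum>i\<in>UNIV. h $ i * frechet_derivative u (at x) (axis i 1))"
    by (simp add: linear_sum[OF lin] linear_scale[OF lin])
  finally show ?thesis .
qed

lemma abs_frechet_derivative_le:
  fixes u :: "real ^ 'n \<Rightarrow> real"
  assumes "u differentiable at x" and K: "\<And>i. \<bar>partial_deriv [i] u x\<bar> \<le> K"
  shows "\<bar>frechet_derivative u (at x) h\<bar> \<le> real CARD('n) * K * norm h"
proof -
  have "\<bar>frechet_derivative u (at x) h\<bar> \<le> (\<Sum>i\<in>(UNIV::'n set). \<bar>h $ i * frechet_derivative u (at x) (axis i 1)\<bar>)"
    unfolding frechet_derivative_sum_axis[OF assms(1), of h] by (rule sum_abs)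
  also have "\<dots> \<le> (\<Sum>i\<in>(UNIV::'n set). norm h * K)"
    unfolding abs_mult using K by (intro sum_mono mult_mono component_le_norm_cart) auto
  finally show ?thesis by (simp add: mult_ac)
qed

lemma abs_diff_le_partial_deriv:
  fixes u :: "real ^ 'n \<Rightarrow> real"
  assumes u: "u differentiable_on UNIV" and K: "\<And>i x. \<bar>partial_deriv [i] u x\<bar> \<le> K"
  shows "\<bar>u y - u x\<bar> \<le> real CARD('n) * K * norm (y - x)"
proof -
  have d: "u differentiable at z" for z using u by (simp add: differentiable_on_eq_differentiable_at)
  have "norm (u y - u x) \<le> real CARD('n) * K * norm (y - x)"
  proof (rule differentiable_bound[of UNIV u "\<lambda>z. frechet_derivative u (at z)"])
    fix z show "(u has_derivative frechet_derivative u (at z)) (at z within UNIV)"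
      using d frechet_derivative_works by blast
    have "0 \<le> K" using order_trans[OF abs_ge_zero K] .
    then show "onorm (frechet_derivative u (at z)) \<le> real CARD('n) * K"
      by (intro onorm_bound) (use abs_frechet_derivative_le[OF d K] in auto)
  qed auto
  then show ?thesis by simp
qed

text \<open>Serves the heat kernel, the Gaussian average, the stable average and the time integral
  alike. The domination is local in x because the translates of a heat kernel have no common
  integrable majorant; it covers all orders at once so that the induction on the list of directions
  keeps it fixed.\<close>

lemma partial_deriv_LINT:
  fixes F :: "'a \<Rightarrow> real ^ 'n \<Rightarrow> real"
  assumes meas: "\<And>x. (\<lambda>\<omega>. F \<omega> x) \<in> borel_measurable M"
    and smooth: "\<And>\<omega>. \<omega> \<in> space M \<Longrightarrow> F \<omega> \<in> Cn_space n"
    and dom: "\<And>x0. \<exists>w. integrable M w \<and> (\<forall>\<omega>\<in>space M. \<forall>x\<in>ball x0 1. \<forall>is. length is \<le> n \<longrightarrow>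
                \<bar>partial_deriv is (F \<omega>) x\<bar> \<le> w \<omega>)"
  shows "length is \<le> n \<Longrightarrow> partial_deriv is (\<lambda>x. LINT \<omega>|M. F \<omega> x) = (\<lambda>x. LINT \<omega>|M. partial_deriv is (F \<omega>) x)"
    and "length is \<le> n \<Longrightarrow> integrable M (\<lambda>\<omega>. partial_deriv is (F \<omega>) x)"
    and "length is < n \<Longrightarrow> partial_deriv is (\<lambda>x. LINT \<omega>|M. F \<omega> x) differentiable_on UNIV"
    and "length is \<le> n \<Longrightarrow> continuous_on UNIV (partial_deriv is (\<lambda>x. LINT \<omega>|M. F \<omega> x))"
    and "(\<And>is x. length is \<le> n \<Longrightarrow> \<bar>partial_deriv is (\<lambda>x. LINT \<omega>|M. F \<omega> x) x\<bar> \<le> K is)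
      \<Longrightarrow> (\<lambda>x. LINT \<omega>|M. F \<omega> x) \<in> Cn_space n"
proof -
  define P where "P is \<longleftrightarrow> (\<forall>x. integrable M (\<lambda>\<omega>. partial_deriv is (F \<omega>) x)) \<and>
      partial_deriv is (\<lambda>x. LINT \<omega>|M. F \<omega> x) = (\<lambda>x. LINT \<omega>|M. partial_deriv is (F \<omega>) x)" for "is"
  have step: "integrable M (\<lambda>\<omega>. partial_deriv (i # is) (F \<omega>) x)" 
      "(partial_deriv is (\<lambda>x. LINT \<omega>|M. F \<omega> x) has_derivative
          (\<lambda>h. LINT \<omega>|M. frechet_derivative (partial_deriv is (F \<omega>)) (at x) h)) (at x)"
    if P: "P is" and len: "length is < n" for "is" i x
  proof -
    obtain w where w: "integrable M w" 
      and bnd: "\<And>\<omega> y js. \<omega>\<in>space M \<Longrightarrow> y \<in>ball x 1 \<Longrightarrow> length js \<le> n \<Longrightarrow> \<bar>partial_deriv js (F \<omega>) y\<bar> \<le> w \<omega>"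
      using dom[of x] by blast
    have d: "partial_deriv is (F \<omega>) differentiable at y" if "\<omega> \<in> space M" for y \<omega>
      using smooth[OF that] len by (auto simp: Cn_space_def differentiable_on_eq_differentiable_at)
    have d': "((partial_deriv is (F \<omega>)) has_derivative frechet_derivative (partial_deriv is (F \<omega>)) (at y)) (at y)"
      if "\<omega> \<in> space M" for y \<omega>
      using d[OF that] frechet_derivative_works by blast
    have b: "\<bar>frechet_derivative (partial_deriv is (F \<omega>)) (at y) h\<bar> \<le> (real CARD('n) * w \<omega>) * norm h"
      if "\<omega> \<in> space M" "y \<in> ball x 1" for y h \<omega>
      using bnd[OF that, of "_ # is"] len by (intro abs_frechet_derivative_le d that) auto
    have m: "(\<lambda>\<omega>. partial_deriv is (F \<omega>) y) \<in> borel_measurable M" for y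
      using P unfolding P_def by (intro borel_measurable_integrable) blast
    note * = has_derivative_LINT[of 1 "\<lambda>\<omega>. partial_deriv is (F \<omega>)" M x
        "\<lambda>\<omega> y. frechet_derivative (partial_deriv is (F \<omega>)) (at y)" "\<lambda>\<omega>. real CARD('n) * w \<omega>"]
    show "(partial_deriv is (\<lambda>x. LINT \<omega>|M. F \<omega> x) has_derivative
          (\<lambda>h. LINT \<omega>|M. frechet_derivative (partial_deriv is (F \<omega>)) (at x) h)) (at x)"
      using P *(1) d' b w m by (auto simp: P_def)
    show "integrable M (\<lambda>\<omega>. partial_deriv (i # is) (F \<omega>) x)"
      using P *(2) d' b w m by (auto simp: P_def)
  qed
  have P: "P is" if "length is \<le> n" for "is"
    using that
  proof (induction "is")
    case Nil
    have "integrable M (\<lambda>\<omega>. F \<omega> x)" for x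
    proof -
      obtain w where w: "integrable M w" 
        and bnd: "\<And>\<omega> y js. \<omega>\<in>space M \<Longrightarrow> y \<in>ball x 1 \<Longrightarrow> length js \<le> n \<Longrightarrow> \<bar>partial_deriv js (F \<omega>) y\<bar> \<le> w \<omega>"
        using dom[of x] by blast
      show ?thesis
        by (rule Bochner_Integration.integrable_bound[OF w meas])
          (use bnd[of _ x "[]"] in \<open>auto intro!: AE_I2 order_trans[OF _ abs_ge_self]\<close>)
    qed
    then show ?case by (simp add: P_def)
  next
    case (Cons i "is")
    then have IH: "P is" and len: "length is < n" by auto
    show ?case
      unfolding P_def using step(1)[OF IH len, of i] frechet_derivative_at[OF step(2)[OF IH len]] 
      by (auto simp: fun_eq_iff)
  qed
  show "partial_deriv is (\<lambda>x. LINT \<omega>|M. F \<omega> x) = (\<lambda>x. LINT \<omega>|M. partial_deriv is (F \<omega>) x)"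
    "integrable M (\<lambda>\<omega>. partial_deriv is (F \<omega>) x)" if "length is \<le> n"
    using P[OF that] by (auto simp: P_def)
  show d: "partial_deriv is (\<lambda>x. LINT \<omega>|M. F \<omega> x) differentiable_on UNIV" if "length is < n" for "is"
    using step(2)[OF P that] that by (auto simp: differentiable_on_eq_differentiable_at differentiable_def)
  show c: "continuous_on UNIV (partial_deriv is (\<lambda>x. LINT \<omega>|M. F \<omega> x))" if len: "length is \<le> n" for "is"
  proof -
    have "continuous (at x) (\<lambda>x. LINT \<omega>|M. partial_deriv is (F \<omega>) x)" for x
    proof -
      obtain w where w: "integrable M w" 
        and bnd: "\<And>\<omega> y js. \<omega>\<in>space M \<Longrightarrow> y \<in>ball x 1 \<Longrightarrow> length js \<le> n \<Longrightarrow> \<bar>partial_deriv js (F \<omega>) y\<bar> \<le> w \<omega>"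
        using dom[of x] by blast
      have "continuous_on (ball x 1) (\<lambda>x. LINT \<omega>|M. partial_deriv is (F \<omega>) x)"
      proof (rule continuous_on_LINT[where w=w])
        fix p assume p: "p \<in> ball x 1"
        show "AE \<omega> in M. continuous (at p within ball x 1) (\<lambda>p. partial_deriv is (F \<omega>) p)"
          using smooth len
          by (intro AE_I2) (auto simp: Cn_space_def continuous_on_eq_continuous_within intro: continuous_at_imp_continuous_at_within)
      qed (use w bnd len P[OF len] in \<open>auto simp: P_def\<close>)
      then show ?thesis by (simp add: continuous_on_eq_continuous_at[OF open_ball])
    qed
    then show ?thesis using P[OF len] by (simp add: P_def continuous_at_imp_continuous_on)
  qed
  show "(\<lambda>x. LINT \<omega>|M. F \<omega> x) \<in> Cn_space n"
    if "\<And>is x. length is \<le> n \<Longrightarrow> \<bar>partial_deriv is (\<lambda>x. LINT \<omega>|M. F \<omega> x) x\<bar> \<le> K is"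
    using d c that unfolding Cn_space_def bounded_iff by fastforce
qed

section \<open>Uniqueness and positivity of inverse Laplace transforms\<close>

text \<open>The sign is opposite to that of the forward difference: on
  \<open>exp (- \<mu> * \<sigma>)\<close>, as a function of \<mu>, it acts as multiplication by
  \<open>1 - exp (- \<sigma>)\<close>, so all its iterates keep the Laplace transform of a
  nonnegative function nonnegative.\<close>

definition bdiff :: "(real \<Rightarrow> real) \<Rightarrow> real \<Rightarrow> real" where
  "bdiff G x = G x - G (x + 1)"

lemma bdiff_funpow_Suc: "(bdiff ^^ Suc m) G x = (bdiff ^^ m) G x - (bdiff ^^ m) G (x + 1)"
  by (simp add: bdiff_def)

lemma bdiff_funpow_Suc': "(bdiff ^^ Suc m) G = (bdiff ^^ m) (bdiff G)"
  by (simp add: funpow_Suc_right del: funpow.simps)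

lemma bdiff_funpow_add: "(bdiff ^^ m) (\<lambda>x. G x + H x) x = (bdiff ^^ m) G x + (bdiff ^^ m) H x"
  by (induction m arbitrary: x) (simp_all add: bdiff_def)

lemma bdiff_funpow_cmult: "(bdiff ^^ m) (\<lambda>x. c * G x) x = c * (bdiff ^^ m) G x"
  by (induction m arbitrary: x) (simp_all add: bdiff_def algebra_simps)

lemma bdiff_funpow_shift: "(bdiff ^^ m) (\<lambda>x. G (x + 1)) x = (bdiff ^^ m) G (x + 1)"
  by (induction m arbitrary: x) (simp_all add: bdiff_def)

lemma bdiff_funpow_tendsto:
  assumes "\<And>x. (\<lambda>n. G n x) \<longlonglongrightarrow> L x"
  shows "(\<lambda>n. (bdiff ^^ m) (G n) x) \<longlonglongrightarrow> (bdiff ^^ m) L x"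
  using assms by (induction m arbitrary: x) (auto simp: bdiff_def intro!: tendsto_diff)

lemma bdiff_funpow_has_real_derivative:
  assumes "\<And>x. x > 0 \<Longrightarrow> (G has_real_derivative G' x) (at x)" "x > 0"
  shows "((bdiff ^^ m) G has_real_derivative (bdiff ^^ m) G' x) (at x)"
  using assms(2)
proof (induction m arbitrary: x)
  case 0
  then show ?case using assms(1) by simp
next
  case (Suc m)
  have "((\<lambda>x. (bdiff ^^ m) G (x + 1)) has_real_derivative (bdiff ^^ m) G' (x + 1)) (at x)"
    using Suc.IH[of "x + 1"] Suc.prems DERIV_shift[of "(bdiff ^^ m) G" _ x 1] by simp
  then have "((\<lambda>x. (bdiff ^^ m) G x - (bdiff ^^ m) G (x + 1)) has_real_derivative (bdiff ^^ m) G' x - (bdiff ^^ m) G' (x + 1)) (at x)"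
    using Suc by (intro DERIV_diff) auto
  then show ?case by (simp add: bdiff_funpow_Suc[abs_def] del: funpow.simps)
qed

lemma bdiff_funpow_powr_deriv:
  "x > 0 \<Longrightarrow> ((bdiff ^^ m) (\<lambda>x. x powr a) has_real_derivative a * (bdiff ^^ m) (\<lambda>x. x powr (a - 1)) x) (at x)"
  using bdiff_funpow_has_real_derivative[of "\<lambda>x. x powr a" "\<lambda>x. a * x powr (a - 1)" x m]
  by (auto simp: bdiff_funpow_cmult intro!: has_real_derivative_powr)

text \<open>The derivative of the m-th difference is a times the m-th difference for the exponent a
  - 1, which is again negative. By induction it is \<le> 0, so the m-th difference decreases and the
  next one is nonnegative.\<close>

lemma bdiff_funpow_powr_nonneg:
  "a < 0 \<Longrightarrow> x > 0 \<Longrightarrow> (bdiff ^^ m) (\<lambda>x. x powr a) x \<ge> 0"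
proof (induction m arbitrary: a x)
  case (Suc m)
  have "(bdiff ^^ m) (\<lambda>x. x powr a) (x + 1) \<le> (bdiff ^^ m) (\<lambda>x. x powr a) x"
  proof (rule DERIV_nonpos_imp_nonincreasing[where f="(bdiff ^^ m) (\<lambda>x. x powr a)"])
    fix y assume "x \<le> y"
    with Suc show "\<exists>d. ((bdiff ^^ m) (\<lambda>x. x powr a) has_real_derivative d) (at y) \<and> d \<le> 0"
      by (intro exI[of _ "a * (bdiff ^^ m) (\<lambda>x. x powr (a - 1)) y"] conjI bdiff_funpow_powr_deriv)
        (auto intro!: mult_nonpos_nonneg Suc.IH)
  qed auto
  then show ?case by (simp add: bdiff_funpow_Suc del: funpow.simps)
qed simp

text \<open>Here s < 1 enters: the derivative of the power has the negative exponent s - 1, so every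
  iterated difference of \<open>x powr s\<close> is nondecreasing. This is the Bernstein property of
  the power.\<close>

lemma bdiff_funpow_powr_nonpos:
  assumes "0 < s" "s < 1" "x > 0"
  shows "(bdiff ^^ Suc m) (\<lambda>x. x powr s) x \<le> 0"
proof -
  have "(bdiff ^^ m) (\<lambda>x. x powr s) x \<le> (bdiff ^^ m) (\<lambda>x. x powr s) (x + 1)"
  proof (rule DERIV_nonneg_imp_nondecreasing[where f="(bdiff ^^ m) (\<lambda>x. x powr s)"])
    fix y assume "x \<le> y"
    with assms show "\<exists>d. ((bdiff ^^ m) (\<lambda>x. x powr s) has_real_derivative d) (at y) \<and> d \<ge> 0"
      by (intro exI[of _ "s * (bdiff ^^ m) (\<lambda>x. x powr (s - 1)) y"] conjI bdiff_funpow_powr_deriv)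
        (auto intro!: mult_nonneg_nonneg bdiff_funpow_powr_nonneg)
  qed auto
  then show ?thesis by (simp add: bdiff_funpow_Suc del: funpow.simps)
qed

text \<open>Complete monotonicity cut off at K: the m-th difference at x reads its function only at
  x, ..., x + m. The cut-off reflects that \<open>1 - t * x powr s / n\<close> is nonnegative on a
  bounded range only.\<close>

definition compl_monotone_upto :: "real \<Rightarrow> (real \<Rightarrow> real) \<Rightarrow> bool" where
  "compl_monotone_upto K G \<longleftrightarrow> (\<forall>m x. 0 < x \<longrightarrow> x + real m \<le> K \<longrightarrow> 0 \<le> (bdiff ^^ m) G x)"

lemma compl_monotone_upto_less:
  assumes "compl_monotone_upto K G"
  shows "compl_monotone_upto (K - 1) G" "compl_monotone_upto (K - 1) (bdiff G)"
    "compl_monotone_upto (K - 1) (\<lambda>x. G (x + 1))"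
proof -
  show "compl_monotone_upto (K - 1) G" using assms by (auto simp: compl_monotone_upto_def)
  show "compl_monotone_upto (K - 1) (bdiff G)"
    unfolding compl_monotone_upto_def bdiff_funpow_Suc'[symmetric]
  proof (intro allI impI)
    fix m x assume "0 < x" "x + real m \<le> K - 1"
    then show "0 \<le> (bdiff ^^ Suc m) G x"
      using assms[unfolded compl_monotone_upto_def, rule_format, of x "Suc m"] by simp
  qed
  show "compl_monotone_upto (K - 1) (\<lambda>x. G (x + 1))"
    using assms by (auto simp: compl_monotone_upto_def bdiff_funpow_shift)
qed

text \<open>Discrete Leibniz rule: the difference of a product is the difference of G times H plus
  the shifted G times the difference of H. All four factors keep the property with K - 1, which
  matches the one difference spent.\<close>

lemma compl_monotone_upto_mult:
  assumes "compl_monotone_upto K G" "compl_monotone_upto K H"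
  shows "compl_monotone_upto K (\<lambda>x. G x * H x)"
proof -
  have "0 \<le> (bdiff ^^ m) (\<lambda>x. G x * H x) x" if "0 < x" "x + real m \<le> K" for m x
    using assms that
  proof (induction m arbitrary: G H K x)
    case 0
    then have "0 \<le> G x" "0 \<le> H x"
      using compl_monotone_upto_def[THEN iffD1, rule_format, of K _ x 0] by auto
    then show ?case by simp
  next
    case (Suc m)
    have eq: "bdiff (\<lambda>x. G x * H x) = (\<lambda>x. bdiff G x * H x + G (x + 1) * bdiff H x)"
      by (auto simp: bdiff_def algebra_simps)
    have "0 \<le> (bdiff ^^ m) (\<lambda>x. bdiff G x * H x) x" "0 \<le> (bdiff ^^ m) (\<lambda>x. G (x + 1) * bdiff H x) x"
      using Suc.prems by (auto intro!: Suc.IH[where K="K - 1"] compl_monotone_upto_less)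
    then show ?case by (simp add: bdiff_funpow_Suc' eq bdiff_funpow_add del: funpow.simps)
  qed
  then show ?thesis by (auto simp: compl_monotone_upto_def)
qed

lemma bdiff_funpow_const: "(bdiff ^^ m) (\<lambda>x. c) x = (if m = 0 then c else 0)"
proof -
  have "(bdiff ^^ k) (\<lambda>x. 0) x = 0" for k x
    by (induction k arbitrary: x) (simp_all add: bdiff_def)
  then have "(bdiff ^^ Suc k) (\<lambda>x. c) x = 0" for k x
    unfolding bdiff_funpow_Suc' by (simp add: bdiff_def[of "\<lambda>x. c", abs_def])
  then show ?thesis by (cases m) (auto simp del: funpow.simps(2))
qed

lemma compl_monotone_upto_power:
  assumes "compl_monotone_upto K G"
  shows "compl_monotone_upto K (\<lambda>x. G x ^ n)"
proof (induction n)
  case 0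
  show ?case by (simp add: compl_monotone_upto_def bdiff_funpow_const)
next
  case (Suc n)
  show ?case unfolding power_Suc by (rule compl_monotone_upto_mult[OF assms Suc])
qed

text \<open>The exponential is the limit of the powers of \<open>1 - t x\<^sup>s / n\<close>, whose base inherits
  the alternating differences of \<open>x\<^sup>s\<close> on the bounded range where it is nonnegative.\<close>
lemma bdiff_funpow_exp_powr_nonneg:
  assumes "0 < s" "s < 1" "t > 0" "x > 0"
  shows "0 \<le> (bdiff ^^ m) (\<lambda>x. exp (- t * x powr s)) x"
proof (rule LIMSEQ_le_const)
  show "(\<lambda>n. (bdiff ^^ m) (\<lambda>x. (1 + (- t * x powr s) / real n) ^ n) x) \<longlonglongrightarrow> (bdiff ^^ m) (\<lambda>x. exp (- t * x powr s)) x"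
    by (rule bdiff_funpow_tendsto) (rule tendsto_exp_limit_sequentially)
  \<comment> \<open>The largest argument that the m-th difference at x reads. From N on, the base of
    the power is nonnegative up to there.\<close>
  define K where "K = x + real m"
  obtain N where N: "real N \<ge> t * K powr s" "N > 0"
    by (metis gr0I linorder_not_less nat_less_real_le of_nat_0_less_iff real_arch_simple order_trans less_imp_le reals_Archimedean2)
  have "0 \<le> (bdiff ^^ m) (\<lambda>x. (1 + (- t * x powr s) / real n) ^ n) x" if n: "n \<ge> N" for n
  proof -
    have n0: "n > 0" "t * K powr s \<le> real n" using N n by linarith+
    have "compl_monotone_upto K (\<lambda>x. 1 + (- t * x powr s) / real n)"
      unfolding compl_monotone_upto_def
    proof (intro allI impI)
      fix k y assume y: "0 < (y::real)" "y + real k \<le> K"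
      show "0 \<le> (bdiff ^^ k) (\<lambda>x. 1 + (- t * x powr s) / real n) y"
      proof (cases k)
        case 0
        have "t * y powr s \<le> t * K powr s" using y assms by (intro mult_left_mono powr_mono2) auto
        then have "t * y powr s / real n \<le> 1" using n0 by (simp add: divide_le_eq_1)
        then show ?thesis using 0 by simp
      next
        case (Suc j)
        have "(bdiff ^^ k) (\<lambda>x. 1 + (- t * x powr s) / real n) y = (bdiff ^^ k) (\<lambda>x. 1 + (- t / real n) * x powr s) y"
          by simp
        also have "\<dots> = (- t / real n) * (bdiff ^^ k) (\<lambda>x. x powr s) y"
          unfolding bdiff_funpow_add bdiff_funpow_cmult bdiff_funpow_const using Suc by simp
        also have "\<dots> \<ge> 0"
          using bdiff_funpow_powr_nonpos[OF assms(1,2) y(1), of j] assms Suc n0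
          by (intro mult_nonpos_nonpos) (auto simp del: funpow.simps)
        finally show ?thesis .
      qed
    qed
    from compl_monotone_upto_power[OF this, of n] assms show ?thesis
      by (simp add: compl_monotone_upto_def K_def)
  qed
  then show "\<exists>N. \<forall>n\<ge>N. 0 \<le> (bdiff ^^ m) (\<lambda>x. (1 + (- t * x powr s) / real n) ^ n) x" by blast
qed

text \<open>With x = exp (-\<sigma>) the weights are x^a (1 - x)^m, so the signs of the differences
  of \<open>F\<close> become the signs of integrals of \<eta> against Bernstein polynomials.\<close>

lemma set_integral_exp_bernstein:
  fixes \<eta> :: "real \<Rightarrow> real"
  assumes int: "\<And>\<mu>. \<mu> > 0 \<Longrightarrow> set_integrable lborel {0<..} (\<lambda>\<sigma>. exp (- \<mu> * \<sigma>) * \<eta> \<sigma>)"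
    and F: "\<And>\<mu>. \<mu> > 0 \<Longrightarrow> (LINT \<sigma>:{0<..}|lborel. exp (- \<mu> * \<sigma>) * \<eta> \<sigma>) = F \<mu>"
    and "a > 0"
  shows "set_integrable lborel {0<..} (\<lambda>\<sigma>. exp (- a * \<sigma>) * (1 - exp (- \<sigma>)) ^ m * \<eta> \<sigma>)"
    "(LINT \<sigma>:{0<..}|lborel. exp (- a * \<sigma>) * (1 - exp (- \<sigma>)) ^ m * \<eta> \<sigma>) = (bdiff ^^ m) F a"
proof -
  have "set_integrable lborel {0<..} (\<lambda>\<sigma>. exp (- a * \<sigma>) * (1 - exp (- \<sigma>)) ^ m * \<eta> \<sigma>) \<and>
    (LINT \<sigma>:{0<..}|lborel. exp (- a * \<sigma>) * (1 - exp (- \<sigma>)) ^ m * \<eta> \<sigma>) = (bdiff ^^ m) F a"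
    using \<open>a > 0\<close>
  proof (induction m arbitrary: a)
    case 0
    then show ?case using int F by simp
  next
    case (Suc m)
    have eq: "(\<lambda>\<sigma>. exp (- a * \<sigma>) * (1 - exp (- \<sigma>)) ^ Suc m * \<eta> \<sigma>) =
      (\<lambda>\<sigma>. exp (- a * \<sigma>) * (1 - exp (- \<sigma>)) ^ m * \<eta> \<sigma> - exp (- (a + 1) * \<sigma>) * (1 - exp (- \<sigma>)) ^ m * \<eta> \<sigma>)"
      by (auto simp: fun_eq_iff algebra_simps exp_add[symmetric] exp_minus exp_diff field_simps)
    show ?case unfolding eq bdiff_funpow_Suc
      using Suc.IH[OF Suc.prems] Suc.IH[of "a + 1"] Suc.prems by (auto intro: set_integral_diff)
  qed
  then show "set_integrable lborel {0<..} (\<lambda>\<sigma>. exp (- a * \<sigma>) * (1 - exp (- \<sigma>)) ^ m * \<eta> \<sigma>)"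
    "(LINT \<sigma>:{0<..}|lborel. exp (- a * \<sigma>) * (1 - exp (- \<sigma>)) ^ m * \<eta> \<sigma>) = (bdiff ^^ m) F a" by auto
qed

text \<open>After the substitution \<open>x = exp (- \<sigma>)\<close> a bump function supported where \<open>\<eta>\<close> is negative is a
  uniform limit of nonnegative combinations of Bernstein polynomials.\<close>
lemma inverse_laplace_nonneg:
  assumes \<eta>: "is_inverse_laplace \<eta> F"
    and nonneg: "\<And>m a. a > 0 \<Longrightarrow> (bdiff ^^ m) F a \<ge> 0"
    and "\<sigma> > 0"
  shows "\<eta> \<sigma> \<ge> 0"
proof (rule ccontr)
  assume neg: "\<not> \<eta> \<sigma> \<ge> 0"
  have int: "\<And>\<mu>. \<mu> > 0 \<Longrightarrow> set_integrable lborel {0<..} (\<lambda>\<sigma>. exp (- \<mu> * \<sigma>) * \<eta> \<sigma>)"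
    and F: "\<And>\<mu>. \<mu> > 0 \<Longrightarrow> (LINT \<sigma>:{0<..}|lborel. exp (- \<mu> * \<sigma>) * \<eta> \<sigma>) = F \<mu>"
    and cont: "continuous_on {0<..} \<eta>"
    using \<eta> by (auto simp: is_inverse_laplace_def)
  define x0 where "x0 = exp (- \<sigma>)"
  have x0: "0 < x0" "x0 < 1" using \<open>\<sigma> > 0\<close> by (auto simp: x0_def)
  have "continuous_on {0<..<1} (\<lambda>x. \<eta> (- ln x))"
    by (intro continuous_on_compose2[OF cont] continuous_intros) auto
  then have "isCont (\<lambda>x. \<eta> (- ln x)) x0"
    using x0 by (simp add: continuous_on_eq_continuous_at)
  moreover have "\<eta> (- ln x0) < 0" using neg by (simp add: x0_def)
  ultimately have "eventually (\<lambda>x. \<eta> (- ln x) < 0) (nhds x0)"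
    unfolding isCont_def using order_tendstoD(2) tendsto_at_iff_tendsto_nhds by blast
  then obtain d where d: "d > 0" "\<And>x. dist x x0 < d \<Longrightarrow> \<eta> (- ln x) < 0"
    by (auto simp: eventually_nhds_metric)
  \<comment> \<open>A tent whose height and radius are both d: it is positive exactly where \<eta>
    is known to be negative.\<close>
  define \<phi> where "\<phi> x = max 0 (d - \<bar>x - x0\<bar>)" for x
  have \<phi>_cont: "continuous_on A \<phi>" for A unfolding \<phi>_def by (intro continuous_intros)
  have \<phi>_nonneg: "\<phi> x \<ge> 0" for x by (simp add: \<phi>_def)
  \<comment> \<open>The factor \<open>exp (- \<tau>)\<close> makes \<eta> integrable and raises the
    exponent k of a Bernstein polynomial to k + 1, which keeps the argument of \<open>F\<close>
    positive even for k = 0.\<close>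
  define w where "w \<tau> = exp (- \<tau>) * \<eta> \<tau>" for \<tau>
  have w_int: "set_integrable lborel {0<..} w" using int[of 1] by (simp add: w_def[abs_def])
  define W where "W = (LINT \<tau>:{0<..}|lborel. \<bar>w \<tau>\<bar>)"
  have W: "W \<ge> 0" unfolding W_def set_lebesgue_integral_def by (intro integral_nonneg_AE) auto
  have \<phi>w_le: "\<phi> (exp (- \<tau>)) * w \<tau> \<le> 0" if "\<tau> > 0" for \<tau>
  proof (cases "\<bar>exp (- \<tau>) - x0\<bar> < d")
    case True
    then have "\<eta> \<tau> < 0" using d(2)[of "exp (- \<tau>)"] by (simp add: dist_real_def)
    then show ?thesis by (simp add: w_def \<phi>_nonneg mult_nonneg_nonpos)
  qed (simp add: \<phi>_def)
  have \<phi>w_int: "set_integrable lborel {0<..} (\<lambda>\<tau>. \<phi> (exp (- \<tau>)) * w \<tau>)"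
  proof (rule set_integrable_bound)
    show "set_integrable lborel {0<..} (\<lambda>\<tau>. d * w \<tau>)" using w_int by simp
    have "\<phi> \<in> borel_measurable borel" using \<phi>_cont by (intro borel_measurable_continuous_onI)
    then have "(\<lambda>x. \<phi> (exp (- x)) * (indicat_real {0<..} x *\<^sub>R w x)) \<in> borel_measurable lborel"
      using w_int unfolding set_integrable_def by measurable
    then show "set_borel_measurable lborel {0<..} (\<lambda>\<tau>. \<phi> (exp (- \<tau>)) * w \<tau>)"
      unfolding set_borel_measurable_def by (simp add: mult_ac)
    show "AE x in lborel. x \<in> {0<..} \<longrightarrow> norm (\<phi> (exp (- x)) * w x) \<le> norm (d * w x)"
      using d by (intro AE_I2) (auto simp: abs_mult \<phi>_def intro!: mult_right_mono)
  qed
  have "0 \<le> (LINT \<tau>:{0<..}|lborel. \<phi> (exp (- \<tau>)) * w \<tau>)"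
  proof (rule field_le_epsilon)
    fix e :: real assume "e > 0"
    \<comment> \<open>A uniform approximation error below e' changes the integral by at most e' W
      \<le> e; the 1 in the denominator guards against W = 0.\<close>
    define e' where "e' = e / (W + 1)"
    have e': "e' > 0" "e' * W \<le> e" using \<open>e > 0\<close> W by (auto simp: e'_def field_simps)
    from Bernstein_Weierstrass[OF \<phi>_cont e'(1)] obtain n where
      n: "\<And>x. x \<in> {0..1} \<Longrightarrow> \<bar>\<phi> x - (\<Sum>k\<le>n. \<phi> (k/n) * Bernstein n k x)\<bar> < e'" by blast
    define B where "B x = (\<Sum>k\<le>n. \<phi> (k/n) * Bernstein n k x)" for x
    have trm: "set_integrable lborel {0<..} (\<lambda>\<tau>. Bernstein n k (exp (- \<tau>)) * w \<tau>)"
      "(LINT \<tau>:{0<..}|lborel. Bernstein n k (exp (- \<tau>)) * w \<tau>) \<ge> 0" for k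
    proof -
      have eq: "(\<lambda>\<tau>. Bernstein n k (exp (- \<tau>)) * w \<tau>) =
        (\<lambda>\<tau>. real (n choose k) * (exp (- real (k + 1) * \<tau>) * (1 - exp (- \<tau>)) ^ (n - k) * \<eta> \<tau>))"
        by (auto simp: fun_eq_iff Bernstein_def w_def exp_of_nat_mult[symmetric] exp_add[symmetric] algebra_simps exp_minus exp_diff field_simps)
      show "set_integrable lborel {0<..} (\<lambda>\<tau>. Bernstein n k (exp (- \<tau>)) * w \<tau>)"
        unfolding eq using set_integral_exp_bernstein(1)[OF int F, of "real (k+1)" "n - k"]
        by (intro set_integrable_mult_right) auto
      show "(LINT \<tau>:{0<..}|lborel. Bernstein n k (exp (- \<tau>)) * w \<tau>) \<ge> 0"
        unfolding eq set_integral_mult_right using set_integral_exp_bernstein(2)[OF int F, of "real (k+1)" "n - k"]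
          nonneg[of "real (k+1)" "n - k"]
        by (intro mult_nonneg_nonneg) auto
    qed
    have eqB: "(\<lambda>\<tau>. B (exp (- \<tau>)) * w \<tau>) = (\<lambda>\<tau>. \<Sum>k\<le>n. \<phi> (k/n) * (Bernstein n k (exp (- \<tau>)) * w \<tau>))"
      by (auto simp: fun_eq_iff B_def sum_distrib_right mult.assoc)
    have B_int: "set_integrable lborel {0<..} (\<lambda>\<tau>. B (exp (- \<tau>)) * w \<tau>)"
      unfolding eqB set_integrable_def scaleR_sum_right
      by (intro Bochner_Integration.integrable_sum set_integrable_mult_right[OF trm(1), unfolded set_integrable_def])
    have "(LINT \<tau>:{0<..}|lborel. B (exp (- \<tau>)) * w \<tau>) = (\<Sum>k\<le>n. \<phi> (k/n) * (LINT \<tau>:{0<..}|lborel. Bernstein n k (exp (- \<tau>)) * w \<tau>))"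
      unfolding eqB set_lebesgue_integral_def scaleR_sum_right
      by (subst Bochner_Integration.integral_sum)
        (intro set_integrable_mult_right[OF trm(1), unfolded set_integrable_def] sum.cong refl
          set_integral_mult_right[unfolded set_lebesgue_integral_def])+
    then have B_nonneg: "0 \<le> (LINT \<tau>:{0<..}|lborel. B (exp (- \<tau>)) * w \<tau>)"
      using trm \<phi>_nonneg by (simp add: sum_nonneg)
    have "(LINT \<tau>:{0<..}|lborel. B (exp (- \<tau>)) * w \<tau>) - (LINT \<tau>:{0<..}|lborel. \<phi> (exp (- \<tau>)) * w \<tau>)
      = (LINT \<tau>:{0<..}|lborel. B (exp (- \<tau>)) * w \<tau> - \<phi> (exp (- \<tau>)) * w \<tau>)"
      by (rule set_integral_diff(2)[OF B_int \<phi>w_int, symmetric])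
    also have "\<dots> \<le> (LINT \<tau>:{0<..}|lborel. e' * \<bar>w \<tau>\<bar>)"
    proof (rule set_integral_mono)
      show "set_integrable lborel {0<..} (\<lambda>\<tau>. B (exp (- \<tau>)) * w \<tau> - \<phi> (exp (- \<tau>)) * w \<tau>)"
        by (rule set_integral_diff(1)[OF B_int \<phi>w_int])
      show "set_integrable lborel {0<..} (\<lambda>\<tau>. e' * \<bar>w \<tau>\<bar>)" using w_int by (simp add: set_integrable_abs)
      fix \<tau> :: real assume "\<tau> \<in> {0<..}"
      then have "\<bar>\<phi> (exp (- \<tau>)) - B (exp (- \<tau>))\<bar> \<le> e'" using n[of "exp (- \<tau>)"] by (simp add: B_def)
      then have "\<bar>B (exp (- \<tau>)) - \<phi> (exp (- \<tau>))\<bar> * \<bar>w \<tau>\<bar> \<le> e' * \<bar>w \<tau>\<bar>"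
        by (intro mult_right_mono) (auto simp: abs_minus_commute)
      then show "B (exp (- \<tau>)) * w \<tau> - \<phi> (exp (- \<tau>)) * w \<tau> \<le> e' * \<bar>w \<tau>\<bar>"
        using abs_ge_self[of "(B (exp (- \<tau>)) - \<phi> (exp (- \<tau>))) * w \<tau>"] by (simp add: abs_mult flip: left_diff_distrib)
    qed
    also have "\<dots> = e' * W" by (simp add: W_def)
    finally show "0 \<le> (LINT \<tau>:{0<..}|lborel. \<phi> (exp (- \<tau>)) * w \<tau>) + e"
      using B_nonneg e' by linarith
  qed
  \<comment> \<open>A nonpositive integrand with nonnegative integral vanishes almost
    everywhere.\<close>
  moreover have "(LINT \<tau>:{0<..}|lborel. \<phi> (exp (- \<tau>)) * w \<tau>) = - (LINT \<tau>:{0<..}|lborel. \<bar>\<phi> (exp (- \<tau>)) * w \<tau>\<bar>)"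
    unfolding set_lebesgue_integral_def
    unfolding integral_minus[symmetric]
    using \<phi>w_le by (intro Bochner_Integration.integral_cong) (auto simp: indicator_def)
  moreover have "(LINT \<tau>:{0<..}|lborel. \<bar>\<phi> (exp (- \<tau>)) * w \<tau>\<bar>) \<ge> 0"
    unfolding set_lebesgue_integral_def by (intro integral_nonneg_AE) auto
  ultimately have "(LINT \<tau>|lborel. indicator {0<..} \<tau> * \<bar>\<phi> (exp (- \<tau>)) * w \<tau>\<bar>) = 0"
    unfolding set_lebesgue_integral_def real_scaleR_def by linarith
  then have AE: "AE \<tau> in lborel. indicator {0<..} \<tau> * \<bar>\<phi> (exp (- \<tau>)) * w \<tau>\<bar> = 0"
    using set_integrable_abs[OF \<phi>w_int] unfolding set_integrable_def
    by (subst (asm) integral_nonneg_eq_0_iff_AE) auto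
  \<comment> \<open>A neighbourhood of \<sigma> on which the integrand is strictly negative; being
    open and nonempty it cannot be null.\<close>
  define U where "U = {\<tau>::real. 0 < \<tau>} \<inter> (\<lambda>\<tau>. exp (- \<tau>)) -` ball x0 d"
  have "open U" unfolding U_def
    by (intro open_Int open_Collect_less continuous_on_open_vimage[THEN iffD1, rule_format] open_vimage continuous_intros) auto
  have U: "\<sigma> \<in> U" using \<open>\<sigma> > 0\<close> d by (auto simp: U_def x0_def)
  have "AE \<tau> in lborel. \<tau> \<notin> U"
    using AE
  proof eventually_elim
    case (elim \<tau>)
    show ?case
    proof
      assume "\<tau> \<in> U"
      then have "\<tau> > 0" and *: "\<bar>exp (- \<tau>) - x0\<bar> < d" by (auto simp: U_def dist_real_def abs_minus_commute)
      then have "\<eta> \<tau> < 0" using d(2)[of "exp (- \<tau>)"] by (simp add: dist_real_def)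
      with * \<open>\<tau> > 0\<close> elim show False by (auto simp: w_def \<phi>_def max_def split: if_splits)
    qed
  qed
  then have "U \<in> null_sets lborel"
    using \<open>open U\<close> by (subst AE_iff_null_sets) auto
  then have "U \<in> null_sets lebesgue" by (rule null_sets_completionI)
  then show False using open_not_negligible[OF \<open>open U\<close>] U by (auto simp: negligible_iff_null_sets)
qed

text \<open>The difference of two candidates has transform 0, whose iterated differences all vanish,
  so positivity applies to it and to its negative.\<close>

lemma inverse_laplace_unique:
  assumes "is_inverse_laplace \<eta> F" "is_inverse_laplace \<xi> F" "\<sigma> > 0"
  shows "\<eta> \<sigma> = \<xi> \<sigma>"
proof -
  have diff: "is_inverse_laplace (\<lambda>x. \<eta> x - \<xi> x) (\<lambda>_. 0)" 
    if "is_inverse_laplace \<eta> F" "is_inverse_laplace \<xi> F" for \<eta> \<xi>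
    using that unfolding is_inverse_laplace_def
    by (auto simp: right_diff_distrib intro!: continuous_intros)
  have "\<eta> \<sigma> - \<xi> \<sigma> \<ge> 0" "\<xi> \<sigma> - \<eta> \<sigma> \<ge> 0"
    using inverse_laplace_nonneg[OF diff] assms by (auto simp: bdiff_funpow_const)
  then show ?thesis by simp
qed

section \<open>Existence of the stable density\<close>

text \<open>Applied three times: to the integrand on the imaginary axis, to the series behind the
  negative moments, and with s = 2 to a polynomial against a Gaussian.\<close>

lemma exp_powr_decay:
  fixes \<kappa> s p :: real
  assumes "\<kappa> > 0" "s > 0" "p \<ge> 0"
  shows "\<exists>C>0. \<forall>y\<ge>0. exp (- \<kappa> * y powr s) * (1 + y) powr p \<le> C"
proof -
  have "((\<lambda>y. exp (- \<kappa> * y powr s) * (1 + y) powr p) \<longlongrightarrow> 0) at_top"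
    using assms(1,2) by real_asymp
  then have "eventually (\<lambda>y. exp (- \<kappa> * y powr s) * (1 + y) powr p < 1) at_top"
    by (rule order_tendstoD) simp
  then obtain Y where Y: "\<And>y. y \<ge> Y \<Longrightarrow> exp (- \<kappa> * y powr s) * (1 + y) powr p < 1"
    by (auto simp: eventually_at_top_linorder)
  have "exp (- \<kappa> * y powr s) * (1 + y) powr p \<le> 1 + (1 + \<bar>Y\<bar>) powr p" if y: "y \<ge> 0" for y
  proof (cases "y \<ge> Y")
    case True
    then show ?thesis using Y[OF True] by (smt (verit) powr_ge_zero)
  next
    case False
    have "exp (- \<kappa> * y powr s) * (1 + y) powr p \<le> 1 * (1 + \<bar>Y\<bar>) powr p"
      using False y assms by (intro mult_mono powr_mono2) auto
    then show ?thesis by simp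
  qed
  then show ?thesis by (intro exI[of _ "1 + (1 + \<bar>Y\<bar>) powr p"]) (auto intro: add_pos_nonneg)
qed

lemma integrable_inverse_1_plus_square: "integrable lborel (\<lambda>y::real. 1 / (1 + y\<^sup>2))"
proof -
  have D: "(arctan has_real_derivative 1 / (1 + x\<^sup>2)) (at x)" for x
    using DERIV_arctan[of x] by (simp add: inverse_eq_divide)
  have "integrable lborel (\<lambda>y::real. indicator UNIV y *\<^sub>R (1 / (1 + y\<^sup>2)))"
    using interval_integral_FTC_nonneg(1)[of "-\<infinity>" "\<infinity>" arctan "\<lambda>y. 1 / (1 + y\<^sup>2)" "- (pi/2)" "pi/2"]
D tendsto_arctan_at_top tendsto_arctan_at_bot
    by (auto simp: set_integrable_def einterval_def ereal_tendsto_simps1 add_nonneg_eq_0_iff intro!: continuous_intros)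
  then show ?thesis by simp
qed

lemma integrable_exp_powr_decay:
  assumes "\<kappa> > 0" "s > 0"
  shows "integrable lborel (\<lambda>y::real. exp (- \<kappa> * \<bar>y\<bar> powr s))"
proof -
  obtain C where C: "C > 0" "\<And>y. y \<ge> 0 \<Longrightarrow> exp (- \<kappa> * y powr s) * (1 + y) powr 2 \<le> C"
    using exp_powr_decay[OF assms, of 2] by auto
  show ?thesis
  proof (rule Bochner_Integration.integrable_bound[OF integrable_mult_right[OF integrable_inverse_1_plus_square, of C]])
    show "AE y in lborel. norm (exp (- \<kappa> * \<bar>y\<bar> powr s)) \<le> norm (C * (1 / (1 + y\<^sup>2)))"
    proof (rule AE_I2)
      fix y :: real
      have "exp (- \<kappa> * \<bar>y\<bar> powr s) * (1 + y\<^sup>2) \<le> exp (- \<kappa> * \<bar>y\<bar> powr s) * (1 + \<bar>y\<bar>) powr 2"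
        by (intro mult_left_mono) (auto simp: power2_eq_square algebra_simps)
      also have "\<dots> \<le> C" using C(2)[of "\<bar>y\<bar>"] by simp
      finally show "norm (exp (- \<kappa> * \<bar>y\<bar> powr s)) \<le> norm (C * (1 / (1 + y\<^sup>2)))"
        using C(1) by (simp add: abs_mult field_simps add_pos_nonneg)
    qed
  qed simp
qed

lemma set_integrable_exp_minus:
  assumes "\<mu> > 0"
  shows "set_integrable lborel {0<..} (\<lambda>\<sigma>::real. exp (- \<mu> * \<sigma>))"
proof -
  have "(\<lambda>\<sigma>. exp (- \<mu> * \<sigma>)) absolutely_integrable_on {0..}"
    using assms by (intro nonnegative_absolutely_integrable_1 integrable_on_exp_minus_to_infinity) auto
  then have "set_integrable lborel {0..} (\<lambda>\<sigma>::real. exp (- \<mu> * \<sigma>))"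
    unfolding set_integrable_def by (subst (asm) integrable_completion) auto
  then show ?thesis by (rule set_integrable_subset) auto
qed

lemma set_integral_exp_minus_complex:
  fixes c w :: complex
  assumes w: "Re w > 0"
  shows "set_integrable lborel {0<..} (\<lambda>\<sigma>::real. c * exp (- w * of_real \<sigma>))"
    and "(LINT \<sigma>:{0<..}|lborel. c * exp (- w * of_real \<sigma>)) = c / w"
proof -
  show int: "set_integrable lborel {0<..} (\<lambda>\<sigma>::real. c * exp (- w * of_real \<sigma>))"
  proof (rule set_integrable_bound[of lborel "{0<..}" "\<lambda>\<sigma>. norm c * exp (- Re w * \<sigma>)"])
    show "set_integrable lborel {0<..} (\<lambda>\<sigma>. norm c * exp (- Re w * \<sigma>))"
      using set_integrable_exp_minus[OF w] by simp
    show "set_borel_measurable lborel {0<..} (\<lambda>\<sigma>. c * exp (- w * of_real \<sigma>))"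
      unfolding set_borel_measurable_def by (intro borel_measurable_scaleR borel_measurable_continuous_onI measurable_lborel2 continuous_intros) auto
  qed (auto simp: norm_mult)
  have w0: "w \<noteq> 0" using w by auto
  have "(LBINT \<sigma>=0..\<infinity>. c * exp (- w * of_real \<sigma>)) = 0 - (- c / w)"
  proof (rule interval_integral_FTC_integrable)
    show "((\<lambda>\<sigma>. - c / w * exp (- w * of_real \<sigma>)) has_vector_derivative c * exp (- w * of_real x)) (at x)" for x :: real
      using w0 by (auto intro!: derivative_eq_intros has_vector_derivative_real_field)
    show "set_integrable lborel (einterval 0 \<infinity>) (\<lambda>\<sigma>::real. c * exp (- w * of_real \<sigma>))"
      using int by (simp add: einterval_def greaterThan_def)
    have "((\<lambda>\<sigma>::real. - c / w * exp (- w * of_real \<sigma>)) \<longlongrightarrow> - c / w * exp (- w * of_real 0)) (at_right 0)"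
      by (intro tendsto_intros)
    then show "(((\<lambda>\<sigma>::real. - c / w * exp (- w * of_real \<sigma>)) \<circ> real_of_ereal) \<longlongrightarrow> - c / w) (at_right 0)"
      by (simp add: ereal_tendsto_simps1 zero_ereal_def)
    have "((\<lambda>\<sigma>::real. - c / w * exp (- w * of_real \<sigma>)) \<longlongrightarrow> 0) at_top"
    proof (rule tendsto_norm_zero_cancel)
      have "((\<lambda>\<sigma>::real. norm (- c / w) * exp (- Re w * \<sigma>)) \<longlongrightarrow> 0) at_top"
        using w by real_asymp
      then show "((\<lambda>\<sigma>::real. norm (- c / w * exp (- w * of_real \<sigma>))) \<longlongrightarrow> 0) at_top"
        by (simp only: norm_mult norm_exp_eq_Re) simp
    qed
    then show "(((\<lambda>\<sigma>::real. - c / w * exp (- w * of_real \<sigma>)) \<circ> real_of_ereal) \<longlongrightarrow> 0) (at_left \<infinity>)"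
      by (simp add: ereal_tendsto_simps1)
  qed (auto intro!: continuous_intros)
  then show "(LINT \<sigma>:{0<..}|lborel. c * exp (- w * of_real \<sigma>)) = c / w"
    by (simp add: interval_lebesgue_integral_def einterval_def greaterThan_def)
qed

section \<open>Bromwich's integral on the imaginary axis\<close>

definition stretched_exp :: "real \<Rightarrow> real \<Rightarrow> complex \<Rightarrow> complex" where
  "stretched_exp s t z = exp (- of_real t * z powr of_real s)"

text \<open>In the half-plane the argument of z has modulus at most pi/2, so that of its s-th power
  has modulus at most s pi/2, where the cosine is still positive. The resulting decay on the
  imaginary axis itself is what allows the line of integration to be placed there.\<close>

lemma Re_powr_ge:
  assumes "Re z \<ge> 0" "0 < s" "s < 1"
  shows "Re (z powr of_real s) \<ge> cos (s * pi / 2) * norm z powr s"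
proof (cases "z = 0")
  case False
  have "\<bar>Arg z\<bar> \<le> pi / 2" using assms(1) Arg_Re_nonneg by blast
  then have "s * \<bar>Arg z\<bar> \<le> s * pi / 2" using assms by simp
  moreover have "s * pi / 2 \<le> pi" using assms by simp
  ultimately have "cos (s * pi / 2) \<le> cos (s * \<bar>Arg z\<bar>)" using assms by (intro cos_monotone_0_pi_le) auto
  also have "\<dots> = cos (s * Arg z)" by (cases "Arg z \<ge> 0") auto
  finally have *: "cos (s * pi / 2) \<le> cos (s * Arg z)" .
  have "Re (z powr of_real s) = norm z powr s * cos (s * Arg z)"
    using False by (simp add: powr_def Re_exp Arg_eq_Im_Ln)
  then show ?thesis using * by (simp add: mult.commute mult_left_mono)
qed simp

lemma norm_stretched_exp_le:
  assumes "Re z \<ge> 0" "0 < s" "s < 1" "t > 0"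
  shows "norm (stretched_exp s t z) \<le> exp (- (t * cos (s * pi / 2)) * norm z powr s)"
  using mult_left_mono[OF Re_powr_ge[OF assms(1-3)], of t] assms by (simp add: stretched_exp_def mult.assoc)

lemma continuous_on_stretched_exp:
  assumes "0 < s"
  shows "continuous_on {z. Re z \<ge> 0} (stretched_exp s t)"
  unfolding stretched_exp_def[abs_def]
  by (intro continuous_intros) (use assms in auto)

lemma field_differentiable_stretched_exp:
  assumes "Re z > 0"
  shows "stretched_exp s t field_differentiable at z"
proof -
  have "z \<notin> \<real>\<^sub>\<le>\<^sub>0" using assms by (auto simp: complex_nonpos_Reals_iff)
  then show ?thesis unfolding stretched_exp_def[abs_def] field_differentiable_def
    by (auto intro!: exI derivative_eq_intros)
qed

lemma stretched_exp_of_real: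
  assumes "\<mu> > 0"
  shows "stretched_exp s t (of_real \<mu>) = of_real (exp (- t * \<mu> powr s))"
  using assms by (simp add: stretched_exp_def powr_of_real exp_of_real[symmetric])

text \<open>Cauchy's formula on the rectangle with corners \<open>\<plusminus> \<i> R\<close> and \<open>R \<plusminus> \<i> R\<close>; the three sides away from
  the imaginary axis contribute nothing in the limit.\<close>
lemma stretched_exp_cauchy:
  assumes s: "0 < s" "s < 1" "t > 0" "\<mu> > 0"
  shows "(\<lambda>n. integral {- real n..real n} (\<lambda>y. stretched_exp s t (\<i> * of_real y) / (of_real \<mu> - \<i> * of_real y)))
    \<longlonglongrightarrow> 2 * pi * of_real (exp (- t * \<mu> powr s))"
proof -
  let ?F = "stretched_exp s t" and ?S = "{z::complex. Re z \<ge> 0}"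
  define \<kappa> where "\<kappa> = t * cos (s * pi / 2)"
  have \<kappa>: "\<kappa> > 0" unfolding \<kappa>_def using s by (intro mult_pos_pos cos_gt_zero) auto
  define g where "g z = ?F z / (z - of_real \<mu>)" for z
  \<comment> \<open>By Cauchy's formula this is the contribution of the three sides off the
    imaginary axis.\<close>
  define E where "E n = 2 * pi * \<i> * of_real (exp (- t * \<mu> powr s)) -
     \<i> * integral {- real n..real n} (\<lambda>y. ?F (\<i> * of_real y) / (of_real \<mu> - \<i> * of_real y))" for n
  have intS: "interior ?S = {z. Re z > 0}"
  proof -
    have "?S = {z. 1 \<bullet> z \<ge> 0}" by simp
    then show ?thesis using interior_halfspace_ge[of "1::complex" 0] by simp
  qed
  \<comment> \<open>The three sides have total length 4 n, and their points have modulus at least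
    n.\<close>
  have bound: "norm (E n) \<le> 4 * real n * (exp (- \<kappa> * real n powr s) / (real n - \<mu>))"
    if n: "real n > \<mu>" for n
  proof -
    define q where "q = exp (- \<kappa> * real n powr s) / (real n - \<mu>)"
    define a b c d where "a = Complex 0 (- real n)" and "b = Complex (real n) (- real n)"
      and "c = Complex (real n) (real n)" and "d = Complex 0 (real n)"
    have n0: "real n > 0" using n s by linarith
    have path: "rectpath a c = linepath a b +++ linepath b c +++ linepath c d +++ linepath d a"
      by (simp add: rectpath_def Let_def a_def b_def c_def d_def)
    have mem: "of_real \<mu> \<in> box a c" using n s by (simp add: in_box_complex_iff a_def c_def)
    have pim: "path_image (rectpath a c) = cbox a c - box a c"
      using n0 by (intro path_image_rectpath_cbox_minus_box) (auto simp: a_def c_def)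
    have cb: "cbox a c \<subseteq> ?S" by (auto simp: in_cbox_complex_iff a_def)
    have "(g has_contour_integral 2 * pi * \<i> * winding_number (rectpath a c) (of_real \<mu>) * ?F (of_real \<mu>)) (rectpath a c)"
      unfolding g_def
    \<comment> \<open>The left side of the rectangle passes through the branch point 0 on the
      boundary of \<open>?S\<close>. This version of the formula asks for continuity on
      \<open>?S\<close> and for differentiability in its interior only.\<close>
    proof (rule Cauchy_integral_formula_convex[where S="?S" and K="{}"])
      show "convex ?S" using convex_halfspace_ge[of 0 "1::complex"] by simp
      show "path_image (rectpath a c) \<subseteq> ?S - {of_real \<mu>}" using pim cb mem by blast
    qed (use s mem in \<open>auto simp: intS intro: continuous_on_stretched_exp field_differentiable_stretched_exp\<close>)
    then have main: "(g has_contour_integral 2 * pi * \<i> * of_real (exp (- t * \<mu> powr s))) (rectpath a c)"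
      using s by (simp add: winding_number_rectpath[OF mem] stretched_exp_of_real)
    have gcont: "continuous_on (?S - {of_real \<mu>}) g"
      unfolding g_def
      by (intro continuous_intros continuous_on_subset[OF continuous_on_stretched_exp]) (use s in auto)
    have seg: "closed_segment a b \<subseteq> cbox a c - box a c" "closed_segment b c \<subseteq> cbox a c - box a c"
      "closed_segment c d \<subseteq> cbox a c - box a c" "closed_segment d a \<subseteq> cbox a c - box a c"
      unfolding pim[symmetric] path by (auto simp: path_image_join)
    have ci: "g contour_integrable_on (linepath u v)" if "closed_segment u v \<subseteq> cbox a c - box a c" for u v
      by (rule contour_integrable_continuous_linepath, rule continuous_on_subset[OF gcont])
        (use that cb mem in blast)
    have "contour_integral (rectpath a c) g = contour_integral (linepath a b) g + (contour_integral (linepath b c) g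
      + (contour_integral (linepath c d) g + contour_integral (linepath d a) g))"
      unfolding path using ci seg by (simp add: contour_integrable_join)
    moreover have "contour_integral (rectpath a c) g = 2 * pi * \<i> * of_real (exp (- t * \<mu> powr s))"
      using main by (rule contour_integral_unique)
    \<comment> \<open>Two signs cancel: the side is traversed downwards, and z - \<mu> is the
      negative of the denominator on the right.\<close>
    moreover have "contour_integral (linepath d a) g = \<i> * integral {- real n..real n} (\<lambda>y. ?F (\<i> * of_real y) / (of_real \<mu> - \<i> * of_real y))"
    proof -
      have "contour_integral (linepath d a) g = - contour_integral (linepath a d) g"
        using contour_integral_reversepath[of "linepath a d" g] by simp
      also have "contour_integral (linepath a d) g = \<i> * integral {- real n..real n} (\<lambda>x. g (Complex 0 x))"
        using n0 by (intro contour_integral_linepath_same_Re) (auto simp: a_def d_def)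
      also have "(\<lambda>x. g (Complex 0 x)) = (\<lambda>y. - (?F (\<i> * of_real y) / (of_real \<mu> - \<i> * of_real y)))"
      proof
        fix y :: real
        have "Complex 0 y = \<i> * of_real y" by (simp add: complex_eq_iff)
        then show "g (Complex 0 y) = - (?F (\<i> * of_real y) / (of_real \<mu> - \<i> * of_real y))"
          unfolding g_def by (simp add: minus_divide_right)
      qed
      finally show ?thesis by simp
    qed
    ultimately have "E n = contour_integral (linepath a b) g + contour_integral (linepath b c) g + contour_integral (linepath c d) g"
      by (simp add: E_def)
    moreover have B: "norm (contour_integral (linepath u v) g) \<le> q * norm (v - u)"
      if "closed_segment u v \<subseteq> cbox a c - box a c" and far: "\<And>z. z \<in> closed_segment u v \<Longrightarrow> Re z = n \<or> \<bar>Im z\<bar> = n" for u v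
    proof (rule contour_integral_bound_linepath[OF ci[OF that(1)]])
      fix z assume z: "z \<in> closed_segment u v"
      then have Re: "Re z \<ge> 0" using that cb by auto
      have nz: "norm z \<ge> n" using far[OF z] abs_Re_le_cmod[of z] abs_Im_le_cmod[of z] by auto
      have "norm (?F z) \<le> exp (- \<kappa> * norm z powr s)"
        using norm_stretched_exp_le[OF Re s(1-3)] by (simp add: \<kappa>_def)
      also have "\<dots> \<le> exp (- \<kappa> * real n powr s)"
        using nz \<kappa> s n0 by (simp add: powr_mono2)
      finally have 1: "norm (?F z) \<le> exp (- \<kappa> * real n powr s)" .
      have "real n - \<mu> \<le> norm (z - of_real \<mu>)" using nz norm_triangle_ineq2[of z "of_real \<mu>"] s by simp
      then show "norm (g z) \<le> q"
        unfolding q_def g_def norm_divide using 1 n by (intro frac_le) auto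
    qed (use n in \<open>auto simp: q_def\<close>)
    have "norm (contour_integral (linepath a b) g) \<le> q * norm (b - a)"
      by (rule B[OF seg(1)]) (auto simp: a_def b_def closed_segment_same_Im)
    moreover have "norm (contour_integral (linepath b c) g) \<le> q * norm (c - b)"
      by (rule B[OF seg(2)]) (auto simp: c_def b_def closed_segment_same_Re)
    moreover have "norm (contour_integral (linepath c d) g) \<le> q * norm (d - c)"
      by (rule B[OF seg(3)]) (auto simp: c_def d_def closed_segment_same_Im)
    moreover have "norm (b - a) = n" "norm (c - b) = 2 * n" "norm (d - c) = n"
      by (auto simp: a_def b_def c_def d_def cmod_def real_sqrt_mult)
    ultimately have "norm (E n) \<le> 4 * real n * q"
      using norm_triangle_ineq[of "contour_integral (linepath a b) g + contour_integral (linepath b c) g" "contour_integral (linepath c d) g"]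
        norm_triangle_ineq[of "contour_integral (linepath a b) g" "contour_integral (linepath b c) g"]
      by (simp add: mult.commute)
    then show ?thesis by (simp add: q_def)
  qed
  have "(\<lambda>n. E n) \<longlonglongrightarrow> 0"
  proof (rule Lim_null_comparison)
    show "(\<lambda>n. 4 * real n * (exp (- \<kappa> * real n powr s) / (real n - \<mu>))) \<longlonglongrightarrow> 0"
      using \<kappa> s by real_asymp
    have "eventually (\<lambda>n. real n > \<mu>) sequentially" by real_asymp
    then show "eventually (\<lambda>n. norm (E n) \<le> 4 * real n * (exp (- \<kappa> * real n powr s) / (real n - \<mu>))) sequentially"
      by eventually_elim (rule bound)
  qed
  then have "(\<lambda>n. 2 * pi * of_real (exp (- t * \<mu> powr s)) - E n / \<i>) \<longlonglongrightarrow> 2 * pi * of_real (exp (- t * \<mu> powr s)) - 0 / \<i>"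
    by (intro tendsto_intros) auto
  moreover have "2 * pi * of_real (exp (- t * \<mu> powr s)) - E n / \<i> = integral {- real n..real n} (\<lambda>y. ?F (\<i> * of_real y) / (of_real \<mu> - \<i> * of_real y))" for n
    by (simp add: E_def field_simps)
  ultimately show ?thesis by simp
qed

text \<open>Bromwich's inversion formula, with the vertical line of integration moved to the imaginary axis.\<close>
lemma ex_inverse_laplace_stretched_exp:
  assumes s: "0 < s" "s < 1" "t > 0"
  shows "\<exists>\<eta>. is_inverse_laplace \<eta> (\<lambda>\<mu>. exp (- t * \<mu> powr s))"
proof -
  let ?F = "\<lambda>y. stretched_exp s t (\<i> * of_real y)"
  define \<kappa> where "\<kappa> = t * cos (s * pi / 2)"
  have \<kappa>: "\<kappa> > 0" unfolding \<kappa>_def using s by (intro mult_pos_pos cos_gt_zero) auto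
  define w where "w y = exp (- \<kappa> * \<bar>y\<bar> powr s)" for y
  have w_int: "integrable lborel w" unfolding w_def[abs_def] by (rule integrable_exp_powr_decay) (use \<kappa> s in auto)
  have w0: "w y \<ge> 0" for y by (simp add: w_def)
  have F_le: "norm (?F y) \<le> w y" for y
    using norm_stretched_exp_le[of "\<i> * of_real y" s t] s by (simp add: w_def \<kappa>_def norm_mult)
  have F_cont: "continuous_on A ?F" for A
    by (rule continuous_on_compose2[OF continuous_on_stretched_exp[OF s(1)]]) (auto intro!: continuous_intros)
  have F_meas[measurable]: "?F \<in> borel_measurable borel" by (intro borel_measurable_continuous_onI F_cont)
  \<comment> \<open>The real part makes \<eta> real by construction. It does not disturb the
    transform, since the value that Cauchy's formula finally delivers is real.\<close>
  define k where "k \<sigma> y = Re (?F y * exp (\<i> * of_real (y * \<sigma>)))" for \<sigma> y :: real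
  have k_le: "\<bar>k \<sigma> y\<bar> \<le> w y" for \<sigma> y
  proof -
    have "norm (?F y * exp (\<i> * of_real (y * \<sigma>))) \<le> w y" using F_le[of y] by (simp add: norm_mult)
    then show ?thesis unfolding k_def using abs_Re_le_cmod order_trans by blast
  qed
  define \<eta> where "\<eta> \<sigma> = (LINT y|lborel. k \<sigma> y) / (2 * pi)" for \<sigma>
  have "continuous_on UNIV (\<lambda>\<sigma>. LINT y|lborel. k \<sigma> y)"
  proof (rule continuous_on_LINT[where w=w])
    show "k p \<in> borel_measurable lborel" for p unfolding k_def[abs_def] by measurable
    have "continuous_on UNIV (\<lambda>p. k p y)" for y unfolding k_def by (intro continuous_intros)
    then show "AE y in lborel. continuous (at p) (\<lambda>p. k p y)" for p
      by (simp add: continuous_on_eq_continuous_at)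
  qed (use k_le w_int in auto)
  then have \<eta>_cont: "continuous_on UNIV \<eta>" unfolding \<eta>_def by (intro continuous_intros) auto
  define W where "W = integral\<^sup>L lborel w"
  have k_int: "integrable lborel (k \<sigma>)" for \<sigma>
    by (rule Bochner_Integration.integrable_bound[OF w_int])
      (use k_le w0 in \<open>auto simp: k_def[abs_def]\<close>)
  have \<eta>_le: "\<bar>\<eta> \<sigma>\<bar> \<le> W" for \<sigma>
  proof -
    have "\<bar>LINT y|lborel. k \<sigma> y\<bar> \<le> W"
      unfolding W_def by (rule order_trans[OF integral_abs_bound], rule integral_mono) (use k_int w_int k_le in auto)
    moreover have "W \<ge> 0" unfolding W_def by (simp add: w0)
    moreover have "2 * pi \<ge> 1" using pi_gt3 by simp
    ultimately show ?thesis unfolding \<eta>_def abs_divide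
      by (simp add: divide_le_eq) (metis mult.commute mult_left_mono mult_1 order_trans)
  qed
  have "is_inverse_laplace \<eta> (\<lambda>\<mu>. exp (- t * \<mu> powr s))"
    unfolding is_inverse_laplace_def
  proof (intro conjI allI impI)
    show "continuous_on {0<..} \<eta>" using \<eta>_cont continuous_on_subset by blast
    fix \<mu> :: real assume \<mu>: "\<mu> > 0"
    have [measurable]: "\<eta> \<in> borel_measurable borel" using \<eta>_cont by (intro borel_measurable_continuous_onI)
    show "set_integrable lborel {0<..} (\<lambda>\<sigma>. exp (- \<mu> * \<sigma>) * \<eta> \<sigma>)"
    proof (rule set_integrable_bound[of _ _ "\<lambda>\<sigma>. W * exp (- \<mu> * \<sigma>)"])
      show "set_integrable lborel {0<..} (\<lambda>\<sigma>. W * exp (- \<mu> * \<sigma>))" using set_integrable_exp_minus[OF \<mu>] by simp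
      show "AE x in lborel. x \<in> {0<..} \<longrightarrow> norm (exp (- \<mu> * x) * \<eta> x) \<le> norm (W * exp (- \<mu> * x))"
        using order_trans[OF \<eta>_le abs_ge_self] by (intro AE_I2) (auto simp: abs_mult mult.commute)
    qed (auto simp: set_borel_measurable_def)
    \<comment> \<open>The double integrand, dominated by a product of integrable functions of
      \<sigma> and of y. Integrating over \<sigma> first turns the oscillation into 1/(\<mu> - i y),
      the kernel of Cauchy's formula.\<close>
    define G where "G \<sigma> y = indicator {0<..} \<sigma> * exp (- \<mu> * \<sigma>) * k \<sigma> y" for \<sigma> y :: real
    have e_int: "integrable lborel (\<lambda>\<sigma>. indicator {0<..} \<sigma> * exp (- \<mu> * \<sigma>) :: real)"
      using set_integrable_exp_minus[OF \<mu>] by (simp add: set_integrable_def)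
    have G_int: "integrable (lborel \<Otimes>\<^sub>M lborel) (case_prod G)"
    proof (rule Bochner_Integration.integrable_bound)
      show "integrable (lborel \<Otimes>\<^sub>M lborel) (\<lambda>(\<sigma>, y). (indicator {0<..} \<sigma> * exp (- \<mu> * \<sigma>)) * w y :: real)"
        using e_int w_int by (intro lborel_pair.Fubini_integrable) (auto simp: abs_mult)
      show "case_prod G \<in> borel_measurable (lborel \<Otimes>\<^sub>M lborel)"
        unfolding G_def k_def by measurable
      show "AE x in lborel \<Otimes>\<^sub>M lborel. norm (case_prod G x) \<le> norm (case x of (\<sigma>, y) \<Rightarrow> indicator {0<..} \<sigma> * exp (- \<mu> * \<sigma>) * w y)"
        using order_trans[OF k_le abs_ge_self] by (intro AE_I2) (auto simp: G_def abs_mult split: prod.split intro!: mult_left_mono)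
    qed
    have inner: "(LINT \<sigma>|lborel. G \<sigma> y) = Re (?F y / (of_real \<mu> - \<i> * of_real y))" for y
    proof -
      have *: "set_integrable lborel {0<..} (\<lambda>\<sigma>. ?F y * exp (- (of_real \<mu> - \<i> * of_real y) * of_real \<sigma>))"
        "(LINT \<sigma>:{0<..}|lborel. ?F y * exp (- (of_real \<mu> - \<i> * of_real y) * of_real \<sigma>)) = ?F y / (of_real \<mu> - \<i> * of_real y)"
        by (rule set_integral_exp_minus_complex, use \<mu> in simp)+
      have e: "exp (- (of_real \<mu> - \<i> * of_real y) * of_real \<sigma>) = of_real (exp (- \<mu> * \<sigma>)) * exp (\<i> * of_real (y * \<sigma>))" for \<sigma>
        unfolding exp_of_real[symmetric] exp_add[symmetric] by (simp add: algebra_simps)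
      have "(LINT \<sigma>|lborel. G \<sigma> y) = (LINT \<sigma>|lborel. Re (indicator {0<..} \<sigma> *\<^sub>R (?F y * exp (- (of_real \<mu> - \<i> * of_real y) * of_real \<sigma>))))"
        unfolding e by (rule Bochner_Integration.integral_cong) (simp_all add: G_def k_def algebra_simps)
      also have "\<dots> = Re (LINT \<sigma>:{0<..}|lborel. ?F y * exp (- (of_real \<mu> - \<i> * of_real y) * of_real \<sigma>))"
        unfolding set_lebesgue_integral_def by (rule integral_Re[OF *(1)[unfolded set_integrable_def]])
      finally show ?thesis unfolding *(2) .
    qed
    have "(LINT \<sigma>:{0<..}|lborel. exp (- \<mu> * \<sigma>) * \<eta> \<sigma>) = (LINT \<sigma>|lborel. (LINT y|lborel. G \<sigma> y)) / (2 * pi)"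
      unfolding set_lebesgue_integral_def G_def \<eta>_def by (simp add: mult.assoc)
    also have "(LINT \<sigma>|lborel. (LINT y|lborel. G \<sigma> y)) = (LINT y|lborel. (LINT \<sigma>|lborel. G \<sigma> y))"
      by (rule lborel_pair.Fubini_integral[OF G_int, symmetric])
    also have "\<dots> = (LINT y|lborel. Re (?F y / (of_real \<mu> - \<i> * of_real y)))"
      by (simp add: inner)
    also have "\<dots> = 2 * pi * exp (- t * \<mu> powr s)"
    proof -
      define H where "H y = ?F y / (of_real \<mu> - \<i> * of_real y)" for y
      have den: "of_real \<mu> - \<i> * of_real y \<noteq> 0" for y using \<mu> by (simp add: complex_eq_iff)
      have H_cont: "continuous_on A H" for A unfolding H_def
        by (intro continuous_intros F_cont) (use den in auto)
      have [measurable]: "H \<in> borel_measurable borel" by (intro borel_measurable_continuous_onI H_cont)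
      have H_le: "norm (H y) \<le> w y / \<mu>" for y
        unfolding H_def norm_divide using F_le[of y] \<mu> abs_Re_le_cmod[of "of_real \<mu> - \<i> * of_real y"]
        by (intro frac_le w0) auto
      \<comment> \<open>Cauchy's formula gives a limit of truncated integrals; dominated convergence
        identifies it with the Lebesgue integral.\<close>
      have "(\<lambda>n. LINT y|lborel. indicator {- real n..real n} y *\<^sub>R H y) \<longlonglongrightarrow> (LINT y|lborel. H y)"
      proof (rule integral_dominated_convergence[where w="\<lambda>y. w y / \<mu>"])
        show "AE y in lborel. (\<lambda>n. indicator {- real n..real n} y *\<^sub>R H y) \<longlonglongrightarrow> H y"
        proof (rule AE_I2)
          fix y :: real
          have "eventually (\<lambda>n. real n > \<bar>y\<bar>) sequentially" by real_asymp
          then have "eventually (\<lambda>n. H y = indicator {- real n..real n} y *\<^sub>R H y) sequentially"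
            by eventually_elim (auto simp: indicator_def)
          then show "(\<lambda>n. indicator {- real n..real n} y *\<^sub>R H y) \<longlonglongrightarrow> H y"
            by (rule Lim_transform_eventually[OF tendsto_const])
        qed
        show "AE y in lborel. norm (indicator {- real n..real n} y *\<^sub>R H y) \<le> w y / \<mu>" for n
          using H_le w0 \<mu> by (intro AE_I2) (auto simp: indicator_def)
      qed (use w_int in auto)
      moreover have "(LINT y|lborel. indicator {- real n..real n} y *\<^sub>R H y) = integral {- real n..real n} H" for n
        using set_borel_integral_eq_integral(2)[OF borel_integrable_compact[OF _ H_cont, of "{- real n..real n}", unfolded set_integrable_def[symmetric]]]
        by (simp add: set_lebesgue_integral_def)
      ultimately have "(\<lambda>n. integral {- real n..real n} H) \<longlonglongrightarrow> (LINT y|lborel. H y)" by simp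
      then have "(LINT y|lborel. H y) = 2 * pi * of_real (exp (- t * \<mu> powr s))"
        using stretched_exp_cauchy[OF s \<mu>] LIMSEQ_unique unfolding H_def by blast
      moreover have "integrable lborel H"
        by (rule Bochner_Integration.integrable_bound[of _ "\<lambda>y. w y / \<mu>"])
          (use w_int H_le w0 \<mu> in auto)
      ultimately show ?thesis by (simp add: H_def[symmetric])
    qed
    finally show "(LINT \<sigma>:{0<..}|lborel. exp (- \<mu> * \<sigma>) * \<eta> \<sigma>) = exp (- t * \<mu> powr s)" by simp
  qed
  then show ?thesis by blast
qed

section \<open>The stable law and its negative moments\<close>

context
  fixes s t :: real
  assumes s: "0 < s" "s < 1" and t: "t > 0"
begin

lemma stable_density_inverse_laplace: "is_inverse_laplace (stable_density s t) (\<lambda>\<mu>. exp (- t * \<mu> powr s))"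
  unfolding stable_density_def by (rule someI_ex[OF ex_inverse_laplace_stretched_exp[OF s t]])

lemma stable_density_nonneg: "\<sigma> > 0 \<Longrightarrow> stable_density s t \<sigma> \<ge> 0"
  by (rule inverse_laplace_nonneg[OF stable_density_inverse_laplace bdiff_funpow_exp_powr_nonneg[OF s t]])

end

text \<open>With c = t^(1/s) the rescaled density has transform exp (-(c \<mu>)^s) = exp (-t
  \<mu>^s), and uniqueness identifies it. Estimates for all times thereby reduce to the law at time
  1.\<close>

lemma stable_density_scaling:
  assumes s: "0 < s" "s < 1" and t: "t > 0" and "\<sigma> > 0"
  shows "stable_density s t \<sigma> = stable_density s 1 (\<sigma> / t powr (1 / s)) / t powr (1 / s)"
proof (rule inverse_laplace_unique[OF stable_density_inverse_laplace[OF s t] _ \<open>\<sigma> > 0\<close>])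
  define c where "c = t powr (1 / s)"
  have c: "c > 0" using t by (simp add: c_def)
  let ?\<eta> = "stable_density s 1"
  have \<eta>: "is_inverse_laplace ?\<eta> (\<lambda>\<mu>. exp (- 1 * \<mu> powr s))"
    by (rule stable_density_inverse_laplace[OF s]) simp
  have "is_inverse_laplace (\<lambda>\<sigma>. ?\<eta> (\<sigma> / c) / c) (\<lambda>\<mu>. exp (- t * \<mu> powr s))"
    unfolding is_inverse_laplace_def
  proof (intro conjI allI impI)
    have "continuous_on {0<..} ?\<eta>" using \<eta> by (simp add: is_inverse_laplace_def)
    then have "continuous_on {0<..} (\<lambda>\<sigma>. ?\<eta> (\<sigma> / c))"
      by (rule continuous_on_compose2) (use c in \<open>auto intro!: continuous_intros\<close>)
    then show "continuous_on {0<..} (\<lambda>\<sigma>. ?\<eta> (\<sigma> / c) / c)"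
      by (rule continuous_on_divide) (use c in auto)
    fix \<mu> :: real assume \<mu>: "\<mu> > 0"
    have *: "set_integrable lborel {0<..} (\<lambda>\<sigma>. exp (- (\<mu> * c) * \<sigma>) * ?\<eta> \<sigma>)"
      "(LINT \<sigma>:{0<..}|lborel. exp (- (\<mu> * c) * \<sigma>) * ?\<eta> \<sigma>) = exp (- 1 * (\<mu> * c) powr s)"
      using \<eta>[unfolded is_inverse_laplace_def, THEN conjunct2, rule_format, of "\<mu> * c"] \<mu> c by simp_all
    define F where "F \<sigma> = indicator {0<..} \<sigma> *\<^sub>R (exp (- \<mu> * \<sigma>) * (?\<eta> (\<sigma> / c) / c))" for \<sigma> :: real
    have eq: "(\<lambda>\<sigma>. F (0 + c * \<sigma>)) =
      (\<lambda>\<sigma>. (1 / c) * (indicator {0<..} \<sigma> *\<^sub>R (exp (- (\<mu> * c) * \<sigma>) * ?\<eta> \<sigma>)))"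
      using c by (auto simp: F_def fun_eq_iff indicator_def zero_less_mult_iff mult_ac)
    show "set_integrable lborel {0<..} (\<lambda>\<sigma>. exp (- \<mu> * \<sigma>) * (?\<eta> (\<sigma> / c) / c))"
    proof -
      have "integrable lborel (\<lambda>\<sigma>. F (0 + c * \<sigma>))"
        unfolding eq using *(1)[unfolded set_integrable_def] by (rule integrable_mult_right)
      then have "integrable lborel F" using lborel_integrable_real_affine_iff[of c F 0] c by simp
      then show ?thesis by (simp only: set_integrable_def F_def[abs_def])
    qed
    have "(LINT \<sigma>:{0<..}|lborel. exp (- \<mu> * \<sigma>) * (?\<eta> (\<sigma> / c) / c)) = \<bar>c\<bar> *\<^sub>R (LINT \<sigma>|lborel. (1 / c) * (indicator {0<..} \<sigma> *\<^sub>R (exp (- (\<mu> * c) * \<sigma>) * ?\<eta> \<sigma>)))"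
      using lborel_integral_real_affine[of c F 0] c unfolding eq by (simp add: set_lebesgue_integral_def F_def)
    also have "\<dots> = exp (- 1 * (\<mu> * c) powr s)"
      using c *(2) unfolding set_lebesgue_integral_def by simp
    also have "(\<mu> * c) powr s = t * \<mu> powr s"
      using \<mu> c s t by (simp add: powr_mult c_def powr_powr)
    finally show "(LINT \<sigma>:{0<..}|lborel. exp (- \<mu> * \<sigma>) * (?\<eta> (\<sigma> / c) / c)) = exp (- t * \<mu> powr s)" by simp
  qed
  then show "is_inverse_laplace (\<lambda>\<sigma>. ?\<eta> (\<sigma> / t powr (1 / s)) / t powr (1 / s)) (\<lambda>\<mu>. exp (- t * \<mu> powr s))"
    by (simp add: c_def)
qed

text \<open>Off the positive half-line \<open>stable_density\<close> is arbitrary, so the law lives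
  on the restricted space; membership in \<open>space\<close> then supplies \<rho> > 0.\<close>

definition stable_measure :: "real \<Rightarrow> real measure" where
  "stable_measure s = density (restrict_space lborel {0<..}) (\<lambda>\<rho>. ennreal (stable_density s 1 \<rho>))"

lemma space_stable_measure [simp]: "space (stable_measure s) = {0<..}"
  by (simp add: stable_measure_def space_restrict_space)

lemma sets_stable_measure [measurable_cong]: "sets (stable_measure s) = sets (restrict_space borel {0<..})"
  by (simp add: stable_measure_def sets_restrict_space)

lemma borel_measurable_stable_measureI:
  fixes f :: "real \<Rightarrow> real"
  shows "continuous_on {0<..} f \<Longrightarrow> f \<in> borel_measurable (stable_measure s)"
  using borel_measurable_continuous_on_restrict[of "{0<..}" f] measurable_cong_sets[OF sets_stable_measure refl, of s borel] by auto

context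
  fixes s :: real
  assumes s: "0 < s" "s < 1"
begin

lemma stable_density_measurable: "stable_density s 1 \<in> borel_measurable (restrict_space lborel {0<..})"
proof -
  have "continuous_on {0<..} (stable_density s 1)"
    using stable_density_inverse_laplace[OF s, of 1] by (simp add: is_inverse_laplace_def)
  from borel_measurable_continuous_on_restrict[OF this]
  show ?thesis using measurable_cong_sets[of "restrict_space borel {0<..}" "restrict_space lborel {0<..}"]
    by (simp add: sets_restrict_space)
qed

lemma nn_integral_stable_measure_exp:
  assumes "\<mu> > 0"
  shows "(\<integral>\<^sup>+ \<rho>. ennreal (exp (- \<mu> * \<rho>)) \<partial>stable_measure s) = ennreal (exp (- (\<mu> powr s)))"
proof -
  note L = stable_density_inverse_laplace[OF s, of 1, unfolded is_inverse_laplace_def]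
  have pos: "0 < \<rho> \<Longrightarrow> stable_density s 1 \<rho> \<ge> 0" for \<rho> by (rule stable_density_nonneg[OF s]) auto
  have "(\<integral>\<^sup>+ \<rho>. ennreal (exp (- \<mu> * \<rho>)) \<partial>stable_measure s) =
     (\<integral>\<^sup>+ \<rho>. ennreal (stable_density s 1 \<rho>) * ennreal (exp (- \<mu> * \<rho>)) \<partial>restrict_space lborel {0<..})"
    unfolding stable_measure_def using stable_density_measurable
    by (subst nn_integral_density) (auto intro!: measurable_restrict_space1)
  also have "\<dots> = (\<integral>\<^sup>+ \<rho>. ennreal (stable_density s 1 \<rho>) * ennreal (exp (- \<mu> * \<rho>)) * indicator {0<..} \<rho> \<partial>lborel)"
    by (subst nn_integral_restrict_space) auto
  also have "\<dots> = (\<integral>\<^sup>+ \<rho>. ennreal (indicator {0<..} \<rho> *\<^sub>R (exp (- \<mu> * \<rho>) * stable_density s 1 \<rho>)) \<partial>lborel)"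
    by (intro nn_integral_cong) (auto simp: indicator_def pos ennreal_mult[symmetric] mult.commute)
  also have "\<dots> = ennreal (LINT \<rho>:{0<..}|lborel. exp (- \<mu> * \<rho>) * stable_density s 1 \<rho>)"
    unfolding set_lebesgue_integral_def
    by (rule nn_integral_eq_integral) (use L assms pos in \<open>auto simp: set_integrable_def indicator_def\<close>)
  also have "\<dots> = ennreal (exp (- (\<mu> powr s)))" using L assms by simp
  finally show ?thesis .
qed

text \<open>Let \<mu> = 1/(n+1) decrease to 0 in the Laplace transform and use monotone convergence.
  The absolute value keeps the sequence increasing at negative arguments too.\<close>

lemma prob_space_stable_measure: "prob_space (stable_measure s)"
proof
  have "(\<lambda>n. \<integral>\<^sup>+ \<rho>. ennreal (exp (- (1 / real (Suc n)) * \<bar>\<rho>\<bar>)) \<partial>stable_measure s) \<longlonglongrightarrow> (\<integral>\<^sup>+ \<rho>. 1 \<partial>stable_measure s)"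
  proof (rule nn_integral_LIMSEQ)
    show "incseq (\<lambda>n \<rho>. ennreal (exp (- (1 / real (Suc n)) * \<bar>\<rho>\<bar>)))"
      by (auto simp: incseq_def le_fun_def intro!: ennreal_leI mult_right_mono divide_left_mono)
    fix x :: real
    have "(\<lambda>n. exp (- (1 / real (Suc n)) * \<bar>x\<bar>)) \<longlonglongrightarrow> exp (- 0 * \<bar>x\<bar>)"
      by (intro tendsto_intros LIMSEQ_Suc[OF lim_1_over_n])
    then have "(\<lambda>n. ennreal (exp (- (1 / real (Suc n)) * \<bar>x\<bar>))) \<longlonglongrightarrow> ennreal (exp (- 0 * \<bar>x\<bar>))"
      by (rule tendsto_ennrealI)
    then show "(\<lambda>n. ennreal (exp (- (1 / real (Suc n)) * \<bar>x\<bar>))) \<longlonglongrightarrow> 1" by simp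
  qed (auto intro!: borel_measurable_stable_measureI continuous_intros measurable_compose[OF _ measurable_ennreal])
  moreover have "(\<lambda>n. \<integral>\<^sup>+ \<rho>. ennreal (exp (- (1 / real (Suc n)) * \<bar>\<rho>\<bar>)) \<partial>stable_measure s) \<longlonglongrightarrow> 1"
  proof -
    have eq: "(\<integral>\<^sup>+ \<rho>. ennreal (exp (- (1 / real (Suc n)) * \<bar>\<rho>\<bar>)) \<partial>stable_measure s) =
      (\<integral>\<^sup>+ \<rho>. ennreal (exp (- (1 / real (Suc n)) * \<rho>)) \<partial>stable_measure s)" for n
      by (intro nn_integral_cong) simp
    have "(\<lambda>n. exp (- ((1 / real (Suc n)) powr s))) \<longlonglongrightarrow> 1"
      using s by real_asymp
    then have "(\<lambda>n. ennreal (exp (- ((1 / real (Suc n)) powr s)))) \<longlonglongrightarrow> ennreal 1"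
      by (rule tendsto_ennrealI)
    then show ?thesis unfolding eq by (subst nn_integral_stable_measure_exp) auto
  qed
  ultimately show "emeasure (stable_measure s) (space (stable_measure s)) = 1"
    using LIMSEQ_unique by fastforce
qed

text \<open>Negative moments are controlled by \<open>\<Sum> k e\<^bsup>-k\<rho>\<^esup> = e\<^bsup>-\<rho>\<^esup> / (1 - e\<^bsup>-\<rho>\<^esup>)\<^sup>2\<close>, whose summands
  integrate to \<open>k e\<^bsup>-k^s\<^esup>\<close>.\<close>
lemma integrable_stable_measure_powr:
  assumes a: "0 \<le> a" "a \<le> 2"
  shows "integrable (stable_measure s) (\<lambda>\<rho>. \<rho> powr (- a))"
proof -
  interpret prob_space "stable_measure s" by (rule prob_space_stable_measure)
  define e where "e n \<rho> = real (Suc n) * exp (- real (Suc n) * \<rho>)" for n \<rho>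
  have le: "\<rho> powr (- a) \<le> 1 + exp 1 * (\<Sum>n. e n \<rho>)" and summ: "summable (\<lambda>n. e n \<rho>)" if "\<rho> > 0" for \<rho>
  proof -
    have sums: "(\<lambda>n. e n \<rho>) sums (exp (- \<rho>) * (1 / (1 - exp (- \<rho>))\<^sup>2))"
    proof -
      have "(\<lambda>n. exp (- \<rho>) * (of_nat (Suc n) * exp (- \<rho>) ^ n)) sums (exp (- \<rho>) * (1 / (1 - exp (- \<rho>))\<^sup>2))"
        using that by (intro sums_mult geometric_deriv_sums) auto
      moreover have "exp (- \<rho>) * (of_nat (Suc n) * exp (- \<rho>) ^ n) = e n \<rho>" for n
        by (simp add: e_def exp_of_nat_mult[symmetric] exp_add[symmetric] algebra_simps)
      ultimately show ?thesis by simp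
    qed
    then show "summable (\<lambda>n. e n \<rho>)" by (rule sums_summable)
    have S: "(\<Sum>n. e n \<rho>) = exp (- \<rho>) * (1 / (1 - exp (- \<rho>))\<^sup>2)" using sums by (rule sums_unique[symmetric])
    show "\<rho> powr (- a) \<le> 1 + exp 1 * (\<Sum>n. e n \<rho>)"
    proof (cases "\<rho> \<ge> 1")
      case True
      have "\<rho> powr (- a) \<le> 1 powr (- a)" using True a by (intro powr_mono2') auto
      moreover have "0 \<le> exp 1 * (\<Sum>n. e n \<rho>)" unfolding S by simp
      ultimately show ?thesis by simp
    next
      case False
      \<comment> \<open>The chain uses 1 - exp (-\<rho>) \<le> \<rho>; the factor
        \<open>exp 1\<close> makes up for \<open>exp (- \<rho>)\<close>, which is at least 1/e for
        \<rho> < 1. The square in the closed form of the series is the origin of the limit a \<le>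
        2.\<close>
      have "\<rho> powr (- a) \<le> \<rho> powr (- 2)" using False that a by (intro powr_mono') auto
      also have "\<dots> = 1 / \<rho>\<^sup>2" using that by (simp add: powr_minus divide_inverse)
      also have "\<dots> \<le> 1 / (1 - exp (- \<rho>))\<^sup>2"
        using exp_ge_add_one_self[of "- \<rho>"] that by (intro divide_left_mono power_mono) auto
      also have "\<dots> \<le> exp 1 * (exp (- \<rho>) * (1 / (1 - exp (- \<rho>))\<^sup>2))"
      proof -
        have "1 \<le> exp 1 * exp (- \<rho>)" using False by (simp add: exp_add[symmetric])
        then have "1 * (1 / (1 - exp (- \<rho>))\<^sup>2) \<le> (exp 1 * exp (- \<rho>)) * (1 / (1 - exp (- \<rho>))\<^sup>2)"
          by (intro mult_right_mono) auto
        then show ?thesis by (simp only: mult.assoc mult_1)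
      qed
      finally show ?thesis unfolding S by simp
    qed
  qed
  have fin: "(\<integral>\<^sup>+ \<rho>. ennreal (\<Sum>n. e n \<rho>) \<partial>stable_measure s) < \<infinity>"
  proof -
    have e0: "e n \<rho> \<ge> 0" for n \<rho> by (simp add: e_def)
    have "(\<integral>\<^sup>+ \<rho>. ennreal (\<Sum>n. e n \<rho>) \<partial>stable_measure s) = (\<integral>\<^sup>+ \<rho>. (\<Sum>n. ennreal (e n \<rho>)) \<partial>stable_measure s)"
      using summ e0 by (intro nn_integral_cong) (auto simp: suminf_ennreal2)
    also have "\<dots> = (\<Sum>n. \<integral>\<^sup>+ \<rho>. ennreal (e n \<rho>) \<partial>stable_measure s)"
      by (rule nn_integral_suminf)
        (auto simp: e_def intro!: borel_measurable_stable_measureI continuous_intros measurable_compose[OF _ measurable_ennreal])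
    also have "\<dots> = (\<Sum>n. ennreal (real (Suc n) * exp (- (real (Suc n) powr s))))"
    proof (intro arg_cong[where f=suminf] ext)
      fix n
      have "(\<integral>\<^sup>+ \<rho>. ennreal (e n \<rho>) \<partial>stable_measure s) = ennreal (real (Suc n)) * (\<integral>\<^sup>+ \<rho>. ennreal (exp (- real (Suc n) * \<rho>)) \<partial>stable_measure s)"
        unfolding e_def by (subst nn_integral_cmult[symmetric])
          (auto simp: ennreal_mult intro!: borel_measurable_stable_measureI continuous_intros measurable_compose[OF _ measurable_ennreal])
      also have "\<dots> = ennreal (real (Suc n) * exp (- (real (Suc n) powr s)))"
        by (subst nn_integral_stable_measure_exp) (auto simp: ennreal_mult)
      finally show "(\<integral>\<^sup>+ \<rho>. ennreal (e n \<rho>) \<partial>stable_measure s) = ennreal (real (Suc n) * exp (- (real (Suc n) powr s)))" .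
    qed
    also have "\<dots> < \<infinity>"
    proof -
      obtain C where C: "\<And>y. y \<ge> 0 \<Longrightarrow> exp (- 1 * y powr s) * (1 + y) powr 3 \<le> C"
        using exp_powr_decay[of 1 s 3] s by auto
      have "summable (\<lambda>n. real (Suc n) * exp (- (real (Suc n) powr s)))"
      proof (rule summable_comparison_test')
        show "summable (\<lambda>n. C * (1 / real (Suc n) ^ 2))"
          using summable_Suc_iff[of "\<lambda>n. inverse (real n ^ 2)"] inverse_power_summable[of 2, where 'a=real]
          by (intro summable_mult) (simp add: inverse_eq_divide)
        fix n :: nat
        let ?k = "real (Suc n)"
        have "exp (- (?k powr s)) * ?k ^ 3 \<le> exp (- (?k powr s)) * (1 + ?k) powr 3"
          by (intro mult_left_mono) (auto simp: powr_realpow[of _ 3, simplified] intro!: power_mono)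
        also have "\<dots> \<le> C" using C[of ?k] by simp
        finally have "?k * exp (- (?k powr s)) * ?k ^ 2 \<le> C" by (simp only: power3_eq_cube power2_eq_square mult_ac)
        then show "norm (?k * exp (- (?k powr s))) \<le> C * (1 / ?k ^ 2)" by (simp add: pos_le_divide_eq del: of_nat_Suc)
      qed
      then show ?thesis by (simp add: suminf_ennreal2 less_top[symmetric] del: of_nat_Suc)
    qed
    finally show ?thesis .
  qed
  show ?thesis
  proof (rule integrableI_nonneg)
    show "(\<lambda>\<rho>. \<rho> powr - a) \<in> borel_measurable (stable_measure s)"
      by (intro borel_measurable_stable_measureI continuous_intros) auto
    have "(\<integral>\<^sup>+ \<rho>. ennreal (\<rho> powr - a) \<partial>stable_measure s) \<le> (\<integral>\<^sup>+ \<rho>. (1 + ennreal (exp 1) * ennreal (\<Sum>n. e n \<rho>)) \<partial>stable_measure s)"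
    proof (rule nn_integral_mono)
      fix \<rho> assume "\<rho> \<in> space (stable_measure s)"
      then have "\<rho> > 0" by simp
      have "0 \<le> (\<Sum>n. e n \<rho>)" by (intro suminf_nonneg summ \<open>\<rho> > 0\<close>) (simp add: e_def)
      then have "1 + ennreal (exp 1) * ennreal (\<Sum>n. e n \<rho>) = ennreal (1 + exp 1 * (\<Sum>n. e n \<rho>))"
        by (simp add: ennreal_plus ennreal_mult)
      then show "ennreal (\<rho> powr - a) \<le> 1 + ennreal (exp 1) * ennreal (\<Sum>n. e n \<rho>)"
        using le[OF \<open>\<rho> > 0\<close>] by (simp only: ennreal_leI)
    qed
    also have "\<dots> = 1 + ennreal (exp 1) * (\<integral>\<^sup>+ \<rho>. ennreal (\<Sum>n. e n \<rho>) \<partial>stable_measure s)"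
    proof -
      have m: "(\<lambda>\<rho>. \<Sum>n. e n \<rho>) \<in> borel_measurable (stable_measure s)"
        by (rule borel_measurable_suminf) (auto simp: e_def intro!: borel_measurable_stable_measureI continuous_intros)
      then show ?thesis by (subst nn_integral_add) (auto simp: nn_integral_cmult emeasure_space_1[simplified])
    qed
    also have "\<dots> < \<infinity>" using fin by (simp add: ennreal_mult_less_top)
    finally show "(\<integral>\<^sup>+ \<rho>. ennreal (\<rho> powr - a) \<partial>stable_measure s) < \<infinity>" .
  qed auto
qed

text \<open>The substitution \<sigma> = c \<rho> with c = t^(1/s), combined with the scaling law,
  expresses all times through one probability measure.\<close>

lemma set_integral_stable_density:
  assumes t: "t > 0" and H: "continuous_on {0<..} H"
  shows "(LINT \<sigma>:{0<..}|lborel. H \<sigma> * stable_density s t \<sigma>) = (LINT \<rho>|stable_measure s. H (t powr (1 / s) * \<rho>))"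
proof -
  define c where "c = t powr (1 / s)"
  have c: "c > 0" using t by (simp add: c_def)
  let ?\<eta> = "stable_density s 1"
  have Hc: "continuous_on {0<..} (\<lambda>\<rho>. H (c * \<rho>))"
    by (rule continuous_on_compose2[OF H]) (use c in \<open>auto intro!: continuous_intros\<close>)
  have m: "(\<lambda>\<rho>. H (c * \<rho>)) \<in> borel_measurable (restrict_space lborel {0<..})"
    using borel_measurable_continuous_on_restrict[OF Hc] measurable_cong_sets[of "restrict_space borel {0<..}" "restrict_space lborel {0<..}"]
    by (simp add: sets_restrict_space)
  have "(LINT \<rho>|stable_measure s. H (c * \<rho>)) = (LINT \<rho>|restrict_space lborel {0<..}. ?\<eta> \<rho> *\<^sub>R H (c * \<rho>))"
    unfolding stable_measure_def
    using stable_density_nonneg[OF s, of 1] stable_density_measurable m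
    by (intro integral_density) (auto intro!: AE_I2 simp: space_restrict_space)
  also have "\<dots> = (LINT \<rho>|lborel. indicator {0<..} \<rho> *\<^sub>R (?\<eta> \<rho> *\<^sub>R H (c * \<rho>)))"
    by (subst integral_restrict_space) (auto)
  also have "\<dots> = \<bar>c\<bar> *\<^sub>R (LINT \<rho>|lborel. indicator {0<..} (0 + c * \<rho>) *\<^sub>R (H (0 + c * \<rho>) * stable_density s t (0 + c * \<rho>)))"
    unfolding integral_scaleR_right[symmetric]
    by (intro Bochner_Integration.integral_cong)
      (use c in \<open>auto simp: indicator_def zero_less_mult_iff stable_density_scaling[OF s t] c_def[symmetric]\<close>)
  also have "\<dots> = (LINT \<sigma>:{0<..}|lborel. H \<sigma> * stable_density s t \<sigma>)"
    unfolding set_lebesgue_integral_def using c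
    by (intro lborel_integral_real_affine[symmetric]) auto
  finally show ?thesis by (simp add: c_def)
qed

end

section \<open>The Gaussian kernel\<close>

text \<open>The heat kernel at time 1: a centred Gaussian density with variance 2 in each
  coordinate.\<close>

definition gauss :: "real ^ 'n \<Rightarrow> real" where
  "gauss z = (4 * pi) powr (- real CARD('n) / 2) * exp (- (norm z)\<^sup>2 / 4)"

lemma gauss_pos: "gauss z > 0"
  by (simp add: gauss_def)

lemma gauss_has_derivative:
  fixes z :: "real ^ 'n"
  shows "(gauss has_derivative (\<lambda>h. - (z \<bullet> h) / 2 * gauss z)) (at z)"
  unfolding gauss_def[abs_def] power2_norm_eq_inner
  by (auto intro!: derivative_eq_intros simp: inner_commute algebra_simps)

lemma real_polynomial_function_deriv:
  fixes q :: "real ^ 'n \<Rightarrow> real"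
  assumes "real_polynomial_function q"
  shows "q differentiable at x" "real_polynomial_function (partial_deriv [i] q)"
proof -
  have "(\<forall>x. q differentiable at x) \<and> real_polynomial_function (partial_deriv [i] q)"
    using assms
  proof (induction rule: real_polynomial_function.induct)
    case (linear f)
    then have D: "(f has_derivative f) (at x)" for x by (rule bounded_linear_imp_has_derivative)
    have "partial_deriv [i] f = (\<lambda>x. f (axis i 1))"
      using frechet_derivative_at[OF D, symmetric] by auto
    then show ?case using D by (auto simp: differentiable_def intro: real_polynomial_function.intros(2))
  next
    case (const c)
    then show ?case by (auto intro!: real_polynomial_function.intros(2))
  next
    case (add f g)
    have "partial_deriv [i] (\<lambda>x. f x + g x) = (\<lambda>x. partial_deriv [i] f x + partial_deriv [i] g x)"
    proof
      fix x
      have "((\<lambda>x. f x + g x) has_derivative (\<lambda>h. frechet_derivative f (at x) h + frechet_derivative g (at x) h)) (at x)"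
        using add.IH by (intro has_derivative_add) (auto simp: frechet_derivative_works[symmetric])
      from frechet_derivative_at[OF this, symmetric]
      show "partial_deriv [i] (\<lambda>x. f x + g x) x = partial_deriv [i] f x + partial_deriv [i] g x" by simp
    qed
    then show ?case using add.IH by (auto intro: real_polynomial_function.intros)
  next
    case (mult f g)
    have "partial_deriv [i] (\<lambda>x. f x * g x) = (\<lambda>x. f x * partial_deriv [i] g x + partial_deriv [i] f x * g x)"
    proof
      fix x
      have "((\<lambda>x. f x * g x) has_derivative (\<lambda>h. f x * frechet_derivative g (at x) h + frechet_derivative f (at x) h * g x)) (at x)"
        using mult.IH by (intro has_derivative_mult) (auto simp: frechet_derivative_works[symmetric])
      from frechet_derivative_at[OF this, symmetric]
      show "partial_deriv [i] (\<lambda>x. f x * g x) x = f x * partial_deriv [i] g x + partial_deriv [i] f x * g x" by simp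
    qed
    then show ?case using mult by (auto intro: real_polynomial_function.intros)
  qed
  then show "q differentiable at x" "real_polynomial_function (partial_deriv [i] q)" by auto
qed

lemma real_polynomial_function_growth:
  fixes q :: "'a::real_normed_vector \<Rightarrow> real"
  assumes "real_polynomial_function q"
  shows "\<exists>C\<ge>0. \<exists>m. \<forall>x. \<bar>q x\<bar> \<le> C * (1 + norm x) ^ m"
  using assms
proof (induction rule: real_polynomial_function.induct)
  case (linear f)
  then obtain K where K: "K > 0" "\<And>x. norm (f x) \<le> norm x * K" using bounded_linear.pos_bounded by blast
  have "\<bar>f x\<bar> \<le> K * (1 + norm x) ^ 1" for x using K(2)[of x] K(1) by (simp add: algebra_simps)
  then show ?case using K(1) by (meson less_imp_le)
next
  case (const c)
  show ?case by (rule exI[of _ "\<bar>c\<bar>"]) (auto intro!: exI[of _ "0::nat"])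
next
  case (add f g)
  then obtain C m D n where *: "C \<ge> 0" "D \<ge> 0" "\<And>x. \<bar>f x\<bar> \<le> C * (1 + norm x) ^ m" "\<And>x. \<bar>g x\<bar> \<le> D * (1 + norm x) ^ n"
    by blast
  have "\<bar>f x + g x\<bar> \<le> (C + D) * (1 + norm x) ^ (m + n)" for x
  proof -
    have "C * (1 + norm x) ^ m \<le> C * (1 + norm x) ^ (m + n)" "D * (1 + norm x) ^ n \<le> D * (1 + norm x) ^ (m + n)"
      using * by (auto intro!: mult_left_mono power_increasing)
    then show ?thesis using *(3)[of x] *(4)[of x] by (simp add: algebra_simps)
  qed
  then show ?case using * by (meson add_nonneg_nonneg)
next
  case (mult f g)
  then obtain C m D n where *: "C \<ge> 0" "D \<ge> 0" "\<And>x. \<bar>f x\<bar> \<le> C * (1 + norm x) ^ m" "\<And>x. \<bar>g x\<bar> \<le> D * (1 + norm x) ^ n"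
    by blast
  have "\<bar>f x * g x\<bar> \<le> (C * D) * (1 + norm x) ^ (m + n)" for x
    using mult_mono[OF *(3)[of x] *(4)[of x]] * by (simp add: abs_mult power_add mult_ac)
  then show ?case using * by (meson mult_nonneg_nonneg)
qed

text \<open>The factors q are Hermite polynomials up to normalisation; only their polynomial growth
  is used later.\<close>

lemma partial_deriv_gauss_poly:
  "\<exists>q. real_polynomial_function q \<and> partial_deriv is (gauss :: real ^ 'n \<Rightarrow> real) = (\<lambda>z. q z * gauss z)"
proof (induction "is")
  case Nil
  show ?case by (rule exI[of _ "\<lambda>_. 1"]) (auto intro: real_polynomial_function.intros)
next
  case (Cons i "is")
  then obtain q where q: "real_polynomial_function q" "partial_deriv is (gauss :: real ^ 'n \<Rightarrow> real) = (\<lambda>z. q z * gauss z)"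
    by blast
  have "partial_deriv (i # is) (gauss :: real ^ 'n \<Rightarrow> real) = (\<lambda>z. (q z * (- (1 / 2) * (z $ i)) + partial_deriv [i] q z) * gauss z)"
  proof
    fix z :: "real ^ 'n"
    have "((\<lambda>z. q z * gauss z) has_derivative (\<lambda>h. q z * (- (z \<bullet> h) / 2 * gauss z) + frechet_derivative q (at z) h * gauss z)) (at z)"
      using real_polynomial_function_deriv(1)[OF q(1)]
      by (intro has_derivative_mult gauss_has_derivative) (auto simp: frechet_derivative_works[symmetric])
    from frechet_derivative_at[OF this, symmetric]
    show "partial_deriv (i # is) gauss z = (q z * (- (1 / 2) * (z $ i)) + partial_deriv [i] q z) * gauss z"
      by (simp add: q(2) inner_axis algebra_simps)
  qed
  moreover have "real_polynomial_function (\<lambda>z. q z * (- (1 / 2) * (z $ i)) + partial_deriv [i] q z)"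
    by (rule real_polynomial_function.intros(3)[OF real_polynomial_function.intros(4)[OF q(1)
          real_polynomial_function.intros(4)[OF real_polynomial_function.intros(2)
          real_polynomial_function.intros(1)[OF bounded_linear_vec_nth]]] real_polynomial_function_deriv(2)[OF q(1)]])
  ultimately show ?case by blast
qed

lemma partial_deriv_gauss_differentiable: "partial_deriv is (gauss :: real ^ 'n \<Rightarrow> real) differentiable at z"
proof -
  obtain q where q: "real_polynomial_function q" "partial_deriv is (gauss :: real ^ 'n \<Rightarrow> real) = (\<lambda>z. q z * gauss z)"
    using partial_deriv_gauss_poly by blast
  show ?thesis unfolding q(2)
    using real_polynomial_function_deriv(1)[OF q(1)] gauss_has_derivative
    by (intro differentiable_mult) (auto simp: differentiable_def)
qed

text \<open>Half of the Gaussian exponent absorbs the polynomial and the weight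
  \<open>1 + norm z\<close>; the other half is kept for integrability. The weight is there to pay
  for a Hoelder increment.\<close>

lemma partial_deriv_gauss_bound:
  "\<exists>C\<ge>0. \<forall>z::real^'n. \<bar>partial_deriv is gauss z\<bar> * (1 + norm z) \<le> C * exp (- (norm z)\<^sup>2 / 8)"
proof -
  obtain q where q: "real_polynomial_function q" "partial_deriv is (gauss :: real ^ 'n \<Rightarrow> real) = (\<lambda>z. q z * gauss z)"
    using partial_deriv_gauss_poly by blast
  obtain C m where C: "C \<ge> 0" "\<And>z. \<bar>q z\<bar> \<le> C * (1 + norm z) ^ m" using real_polynomial_function_growth[OF q(1)] by blast
  obtain D where D: "D > 0" "\<And>y. y \<ge> 0 \<Longrightarrow> exp (- (1 / 8) * y powr 2) * (1 + y) powr real (Suc m) \<le> D"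
    using exp_powr_decay[of "1 / 8" 2 "real (Suc m)"] by auto
  define g where "g = (4 * pi) powr (- real CARD('n) / 2)"
  have g: "g > 0" by (simp add: g_def)
  have "\<bar>partial_deriv is gauss z\<bar> * (1 + norm z) \<le> (C * D * g) * exp (- (norm z)\<^sup>2 / 8)" for z :: "real ^ 'n"
  proof -
    have e: "exp (- (norm z)\<^sup>2 / 4) = exp (- (norm z)\<^sup>2 / 8) * exp (- (norm z)\<^sup>2 / 8)"
      by (simp add: exp_add[symmetric])
    have "\<bar>partial_deriv is gauss z\<bar> * (1 + norm z) = \<bar>q z\<bar> * (1 + norm z) * g * exp (- (norm z)\<^sup>2 / 4)"
      using g unfolding q(2) gauss_def g_def[symmetric] by (simp add: abs_mult)
    also have "\<dots> \<le> (C * (1 + norm z) ^ m) * (1 + norm z) * g * exp (- (norm z)\<^sup>2 / 4)"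
      using g C by (intro mult_right_mono) auto
    also have "\<dots> = C * g * exp (- (norm z)\<^sup>2 / 8) * (exp (- (norm z)\<^sup>2 / 8) * (1 + norm z) ^ Suc m)"
      unfolding e by (simp add: mult_ac)
    also have "\<dots> \<le> C * g * exp (- (norm z)\<^sup>2 / 8) * D"
      using D(2)[of "norm z"] C(1) g
      by (intro mult_left_mono) (auto simp: powr_realpow add_pos_nonneg simp del: power_Suc of_nat_Suc)
    finally show ?thesis by (simp add: mult_ac)
  qed
  moreover have "C * D * g \<ge> 0" using C D g by simp
  ultimately show ?thesis by blast
qed

section \<open>Normalisation of the Gaussian\<close>

lemma nn_integral_gaussian:
  fixes c :: real
  assumes c: "c > 0"
  shows "(\<integral>\<^sup>+ z. ennreal (exp (- c * (norm z)\<^sup>2)) \<partial>(lborel :: (real ^ 'n) measure)) = ennreal ((pi / c) powr (real CARD('n) / 2))"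
proof -
  have 1: "(\<integral>\<^sup>+ x. ennreal (exp (- c * x\<^sup>2)) \<partial>lborel) = ennreal (sqrt (pi / c))"
  proof -
    \<comment> \<open>The standard deviation for which the normal density has exponent - c
      x^2.\<close>
    define \<sigma> where "\<sigma> = sqrt (1 / (2 * c))"
    have \<sigma>: "\<sigma> > 0" "\<sigma>\<^sup>2 = 1 / (2 * c)" using c by (auto simp: \<sigma>_def)
    have eq: "exp (- c * x\<^sup>2) = sqrt (pi / c) * normal_density 0 \<sigma> x" for x
      using c unfolding normal_density_def by (simp add: \<sigma>(2) real_sqrt_divide)
    have "(\<integral>\<^sup>+ x. ennreal (exp (- c * x\<^sup>2)) \<partial>lborel) = ennreal (LINT x|lborel. exp (- c * x\<^sup>2))"
      using \<sigma>(1) unfolding eq by (intro nn_integral_eq_integral) (auto simp: c less_imp_le)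
    also have "(LINT x|lborel. exp (- c * x\<^sup>2)) = sqrt (pi / c)"
      using \<sigma>(1) unfolding eq by simp
    finally show ?thesis .
  qed
  have "(\<integral>\<^sup>+ z. ennreal (exp (- c * (norm z)\<^sup>2)) \<partial>(lborel :: (real ^ 'n) measure)) =
    (\<integral>\<^sup>+ z. (\<Prod>b\<in>Basis. ennreal (exp (- c * (z \<bullet> b)\<^sup>2))) \<partial>(lborel :: (real ^ 'n) measure))"
  proof (intro nn_integral_cong)
    fix z :: "real ^ 'n"
    have "(norm z)\<^sup>2 = (\<Sum>b\<in>Basis. (z \<bullet> b)\<^sup>2)"
      unfolding power2_norm_eq_inner by (subst euclidean_inner) (simp add: power2_eq_square)
    then have "exp (- c * (norm z)\<^sup>2) = (\<Prod>b\<in>Basis. exp (- c * (z \<bullet> b)\<^sup>2))"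
      by (simp add: sum_distrib_left exp_sum[symmetric] sum_negf)
    then show "ennreal (exp (- c * (norm z)\<^sup>2)) = (\<Prod>b\<in>Basis. ennreal (exp (- c * (z \<bullet> b)\<^sup>2)))"
      by (simp add: prod_ennreal)
  qed
  also have "\<dots> = (\<Prod>b\<in>(Basis :: (real ^ 'n) set). \<integral>\<^sup>+ x. ennreal (exp (- c * x\<^sup>2)) \<partial>lborel)"
    by (rule nn_integral_lborel_prod) auto
  also have "\<dots> = ennreal (sqrt (pi / c)) ^ CARD('n)"
    unfolding 1 by simp
  also have "\<dots> = ennreal ((pi / c) powr (real CARD('n) / 2))"
    using c by (simp add: ennreal_power powr_half_sqrt[symmetric] powr_realpow[symmetric] powr_powr)
  finally show ?thesis .
qed

lemma gaussian_integral:
  fixes c :: real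
  assumes c: "c > 0"
  shows "integrable (lborel :: (real ^ 'n) measure) (\<lambda>z. exp (- c * (norm z)\<^sup>2))"
    and "(LINT z|(lborel :: (real ^ 'n) measure). exp (- c * (norm z)\<^sup>2)) = (pi / c) powr (real CARD('n) / 2)"
proof -
  have m: "(\<lambda>z::real^'n. exp (- c * (norm z)\<^sup>2)) \<in> borel_measurable lborel" by measurable
  show "integrable (lborel :: (real ^ 'n) measure) (\<lambda>z. exp (- c * (norm z)\<^sup>2))"
    by (rule integrableI_nonneg[OF m]) (auto simp only: nn_integral_gaussian[OF c] ennreal_less_top infinity_ennreal_def exp_ge_zero intro!: AE_I2)
  show "(LINT z|(lborel :: (real ^ 'n) measure). exp (- c * (norm z)\<^sup>2)) = (pi / c) powr (real CARD('n) / 2)"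
    using m by (intro integral_eq_nn_integral[THEN trans]) (auto simp only: nn_integral_gaussian[OF c] enn2real_ennreal powr_ge_zero exp_ge_zero intro!: AE_I2)
qed

lemma gauss_integral:
  shows "integrable lborel (gauss :: real ^ 'n \<Rightarrow> real)"
    and "(LINT z|lborel. (gauss :: real ^ 'n \<Rightarrow> real) z) = 1"
proof -
  have eq: "(gauss :: real ^ 'n \<Rightarrow> real) = (\<lambda>z. (4 * pi) powr (- real CARD('n) / 2) * exp (- (1 / 4) * (norm z)\<^sup>2))"
    by (auto simp: gauss_def)
  show "integrable lborel (gauss :: real ^ 'n \<Rightarrow> real)"
    unfolding eq by (intro integrable_mult_right gaussian_integral) simp
  show "(LINT z|lborel. (gauss :: real ^ 'n \<Rightarrow> real) z) = 1"
    unfolding eq using gaussian_integral(2)[of "1 / 4", where 'n='n]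
    by (simp add: powr_minus mult.commute)
qed

section \<open>The heat semigroup\<close>

lemma finite_bounded_lists: "finite {is :: ('n::finite) list. length is \<le> n}"
  using finite_lists_length_le[of "UNIV :: 'n set" n] by simp

lemma Cn_space_mono: "m \<le> n \<Longrightarrow> f \<in> Cn_space n \<Longrightarrow> f \<in> Cn_space m"
  by (auto simp: Cn_space_def)

lemma Cn_space_bounded:
  fixes f :: "real ^ 'n \<Rightarrow> real"
  assumes "f \<in> Cn_space n"
  obtains B where "\<And>is x. length is \<le> n \<Longrightarrow> \<bar>partial_deriv is f x\<bar> \<le> B"
proof -
  have "bounded (\<Union>is\<in>{is :: 'n list. length is \<le> n}. range (partial_deriv is f))"
    using assms by (intro bounded_UN finite_bounded_lists) (auto simp: Cn_space_def)
  then obtain B where "\<And>y. y \<in> (\<Union>is\<in>{is :: 'n list. length is \<le> n}. range (partial_deriv is f)) \<Longrightarrow> \<bar>y\<bar> \<le> B"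
    by (auto simp: bounded_iff)
  then show ?thesis by (intro that[of B]) auto
qed

lemma partial_deriv_affine:
  fixes u :: "real ^ 'n \<Rightarrow> real"
  assumes u: "u \<in> Cn_space n"
  shows "length is \<le> n \<Longrightarrow> partial_deriv is (\<lambda>x. a * u (c *\<^sub>R x + b)) = (\<lambda>x. a * c ^ length is * partial_deriv is u (c *\<^sub>R x + b))"
    and "(\<lambda>x. a * u (c *\<^sub>R x + b)) \<in> Cn_space n"
proof -
  have d: "partial_deriv is u differentiable at x" if "length is < n" for "is" x
    using u that by (auto simp: Cn_space_def differentiable_on_eq_differentiable_at)
  have D: "((\<lambda>x. k * partial_deriv is u (c *\<^sub>R x + b)) has_derivative
      (\<lambda>h. k * frechet_derivative (partial_deriv is u) (at (c *\<^sub>R x + b)) (c *\<^sub>R h))) (at x)" 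
    if "length is < n" for "is" x k
  proof (rule has_derivative_mult_right)
    have "((\<lambda>x. c *\<^sub>R x + b) has_derivative (\<lambda>h. c *\<^sub>R h)) (at x)"
      by (auto intro!: derivative_eq_intros)
    from has_derivative_compose[OF this, of "partial_deriv is u"] d[OF that]
    show "((\<lambda>x. partial_deriv is u (c *\<^sub>R x + b)) has_derivative
      (\<lambda>h. frechet_derivative (partial_deriv is u) (at (c *\<^sub>R x + b)) (c *\<^sub>R h))) (at x)"
      by (simp add: frechet_derivative_works)
  qed
  have eq: "partial_deriv is (\<lambda>x. a * u (c *\<^sub>R x + b)) = (\<lambda>x. a * c ^ length is * partial_deriv is u (c *\<^sub>R x + b))"
    if "length is \<le> n" for "is"
    using that
  proof (induction "is")
    case (Cons i "is")
    then have len: "length is < n" and IH: "partial_deriv is (\<lambda>x. a * u (c *\<^sub>R x + b)) = (\<lambda>x. a * c ^ length is * partial_deriv is u (c *\<^sub>R x + b))"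
      by auto
    show ?case
    proof
      fix x
      have "linear (frechet_derivative (partial_deriv is u) (at (c *\<^sub>R x + b)))"
        using d[OF len] by (rule linear_frechet_derivative)
      then show "partial_deriv (i # is) (\<lambda>x. a * u (c *\<^sub>R x + b)) x = a * c ^ length (i # is) * partial_deriv (i # is) u (c *\<^sub>R x + b)"
        using frechet_derivative_at[OF D[OF len, of "a * c ^ length is" x], symmetric]
        by (simp add: IH linear_scale)
    qed
  qed simp
  then show "length is \<le> n \<Longrightarrow> partial_deriv is (\<lambda>x. a * u (c *\<^sub>R x + b)) = (\<lambda>x. a * c ^ length is * partial_deriv is u (c *\<^sub>R x + b))" .
  show "(\<lambda>x. a * u (c *\<^sub>R x + b)) \<in> Cn_space n"
    unfolding Cn_space_def
  proof (intro CollectI conjI allI impI)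
    fix "is" :: "'n list"
    show "partial_deriv is (\<lambda>x. a * u (c *\<^sub>R x + b)) differentiable_on UNIV" if "length is < n"
      using D[OF that] eq[of "is"] that by (auto simp: differentiable_on_eq_differentiable_at differentiable_def)
    assume len: "length is \<le> n"
    then have "continuous_on UNIV (partial_deriv is u)" using u by (auto simp: Cn_space_def)
    then have "continuous_on UNIV (\<lambda>x. partial_deriv is u (c *\<^sub>R x + b))"
      by (rule continuous_on_compose2) (auto intro!: continuous_intros)
    then show "continuous_on UNIV (partial_deriv is (\<lambda>x. a * u (c *\<^sub>R x + b)))"
      unfolding eq[OF len] by (intro continuous_on_mult continuous_on_const)
    obtain B where B: "\<And>is x. length is \<le> n \<Longrightarrow> \<bar>partial_deriv is u x\<bar> \<le> B" using Cn_space_bounded[OF u] by blast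
    have "\<bar>a * c ^ length is * partial_deriv is u (c *\<^sub>R x + b)\<bar> \<le> \<bar>a * c ^ length is\<bar> * B" for x
      unfolding abs_mult[of "a * c ^ length is"] using B[OF len] by (intro mult_left_mono) auto
    then show "bounded (range (partial_deriv is (\<lambda>x. a * u (c *\<^sub>R x + b))))"
      unfolding eq[OF len] by (auto simp: bounded_iff)
  qed
qed

lemma partial_deriv_const: "is \<noteq> [] \<Longrightarrow> partial_deriv is (\<lambda>x. c) = (\<lambda>x. 0)"
proof (induction "is")
  case (Cons i "is")
  then show ?case by (cases "is = []") auto
qed simp

lemma gauss_Cn_space: "gauss \<in> Cn_space n"
  unfolding Cn_space_def
proof (intro CollectI conjI allI impI)
  fix "is" :: "'a list"
  have d: "partial_deriv is (gauss :: real ^ 'a \<Rightarrow> real) differentiable at z" for z by (rule partial_deriv_gauss_differentiable)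
  then show "partial_deriv is (gauss :: real ^ 'a \<Rightarrow> real) differentiable_on UNIV"
    by (simp add: differentiable_on_eq_differentiable_at)
  show "continuous_on UNIV (partial_deriv is (gauss :: real ^ 'a \<Rightarrow> real))"
    using d by (simp add: continuous_on_eq_continuous_at differentiable_imp_continuous_within)
  obtain C where C: "C \<ge> 0" "\<And>z::real^'a. \<bar>partial_deriv is gauss z\<bar> * (1 + norm z) \<le> C * exp (- (norm z)\<^sup>2 / 8)"
    using partial_deriv_gauss_bound by blast
  have "\<bar>partial_deriv is gauss z\<bar> \<le> C" for z :: "real ^ 'a"
  proof -
    have "\<bar>partial_deriv is gauss z\<bar> * 1 \<le> \<bar>partial_deriv is gauss z\<bar> * (1 + norm z)" by (intro mult_left_mono) auto
    also have "\<dots> \<le> C * exp (- (norm z)\<^sup>2 / 8)" by (rule C)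
    also have "\<dots> \<le> C * 1" using C(1) by (intro mult_left_mono) auto
    finally show ?thesis by simp
  qed
  then show "bounded (range (partial_deriv is (gauss :: real ^ 'a \<Rightarrow> real)))" by (auto simp: bounded_iff)
qed

lemma partial_deriv_gauss_measurable [measurable]: "partial_deriv is gauss \<in> borel_measurable borel"
  using gauss_Cn_space[of "length is"] by (intro borel_measurable_continuous_onI) (auto simp: Cn_space_def)

section \<open>Convolution with derivatives of the Gaussian\<close>

lemma lborel_integral_affine:
  fixes F :: "'a::euclidean_space \<Rightarrow> real"
  assumes [measurable]: "F \<in> borel_measurable borel" and c: "c \<noteq> 0"
  shows "(LINT y|lborel. F y) = \<bar>c\<bar> ^ DIM('a) * (LINT z|lborel. F (t + c *\<^sub>R z))"
    and "integrable lborel F \<longleftrightarrow> integrable lborel (\<lambda>z. F (t + c *\<^sub>R z))"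
proof -
  have "(LINT y|lborel. F y) = (LINT y|density (distr lborel borel (\<lambda>x. t + c *\<^sub>R x)) (\<lambda>_. ennreal (\<bar>c\<bar> ^ DIM('a))). F y)"
    using lborel_affine[OF c, of t] by (simp add: ennreal_power)
  also have "\<dots> = \<bar>c\<bar> ^ DIM('a) * (LINT z|lborel. F (t + c *\<^sub>R z))"
    by (subst integral_density) (auto simp: integral_distr)
  finally show "(LINT y|lborel. F y) = \<bar>c\<bar> ^ DIM('a) * (LINT z|lborel. F (t + c *\<^sub>R z))" .
  have "integrable lborel F \<longleftrightarrow> integrable (density (distr lborel borel (\<lambda>x. t + c *\<^sub>R x)) (\<lambda>_. ennreal (\<bar>c\<bar> ^ DIM('a)))) F"
    using lborel_affine[OF c, of t] by (simp add: ennreal_power)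
  also have "\<dots> \<longleftrightarrow> integrable lborel (\<lambda>z. F (t + c *\<^sub>R z))"
    using c by (subst integrable_density) (auto simp: integrable_distr_eq)
  finally show "integrable lborel F \<longleftrightarrow> integrable lborel (\<lambda>z. F (t + c *\<^sub>R z))" .
qed

text \<open>The weight \<open>1 + norm z\<close> dominates \<open>norm z powr \<alpha>\<close> for
  every \<alpha> in [0,1], so one constant serves bounded and Hoelder data.\<close>

definition gauss_moment :: "('n::finite) list \<Rightarrow> real" where
  "gauss_moment is = (LINT z|lborel. \<bar>partial_deriv is (gauss :: real ^ 'n \<Rightarrow> real) z\<bar> * (1 + norm z))"

lemma integrable_gauss_moment: "integrable lborel (\<lambda>z::real^'n. \<bar>partial_deriv is gauss z\<bar> * (1 + norm z))"
proof -
  obtain C where C: "C \<ge> 0" "\<And>z::real^'n. \<bar>partial_deriv is gauss z\<bar> * (1 + norm z) \<le> C * exp (- (norm z)\<^sup>2 / 8)"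
    using partial_deriv_gauss_bound by blast
  show ?thesis
  proof (rule Bochner_Integration.integrable_bound)
    show "integrable lborel (\<lambda>z::real^'n. C * exp (- (1 / 8) * (norm z)\<^sup>2))"
      by (intro integrable_mult_right gaussian_integral) simp
  qed (use C in \<open>auto intro!: AE_I2 order_trans[OF _ abs_ge_self] simp: abs_mult\<close>)
qed

lemma integrable_partial_deriv_gauss: "integrable lborel (\<lambda>z::real^'n. partial_deriv is gauss z)"
  by (rule Bochner_Integration.integrable_bound[OF integrable_gauss_moment[of "is"]])
    (auto intro!: AE_I2 simp: abs_mult mult_le_cancel_left1)

lemma gauss_moment_nonneg: "gauss_moment is \<ge> 0"
  unfolding gauss_moment_def by (intro integral_nonneg_AE AE_I2) auto

text \<open>For r > 0 this is r^j times a derivative of order j of the heat flow at time r^2. In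
  this form the radius sits in the argument of f, and r = 0 is meaningful.\<close>

definition gauss_conv :: "('n::finite) list \<Rightarrow> real \<Rightarrow> (real ^ 'n \<Rightarrow> real) \<Rightarrow> real ^ 'n \<Rightarrow> real" where
  "gauss_conv is r f x = (LINT z|lborel. partial_deriv is gauss z * f (x - r *\<^sub>R z))"

lemma gauss_conv_integrable:
  fixes f :: "real ^ 'n \<Rightarrow> real"
  assumes [measurable]: "f \<in> borel_measurable borel" and B: "\<And>x. \<bar>f x\<bar> \<le> B"
  shows "integrable lborel (\<lambda>z. partial_deriv is gauss z * f (x - r *\<^sub>R z))"
proof (rule Bochner_Integration.integrable_bound)
  show "integrable lborel (\<lambda>z::real^'n. partial_deriv is gauss z * B)"
    by (intro integrable_mult_left integrable_partial_deriv_gauss)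
qed (use order_trans[OF B abs_ge_self] in \<open>auto intro!: AE_I2 mult_left_mono simp: abs_mult\<close>)

lemma gauss_conv_bound:
  fixes f :: "real ^ 'n \<Rightarrow> real"
  assumes "f \<in> borel_measurable borel" and B: "\<And>x. \<bar>f x\<bar> \<le> B"
  shows "\<bar>gauss_conv is r f x\<bar> \<le> B * gauss_moment is"
proof -
  have "\<bar>gauss_conv is r f x\<bar> \<le> (LINT z|lborel. \<bar>partial_deriv is gauss z * f (x - r *\<^sub>R z)\<bar>)"
    unfolding gauss_conv_def by (rule integral_abs_bound)
  also have "\<dots> \<le> (LINT z|lborel. B * (\<bar>partial_deriv is (gauss :: real ^ 'n \<Rightarrow> real) z\<bar> * (1 + norm z)))"
  proof (rule integral_mono)
    show "integrable lborel (\<lambda>z. \<bar>partial_deriv is gauss z * f (x - r *\<^sub>R z)\<bar>)"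
      using gauss_conv_integrable[OF assms] by (rule integrable_abs)
    show "integrable lborel (\<lambda>z::real^'n. B * (\<bar>partial_deriv is gauss z\<bar> * (1 + norm z)))"
      using integrable_gauss_moment by (rule integrable_mult_right)
    fix z :: "real ^ 'n"
    have "0 \<le> B" using order_trans[OF abs_ge_zero B] .
    then have "B * (\<bar>partial_deriv is gauss z\<bar> * 1) \<le> B * (\<bar>partial_deriv is gauss z\<bar> * (1 + norm z))"
      by (intro mult_left_mono) auto
    moreover have "\<bar>partial_deriv is gauss z * f (x - r *\<^sub>R z)\<bar> \<le> B * (\<bar>partial_deriv is gauss z\<bar> * 1)"
      using mult_left_mono[OF B[of "x - r *\<^sub>R z"], of "\<bar>partial_deriv is gauss z\<bar>"] by (simp add: abs_mult mult.commute)
    ultimately show "\<bar>partial_deriv is gauss z * f (x - r *\<^sub>R z)\<bar> \<le> B * (\<bar>partial_deriv is gauss z\<bar> * (1 + norm z))"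
      by linarith
  qed
  finally show ?thesis by (simp add: gauss_moment_def)
qed

text \<open>Rests on the total mass 1 of the kernel. The constant \<open>gauss_moment []\<close> of
  the general bound exceeds 1 and would destroy the contraction property.\<close>

lemma gauss_conv_Nil_bound:
  fixes f :: "real ^ 'n \<Rightarrow> real"
  assumes "f \<in> borel_measurable borel" and B: "\<And>x. \<bar>f x\<bar> \<le> B"
  shows "\<bar>gauss_conv [] r f x\<bar> \<le> B"
proof -
  have "\<bar>gauss_conv [] r f x\<bar> \<le> (LINT z|lborel. \<bar>gauss z * f (x - r *\<^sub>R z)\<bar>)"
    unfolding gauss_conv_def by (simp add: integral_abs_bound)
  also have "\<dots> \<le> (LINT z|lborel. gauss (z :: real ^ 'n) * B)"
  proof (rule integral_mono)
    show "integrable lborel (\<lambda>z. \<bar>gauss z * f (x - r *\<^sub>R z)\<bar>)"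
      using gauss_conv_integrable[OF assms, of "[]"] by (intro integrable_abs) simp
    show "integrable lborel (\<lambda>z::real^'n. gauss z * B)" by (intro integrable_mult_left gauss_integral)
    fix z :: "real ^ 'n"
    show "\<bar>gauss z * f (x - r *\<^sub>R z)\<bar> \<le> gauss z * B"
      using mult_left_mono[OF B[of "x - r *\<^sub>R z"], of "gauss z"] gauss_pos[of z] by (simp add: abs_mult)
  qed
  finally show ?thesis by (simp add: gauss_integral)
qed

text \<open>As an integral over y all derivatives fall on the kernel, so f may be merely bounded and
  measurable; the substitution y = x - sqrt \<sigma> z leads back to the Gaussian at time 1, and
  each derivative leaves a factor 1/sqrt \<sigma>.\<close>

lemma partial_deriv_heat_semigroup:
  fixes f :: "real ^ 'n \<Rightarrow> real"
  assumes f[measurable]: "f \<in> borel_measurable borel" and B: "\<And>x. \<bar>f x\<bar> \<le> B" and \<sigma>: "\<sigma> > 0"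
  shows "partial_deriv is (heat_semigroup \<sigma> f) = (\<lambda>x. (1 / sqrt \<sigma>) ^ length is * gauss_conv is (sqrt \<sigma>) f x)"
    and "heat_semigroup \<sigma> f \<in> Cn_space n"
proof -
  define r where "r = sqrt \<sigma>"
  define c where "c = 1 / r"
  have r: "r > 0" "r\<^sup>2 = \<sigma>" using \<sigma> by (auto simp: r_def)
  have c: "c > 0" "c * r = 1" using r by (auto simp: c_def)
  \<comment> \<open>The part of the normalisation that \<open>gauss\<close> lacks; the Jacobian of
    the substitution cancels it.\<close>
  define k where "k = \<sigma> powr (- real CARD('n) / 2)"
  have k: "k > 0" "r ^ CARD('n) * k = 1"
  proof -
    show "k > 0" using \<sigma> by (simp add: k_def)
    have "r ^ CARD('n) = \<sigma> powr (real CARD('n) / 2)"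
      using \<sigma> by (simp add: r_def powr_half_sqrt[symmetric] powr_realpow[symmetric] powr_powr)
    then show "r ^ CARD('n) * k = 1" using \<sigma> by (simp add: k_def powr_add[symmetric])
  qed
  have B0: "B \<ge> 0" using order_trans[OF abs_ge_zero B] .
  define F where "F y x = (k * f y) * gauss (c *\<^sub>R x + (- c *\<^sub>R y))" for x y :: "real ^ 'n"
  have heat: "heat_semigroup \<sigma> f = (\<lambda>x. LINT y|lborel. F y x)"
  proof
    fix x
    have "(4 * pi * \<sigma>) powr (- real CARD('n) / 2) * exp (- (norm (x - y))\<^sup>2 / (4 * \<sigma>)) * f y = F y x" for y
    proof -
      have "norm (c *\<^sub>R x + (- c *\<^sub>R y)) = c * norm (x - y)"
        using c(1) by (simp add: scaleR_diff_right[symmetric])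
      then have "(norm (c *\<^sub>R x + (- c *\<^sub>R y)))\<^sup>2 = (norm (x - y))\<^sup>2 / \<sigma>"
        using r by (simp add: power_mult_distrib c_def power_divide)
      then show ?thesis
        unfolding F_def gauss_def k_def using \<sigma> by (simp add: powr_mult mult_ac)
    qed
    then show "heat_semigroup \<sigma> f x = (LINT y|lborel. F y x)" unfolding heat_semigroup_def by simp
  qed
  have F_smooth: "F y \<in> Cn_space m" for y m
    unfolding F_def by (rule partial_deriv_affine(2)[OF gauss_Cn_space])
  have F_deriv: "partial_deriv is (F y) x = k * f y * c ^ length is * partial_deriv is gauss (c *\<^sub>R x + (- c *\<^sub>R y))" for "is" y x
    unfolding F_def by (subst partial_deriv_affine(1)[OF gauss_Cn_space order_refl]) simp
  have F_meas: "(\<lambda>y. F y x) \<in> borel_measurable lborel" for x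
  proof -
    have [measurable]: "gauss \<in> borel_measurable (borel :: (real ^ 'n) measure)" using partial_deriv_gauss_measurable[of "[]"] by simp
    show ?thesis unfolding F_def by measurable
  qed
  have dom: "\<exists>w. integrable lborel w \<and> (\<forall>y\<in>space lborel. \<forall>x\<in>ball x0 1. \<forall>is. length is \<le> m \<longrightarrow>
                \<bar>partial_deriv is (F y) x\<bar> \<le> w y)" for x0 m
  proof -
    obtain C where C: "\<And>is. C is \<ge> 0" "\<And>is z. \<bar>partial_deriv is (gauss :: real ^ 'n \<Rightarrow> real) z\<bar> * (1 + norm z) \<le> C is * exp (- (norm z)\<^sup>2 / 8)"
      using partial_deriv_gauss_bound by metis
    define M where "M = (\<Sum>is\<in>{is. length is \<le> m}. c ^ length is * C is)"
    \<comment> \<open>For x within distance 1 of x0, |y - x0|^2 \<le> 2 |x - y|^2 + 2. This moves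
      the Gaussian to the fixed centre x0 at the price of halving the rate and of the factor
      \<open>exp (c\<^sup>2 / 8)\<close>.\<close>
    define w where "w y = k * B * M * exp (c\<^sup>2 / 8) * exp (- (c\<^sup>2 / 16) * (norm (y - x0))\<^sup>2)" for y
    have "integrable lborel w"
    proof -
      have "integrable lborel (\<lambda>y. exp (- (c\<^sup>2 / 16) * (norm (y - x0))\<^sup>2))"
        by (subst lborel_integral_affine(2)[of _ 1 x0]) (use gaussian_integral(1)[of "c\<^sup>2 / 16"] c in auto)
      then show ?thesis unfolding w_def by (rule integrable_mult_right)
    qed
    moreover have "\<bar>partial_deriv is (F y) x\<bar> \<le> w y" if "x \<in> ball x0 1" "length is \<le> m" for y x "is"
    proof -
      let ?z = "c *\<^sub>R x + (- c *\<^sub>R y)"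
      have nz: "norm ?z = c * norm (x - y)" using c(1) by (simp add: scaleR_diff_right[symmetric])
      have "norm (y - x0) \<le> norm (x - y) + 1"
        using norm_triangle_ineq[of "y - x" "x - x0"] that(1) by (simp add: dist_norm norm_minus_commute)
      then have "(norm (y - x0))\<^sup>2 \<le> (norm (x - y) + 1)\<^sup>2" by (intro power_mono) auto
      also have "\<dots> \<le> 2 * (norm (x - y))\<^sup>2 + 2"
        using sum_squares_ge_zero[of "norm (x - y) - 1" 0] by (simp add: power2_eq_square algebra_simps)
      finally have "c\<^sup>2 * (norm (y - x0))\<^sup>2 \<le> c\<^sup>2 * (2 * (norm (x - y))\<^sup>2 + 2)" by (intro mult_left_mono) auto
      then have e: "- (norm ?z)\<^sup>2 / 8 \<le> c\<^sup>2 / 8 + - (c\<^sup>2 / 16) * (norm (y - x0))\<^sup>2"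
        unfolding nz by (simp add: power_mult_distrib algebra_simps)
      have "\<bar>partial_deriv is gauss ?z\<bar> * 1 \<le> \<bar>partial_deriv is gauss ?z\<bar> * (1 + norm ?z)"
        by (intro mult_left_mono) auto
      also have "\<dots> \<le> C is * exp (- (norm ?z)\<^sup>2 / 8)" by (rule C)
      also have "\<dots> \<le> C is * exp (c\<^sup>2 / 8 + - (c\<^sup>2 / 16) * (norm (y - x0))\<^sup>2)"
        using e C(1) by (intro mult_left_mono) auto
      finally have 1: "\<bar>partial_deriv is gauss ?z\<bar> \<le> C is * exp (c\<^sup>2 / 8 + - (c\<^sup>2 / 16) * (norm (y - x0))\<^sup>2)" by simp
      have "c ^ length is * C is \<le> M"
        unfolding M_def using that c C(1) by (intro member_le_sum finite_bounded_lists) auto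
      then have 2: "c ^ length is * \<bar>partial_deriv is gauss ?z\<bar> \<le> M * exp (c\<^sup>2 / 8 + - (c\<^sup>2 / 16) * (norm (y - x0))\<^sup>2)"
        using mult_left_mono[OF 1, of "c ^ length is"] c
        by (smt (verit) exp_ge_zero mult.assoc mult_right_mono zero_le_power)
      have "\<bar>partial_deriv is (F y) x\<bar> = (k * \<bar>f y\<bar>) * (c ^ length is * \<bar>partial_deriv is gauss ?z\<bar>)"
        unfolding F_deriv using k c by (simp add: abs_mult mult_ac)
      also have "\<dots> \<le> (k * B) * (M * exp (c\<^sup>2 / 8 + - (c\<^sup>2 / 16) * (norm (y - x0))\<^sup>2))"
        by (rule mult_mono[OF mult_left_mono[OF B] 2]) (use k c B0 in auto)
      finally show ?thesis by (simp only: w_def exp_add mult_ac)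
    qed
    ultimately show ?thesis by blast
  qed
  have eq: "partial_deriv is (heat_semigroup \<sigma> f) = (\<lambda>x. (1 / sqrt \<sigma>) ^ length is * gauss_conv is (sqrt \<sigma>) f x)" for "is"
  proof
    fix x
    have "partial_deriv is (heat_semigroup \<sigma> f) x = (LINT y|lborel. partial_deriv is (F y) x)"
      unfolding heat by (subst partial_deriv_LINT(1)[OF F_meas F_smooth dom order_refl]) simp
    also have "\<dots> = (LINT y|lborel. k * f y * c ^ length is * partial_deriv is gauss (c *\<^sub>R x + (- c *\<^sub>R y)))"
      unfolding F_deriv ..
    also have "\<dots> = \<bar>- r\<bar> ^ DIM(real ^ 'n) * (LINT z|lborel. k * f (x + (- r) *\<^sub>R z) * c ^ length is * partial_deriv is gauss (c *\<^sub>R x + (- c *\<^sub>R (x + (- r) *\<^sub>R z))))"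
      by (rule lborel_integral_affine(1)) (use r in auto)
    also have "\<dots> = \<bar>- r\<bar> ^ DIM(real ^ 'n) * (LINT z|lborel. (k * c ^ length is) * (partial_deriv is gauss z * f (x - r *\<^sub>R z)))"
      using c by (simp add: scaleR_add_right scaleR_diff_right mult_ac)
    also have "\<dots> = c ^ length is * gauss_conv is r f x"
      using k(2) r by (simp add: gauss_conv_def)
    finally show "partial_deriv is (heat_semigroup \<sigma> f) x = (1 / sqrt \<sigma>) ^ length is * gauss_conv is (sqrt \<sigma>) f x"
      by (simp add: c_def r_def)
  qed
  then show "partial_deriv is (heat_semigroup \<sigma> f) = (\<lambda>x. (1 / sqrt \<sigma>) ^ length is * gauss_conv is (sqrt \<sigma>) f x)" .
  have bound: "\<bar>partial_deriv is (heat_semigroup \<sigma> f) x\<bar> \<le> c ^ length is * (B * gauss_moment is)" for "is" x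
    unfolding eq abs_mult using gauss_conv_bound[OF f B, of "is" r x] c by (intro mult_mono) (auto simp: c_def r_def)
  show "heat_semigroup \<sigma> f \<in> Cn_space n"
    unfolding heat by (rule partial_deriv_LINT(5)[OF F_meas F_smooth dom bound[unfolded heat]])
qed

lemma heat_semigroup_eq:
  assumes "f \<in> borel_measurable borel" "\<And>x. \<bar>f x\<bar> \<le> B" "\<sigma> > 0"
  shows "heat_semigroup \<sigma> f x = gauss_conv [] (sqrt \<sigma>) f x"
  using fun_cong[OF partial_deriv_heat_semigroup(1)[OF assms, of "[]"], of x] by simp

lemma gauss_conv_zero:
  "gauss_conv [] 0 f x = f x"
  by (simp add: gauss_conv_def gauss_integral)

text \<open>Differentiate the heat flow of the constant function 1, which is 1.\<close>
lemma partial_deriv_gauss_mean_zero: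
  assumes "is \<noteq> []"
  shows "(LINT z|lborel. partial_deriv is (gauss :: real ^ 'n \<Rightarrow> real) z) = 0"
proof -
  have 1: "heat_semigroup 1 (\<lambda>_. 1) = (\<lambda>x :: real ^ 'n. 1)"
    by (rule ext, subst heat_semigroup_eq[where B=1]) (auto simp: gauss_conv_def gauss_integral)
  show ?thesis
    using fun_cong[OF partial_deriv_heat_semigroup(1)[of "\<lambda>_ :: real ^ 'n. 1" 1 1 "is"], of 0]
      partial_deriv_const[OF assms, of 1]
    by (simp add: 1 gauss_conv_def)
qed

text \<open>A derivative of the kernel has mean zero, so \<open>f x\<close> may be subtracted under
  the integral; the increment of f then contributes \<open>r powr \<alpha>\<close> and a power of
  \<open>norm z\<close> covered by the weight.\<close>

lemma gauss_conv_holder_bound: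
  fixes f :: "real ^ 'n \<Rightarrow> real"
  assumes f[measurable]: "f \<in> borel_measurable borel" and B: "\<And>x. \<bar>f x\<bar> \<le> B"
    and H: "\<And>x h. \<bar>f (x + h) - f x\<bar> \<le> K * norm h powr \<alpha>" and \<alpha>: "0 \<le> \<alpha>" "\<alpha> \<le> 1"
    and "is \<noteq> []" "r \<ge> 0"
  shows "\<bar>gauss_conv is r f x\<bar> \<le> K * r powr \<alpha> * gauss_moment is"
proof -
  have K: "K \<ge> 0" using H[of 0 "axis undefined 1"] by simp
  have int: "integrable lborel (\<lambda>z. partial_deriv is gauss z * (f (x - r *\<^sub>R z) - f x))"
    unfolding right_diff_distrib
    by (intro Bochner_Integration.integrable_diff gauss_conv_integrable[OF f B] integrable_mult_left integrable_partial_deriv_gauss)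
  have "gauss_conv is r f x = (LINT z|lborel. partial_deriv is gauss z * (f (x - r *\<^sub>R z) - f x))"
    unfolding right_diff_distrib gauss_conv_def
    using partial_deriv_gauss_mean_zero[OF \<open>is \<noteq> []\<close>]
    by (subst Bochner_Integration.integral_diff) (auto intro!: gauss_conv_integrable[OF f B] integrable_mult_left integrable_partial_deriv_gauss)
  then have "\<bar>gauss_conv is r f x\<bar> \<le> (LINT z|lborel. \<bar>partial_deriv is gauss z * (f (x - r *\<^sub>R z) - f x)\<bar>)"
    by (simp add: integral_abs_bound)
  also have "\<dots> \<le> (LINT z|lborel. (K * r powr \<alpha>) * (\<bar>partial_deriv is (gauss :: real ^ 'n \<Rightarrow> real) z\<bar> * (1 + norm z)))"
  proof (rule integral_mono)
    show "integrable lborel (\<lambda>z. \<bar>partial_deriv is gauss z * (f (x - r *\<^sub>R z) - f x)\<bar>)" using int by (rule integrable_abs)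
    show "integrable lborel (\<lambda>z::real^'n. (K * r powr \<alpha>) * (\<bar>partial_deriv is gauss z\<bar> * (1 + norm z)))"
      using integrable_gauss_moment by (rule integrable_mult_right)
    fix z :: "real ^ 'n"
    have "norm z powr \<alpha> \<le> 1 + norm z"
    proof (cases "norm z \<le> 1")
      case True
      then have "norm z powr \<alpha> \<le> 1 powr \<alpha>" using \<alpha> by (intro powr_mono2) auto
      then show ?thesis using norm_ge_zero[of z] by (simp del: norm_ge_zero)
    next
      case False
      then have "norm z powr \<alpha> \<le> norm z powr 1" using \<alpha> by (intro powr_mono) auto
      then show ?thesis using False by simp
    qed
    then have "K * r powr \<alpha> * norm z powr \<alpha> \<le> K * r powr \<alpha> * (1 + norm z)"
      using K by (intro mult_left_mono) auto
    moreover have "\<bar>f (x - r *\<^sub>R z) - f x\<bar> \<le> K * r powr \<alpha> * norm z powr \<alpha>"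
      using H[of x "- (r *\<^sub>R z)"] \<open>r \<ge> 0\<close> by (simp add: powr_mult mult.assoc)
    ultimately have "\<bar>f (x - r *\<^sub>R z) - f x\<bar> \<le> K * r powr \<alpha> * (1 + norm z)" by linarith
    from mult_left_mono[OF this, of "\<bar>partial_deriv is gauss z\<bar>"]
    show "\<bar>partial_deriv is gauss z * (f (x - r *\<^sub>R z) - f x)\<bar> \<le> (K * r powr \<alpha>) * (\<bar>partial_deriv is gauss z\<bar> * (1 + norm z))"
      by (simp add: abs_mult mult_ac)
  qed
  finally show ?thesis by (simp add: gauss_moment_def)
qed

text \<open>The parameter p will be the time argument of the source. The radius ranges over all
  reals including 0, which later yields continuity of the semigroup at time 0.\<close>

lemma continuous_on_gauss_conv:
  fixes u :: "'p::metric_space \<Rightarrow> real ^ 'n \<Rightarrow> real"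
  assumes cont: "continuous_on (S \<times> UNIV) (\<lambda>(p, x). u p x)" and B: "\<And>p x. p \<in> S \<Longrightarrow> \<bar>u p x\<bar> \<le> B"
  shows "continuous_on (S \<times> UNIV \<times> UNIV) (\<lambda>(p, r, x). gauss_conv is r (u p) x)"
  unfolding gauss_conv_def split_beta
proof (rule continuous_on_LINT[where w="\<lambda>z. \<bar>partial_deriv is gauss z\<bar> * B"])
  show "integrable lborel (\<lambda>z::real^'n. \<bar>partial_deriv is gauss z\<bar> * B)"
    by (intro integrable_mult_left integrable_abs integrable_partial_deriv_gauss)
  fix q :: "'p \<times> real \<times> (real ^ 'n)" assume q: "q \<in> S \<times> UNIV \<times> UNIV"
  then have S: "fst q \<in> S" by auto
  have "continuous_on UNIV (u (fst q))"
    by (rule continuous_on_compose2[OF cont, where f="\<lambda>x. (fst q, x)", simplified]) (use S in \<open>auto intro!: continuous_intros\<close>)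
  then have [measurable]: "u (fst q) \<in> borel_measurable borel" by (rule borel_measurable_continuous_onI)
  show "(\<lambda>z. partial_deriv is gauss z * u (fst q) (snd (snd q) - fst (snd q) *\<^sub>R z)) \<in> borel_measurable lborel"
    by measurable
  show "AE z in lborel. \<bar>partial_deriv is gauss z * u (fst q) (snd (snd q) - fst (snd q) *\<^sub>R z)\<bar> \<le> \<bar>partial_deriv is gauss z\<bar> * B"
    using B[OF S] by (intro AE_I2) (auto simp: abs_mult intro!: mult_left_mono)
  have "continuous_on (S \<times> UNIV \<times> UNIV) (\<lambda>q. u (fst q) (snd (snd q) - fst (snd q) *\<^sub>R z))" for z
    by (rule continuous_on_compose2[OF cont, where f="\<lambda>q. (fst q, snd (snd q) - fst (snd q) *\<^sub>R z)", simplified])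
      (auto intro!: continuous_intros)
  then show "AE z in lborel. continuous (at q within S \<times> UNIV \<times> UNIV) (\<lambda>q. partial_deriv is gauss z * u (fst q) (snd (snd q) - fst (snd q) *\<^sub>R z))"
    using q by (intro AE_I2 continuous_intros) (auto simp: continuous_on_eq_continuous_within)
qed

section \<open>The fractional heat semigroup\<close>

lemma powr_minus_half_nat:
  fixes x :: real
  assumes "x > 0"
  shows "x powr (- (real n / 2)) = 1 / sqrt x ^ n"
proof -
  have "sqrt x ^ n = x powr (real n / 2)"
    using assms by (simp add: powr_half_sqrt[symmetric] powr_realpow[symmetric] powr_powr)
  then show ?thesis by (simp add: powr_minus_divide)
qed

context
  fixes s :: real
  assumes s: "0 < s" "s < 1"
begin

text \<open>The length over which the semigroup spreads up to time t: sqrt (t^(1/s) \<rho>) equals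
  \<open>time_scale t * sqrt \<rho>\<close>.\<close>

definition time_scale :: "real \<Rightarrow> real" where "time_scale t = t powr (1 / (2 * s))"

lemma time_scale_pos: "t > 0 \<Longrightarrow> time_scale t > 0"
  by (simp add: time_scale_def)

lemma continuous_on_time_scale: "continuous_on {0..} time_scale"
  unfolding time_scale_def[abs_def] using s by (intro continuous_on_powr' continuous_intros) auto

lemma continuous_on_gauss_conv_radius:
  fixes f :: "real ^ 'n \<Rightarrow> real"
  assumes "continuous_on UNIV f" "\<And>x. \<bar>f x\<bar> \<le> B"
  shows "continuous_on UNIV (\<lambda>(r, x). gauss_conv is r f x)"
proof -
  \<comment> \<open>A one-point parameter set reduces the joint continuity to the pair of radius and
    position.\<close>
  have "continuous_on ({0::real} \<times> UNIV \<times> UNIV) (\<lambda>(p, r, x). gauss_conv is r f x)"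
    by (rule continuous_on_gauss_conv[where u="\<lambda>_. f"])
      (use assms in \<open>auto simp: split_beta intro!: continuous_on_compose2[OF assms(1)] continuous_intros\<close>)
  moreover have "continuous_on UNIV (\<lambda>q :: real \<times> (real ^ 'n). (0::real, q))"
    by (intro continuous_on_Pair continuous_intros)
  ultimately have "continuous_on UNIV (\<lambda>q. case (0::real, q) of (p, r, x) \<Rightarrow> gauss_conv is r f x)"
    by (rule continuous_on_compose2) auto
  then show ?thesis by simp
qed

lemma gauss_conv_radius_measurable:
  assumes "continuous_on UNIV f" "\<And>x. \<bar>f x\<bar> \<le> B"
  shows "(\<lambda>\<rho>. gauss_conv is (c * sqrt \<rho>) f x) \<in> borel_measurable (stable_measure s)"
    and "(\<lambda>\<rho>. k / (c * sqrt \<rho>) ^ n * gauss_conv is (c * sqrt \<rho>) f x) \<in> borel_measurable (stable_measure s)"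
proof -
  have c: "continuous_on {0<..} (\<lambda>\<rho>. gauss_conv is (c * sqrt \<rho>) f x)"
    by (rule continuous_on_compose2[OF continuous_on_gauss_conv_radius[OF assms], where f="\<lambda>\<rho>. (c * sqrt \<rho>, x)", simplified])
      (auto intro!: continuous_intros)
  then show m: "(\<lambda>\<rho>. gauss_conv is (c * sqrt \<rho>) f x) \<in> borel_measurable (stable_measure s)"
    by (rule borel_measurable_stable_measureI)
  have "(\<lambda>\<rho>. c * sqrt \<rho>) \<in> borel_measurable (stable_measure s)"
    by (intro borel_measurable_stable_measureI continuous_intros)
  with m show "(\<lambda>\<rho>. k / (c * sqrt \<rho>) ^ n * gauss_conv is (c * sqrt \<rho>) f x) \<in> borel_measurable (stable_measure s)"
    by measurable
qed

text \<open>The two averages with the scaling inserted. Since \<open>0 powr a = 0\<close>, the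
  length scale vanishes at t = 0 and the formula returns f there, so it covers the closed
  half-line.\<close>

lemma frac_semigroup_eq:
  fixes f :: "real ^ 'n \<Rightarrow> real"
  assumes f: "continuous_on UNIV f" "\<And>x. \<bar>f x\<bar> \<le> B" and t: "t \<ge> 0"
  shows "frac_semigroup s t f x = (LINT \<rho>|stable_measure s. gauss_conv [] (time_scale t * sqrt \<rho>) f x)"
proof (cases "t = 0")
  case True
  interpret prob_space "stable_measure s" by (rule prob_space_stable_measure[OF s])
  show ?thesis using True by (simp add: frac_semigroup_def time_scale_def gauss_conv_zero prob_space[simplified])
next
  case False
  then have t: "t > 0" using t by simp
  have fm: "f \<in> borel_measurable borel" by (rule borel_measurable_continuous_onI[OF f(1)])
  have "frac_semigroup s t f x = (LINT \<sigma>:{0<..}|lborel. gauss_conv [] (sqrt \<sigma>) f x * stable_density s t \<sigma>)"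
    unfolding frac_semigroup_def set_lebesgue_integral_def using False
    by (auto intro!: Bochner_Integration.integral_cong simp: indicator_def heat_semigroup_eq[OF fm f(2)])
  also have "\<dots> = (LINT \<rho>|stable_measure s. gauss_conv [] (sqrt (t powr (1 / s) * \<rho>)) f x)"
    by (intro set_integral_stable_density s t
        continuous_on_compose2[OF continuous_on_gauss_conv_radius[OF f], where f="\<lambda>\<sigma>. (sqrt \<sigma>, x)", simplified])
      (auto intro!: continuous_intros)
  also have "\<dots> = (LINT \<rho>|stable_measure s. gauss_conv [] (time_scale t * sqrt \<rho>) f x)"
    using t by (simp add: real_sqrt_mult time_scale_def powr_half_sqrt[symmetric] powr_powr mult.commute)
  finally show ?thesis .
qed

text \<open>A derivative of order j costs (sqrt \<rho>)^(-j), a negative moment of order j/2; the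
  moments up to order 2 account for the limit n \<le> 4.\<close>

lemma partial_deriv_frac_semigroup:
  fixes f :: "real ^ 'n \<Rightarrow> real"
  assumes f: "continuous_on UNIV f" "\<And>x. \<bar>f x\<bar> \<le> B" and t: "t > 0" and n: "n \<le> 4"
  shows "length is \<le> n \<Longrightarrow> partial_deriv is (frac_semigroup s t f) =
      (\<lambda>x. LINT \<rho>|stable_measure s. 1 / (time_scale t * sqrt \<rho>) ^ length is * gauss_conv is (time_scale t * sqrt \<rho>) f x)"
    and "length is \<le> n \<Longrightarrow> integrable (stable_measure s) (\<lambda>\<rho>. 1 / (time_scale t * sqrt \<rho>) ^ length is * gauss_conv is (time_scale t * sqrt \<rho>) f x)"
    and "frac_semigroup s t f \<in> Cn_space n"
proof -
  interpret prob_space "stable_measure s" by (rule prob_space_stable_measure[OF s])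
  define e where "e = time_scale t"
  have e: "e > 0" using t by (simp add: e_def time_scale_pos)
  have fm: "f \<in> borel_measurable borel" by (rule borel_measurable_continuous_onI[OF f(1)])
  have B0: "B \<ge> 0" using order_trans[OF abs_ge_zero f(2)] .
  define F where "F \<rho> = heat_semigroup (e\<^sup>2 * \<rho>) f" for \<rho>
  have sq: "sqrt (e\<^sup>2 * \<rho>) = e * sqrt \<rho>" for \<rho> using e by (simp add: real_sqrt_mult)
  have F_smooth: "F \<rho> \<in> Cn_space n" if "\<rho> \<in> space (stable_measure s)" for \<rho>
    unfolding F_def using that e by (intro partial_deriv_heat_semigroup(2)[OF fm f(2)]) auto
  have F_deriv: "partial_deriv is (F \<rho>) x = 1 / (e * sqrt \<rho>) ^ length is * gauss_conv is (e * sqrt \<rho>) f x"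
    if "\<rho> \<in> space (stable_measure s)" for \<rho> "is" x
  proof -
    have "e\<^sup>2 * \<rho> > 0" using that e by simp
    from partial_deriv_heat_semigroup(1)[OF fm f(2) this, of "is"]
    show ?thesis unfolding F_def sq power_one_over by (rule fun_cong)
  qed
  have F_meas: "(\<lambda>\<rho>. F \<rho> x) \<in> borel_measurable (stable_measure s)" for x
  proof -
    have "(\<lambda>\<rho>. F \<rho> x) \<in> borel_measurable (stable_measure s) \<longleftrightarrow> (\<lambda>\<rho>. gauss_conv [] (e * sqrt \<rho>) f x) \<in> borel_measurable (stable_measure s)"
      by (rule measurable_cong) (use F_deriv[of _ "[]"] in simp)
    then show ?thesis using gauss_conv_radius_measurable(1)[OF f] by simp
  qed
  have P: "frac_semigroup s t f = (\<lambda>x. LINT \<rho>|stable_measure s. F \<rho> x)"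
  proof
    fix x
    show "frac_semigroup s t f x = (LINT \<rho>|stable_measure s. F \<rho> x)"
      unfolding frac_semigroup_eq[OF f less_imp_le[OF t]]
      by (rule Bochner_Integration.integral_cong) (use F_deriv[of _ "[]"] in \<open>auto simp: e_def\<close>)
  qed
  define M where "M = (\<Sum>is\<in>{is :: 'n list. length is \<le> n}. gauss_moment is)"
  have M: "gauss_moment is \<le> M" if "length is \<le> n" for "is" :: "'n list"
    unfolding M_def using that by (intro member_le_sum finite_bounded_lists gauss_moment_nonneg) auto
  define w where "w \<rho> = (\<Sum>j\<le>n. B * M / e ^ j * \<rho> powr (- (real j / 2)))" for \<rho>
  have w_int: "integrable (stable_measure s) w"
    unfolding w_def using n by (intro Bochner_Integration.integrable_sum integrable_mult_right integrable_stable_measure_powr s) auto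
  have M0: "M \<ge> 0" unfolding M_def by (intro sum_nonneg gauss_moment_nonneg)
  have w_bound: "\<bar>partial_deriv is (F \<rho>) x\<bar> \<le> w \<rho>" if "\<rho> \<in> space (stable_measure s)" "length is \<le> n" for \<rho> x "is"
  proof -
    have \<rho>: "\<rho> > 0" using that by simp
    have "\<rho> powr (- (real (length is) / 2)) = 1 / sqrt \<rho> ^ length is"
      by (rule powr_minus_half_nat[OF \<rho>])
    then have eq: "1 / (e * sqrt \<rho>) ^ length is = 1 / e ^ length is * \<rho> powr (- (real (length is) / 2))"
      by (simp add: power_mult_distrib)
    have "\<bar>partial_deriv is (F \<rho>) x\<bar> = 1 / (e * sqrt \<rho>) ^ length is * \<bar>gauss_conv is (e * sqrt \<rho>) f x\<bar>"
      unfolding F_deriv[OF that(1)] abs_mult using e \<rho> by simp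
    also have "\<dots> \<le> 1 / (e * sqrt \<rho>) ^ length is * (B * M)"
      using gauss_conv_bound[OF fm f(2), of "is" "e * sqrt \<rho>" x] mult_left_mono[OF M[OF that(2)] B0] e \<rho>
      by (intro mult_left_mono) auto
    also have "\<dots> = B * M / e ^ length is * \<rho> powr (- (real (length is) / 2))"
      unfolding eq by simp
    also have "\<dots> \<le> w \<rho>"
      unfolding w_def using that M0 B0 e by (intro member_le_sum) auto
    finally show ?thesis .
  qed
  have dom: "\<exists>w. integrable (stable_measure s) w \<and> (\<forall>\<rho>\<in>space (stable_measure s). \<forall>x\<in>ball x0 1. \<forall>is. length is \<le> n \<longrightarrow>
                \<bar>partial_deriv is (F \<rho>) x\<bar> \<le> w \<rho>)" for x0
    using w_int w_bound by blast
  have L: "length is \<le> n \<Longrightarrow> partial_deriv is (\<lambda>x. LINT \<rho>|stable_measure s. F \<rho> x) = (\<lambda>x. LINT \<rho>|stable_measure s. partial_deriv is (F \<rho>) x)"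
    "length is \<le> n \<Longrightarrow> integrable (stable_measure s) (\<lambda>\<rho>. partial_deriv is (F \<rho>) x)" for "is" x
    by (rule partial_deriv_LINT[OF F_meas F_smooth dom]; assumption)+
  have cong: "(LINT \<rho>|stable_measure s. partial_deriv is (F \<rho>) x) =
    (LINT \<rho>|stable_measure s. 1 / (e * sqrt \<rho>) ^ length is * gauss_conv is (e * sqrt \<rho>) f x)" for "is" x
    by (rule Bochner_Integration.integral_cong) (auto simp: F_deriv)
  have icong: "integrable (stable_measure s) (\<lambda>\<rho>. partial_deriv is (F \<rho>) x) \<longleftrightarrow>
    integrable (stable_measure s) (\<lambda>\<rho>. 1 / (e * sqrt \<rho>) ^ length is * gauss_conv is (e * sqrt \<rho>) f x)" for "is" x
    by (rule Bochner_Integration.integrable_cong) (auto simp: F_deriv)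
  show "partial_deriv is (frac_semigroup s t f) =
      (\<lambda>x. LINT \<rho>|stable_measure s. 1 / (time_scale t * sqrt \<rho>) ^ length is * gauss_conv is (time_scale t * sqrt \<rho>) f x)"
    if "length is \<le> n"
    unfolding P L(1)[OF that] cong e_def ..
  show "integrable (stable_measure s) (\<lambda>\<rho>. 1 / (time_scale t * sqrt \<rho>) ^ length is * gauss_conv is (time_scale t * sqrt \<rho>) f x)"
    if "length is \<le> n"
    using L(2)[OF that] unfolding icong e_def .
  have bound: "\<bar>partial_deriv is (\<lambda>x. LINT \<rho>|stable_measure s. F \<rho> x) x\<bar> \<le> integral\<^sup>L (stable_measure s) w"
    if len: "length is \<le> n" for "is" x
    unfolding L(1)[OF len]
    by (rule order_trans[OF integral_abs_bound], rule integral_mono)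
      (use L(2)[OF len] w_int w_bound len in auto)
  show "frac_semigroup s t f \<in> Cn_space n"
    unfolding P by (rule partial_deriv_LINT(5)[OF F_meas F_smooth dom bound])
qed

definition frac_const :: "('n::finite) list \<Rightarrow> real \<Rightarrow> real" where
  "frac_const is a = gauss_moment is * (LINT \<rho>|stable_measure s. \<rho> powr (- a))"

lemma frac_const_nonneg: "frac_const is a \<ge> 0"
  unfolding frac_const_def by (intro mult_nonneg_nonneg gauss_moment_nonneg integral_nonneg_AE) auto

text \<open>The kernel yields the power \<alpha> - j of e sqrt \<rho>, where e = t^(1/2s) and j is
  the order: the part in e is the time singularity, the part in \<rho> a negative moment of order (j
  - \<alpha>)/2.\<close>

lemma partial_deriv_frac_semigroup_holder_bound:
  fixes f :: "real ^ 'n \<Rightarrow> real"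
  assumes f: "continuous_on UNIV f" "\<And>x. \<bar>f x\<bar> \<le> B" and t: "t > 0"
    and H: "\<And>x h. \<bar>f (x + h) - f x\<bar> \<le> K * norm h powr \<alpha>" and \<alpha>: "0 \<le> \<alpha>" "\<alpha> \<le> 1"
    and n: "length is \<le> 4" and ne: "is \<noteq> []"
  shows "\<bar>partial_deriv is (frac_semigroup s t f) x\<bar>
    \<le> K * frac_const is ((real (length is) - \<alpha>) / 2) * t powr (- ((real (length is) - \<alpha>) / (2 * s)))"
proof -
  let ?n = "length is"
  define e where "e = time_scale t"
  have e: "e > 0" using t by (simp add: e_def time_scale_pos)
  have K: "K \<ge> 0" using H[of 0 "axis undefined 1"] by simp
  have fm: "f \<in> borel_measurable borel" by (rule borel_measurable_continuous_onI[OF f(1)])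
  have n1: "?n \<ge> 1" using ne by (cases "is") auto
  define c where "c = K * gauss_moment is * e powr (\<alpha> - real ?n)"
  define G where "G \<rho> = 1 / (e * sqrt \<rho>) ^ ?n * gauss_conv is (e * sqrt \<rho>) f x" for \<rho>
  have G_int: "integrable (stable_measure s) G"
    unfolding G_def e_def by (rule partial_deriv_frac_semigroup(2)[OF f t n order_refl])
  have m_int: "integrable (stable_measure s) (\<lambda>\<rho>. c * \<rho> powr (- ((real ?n - \<alpha>) / 2)))"
    using n1 n \<alpha> by (intro integrable_mult_right integrable_stable_measure_powr s) auto
  have "\<bar>partial_deriv is (frac_semigroup s t f) x\<bar> = \<bar>LINT \<rho>|stable_measure s. G \<rho>\<bar>"
    unfolding G_def e_def by (subst partial_deriv_frac_semigroup(1)[OF f t n order_refl]) simp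
  also have "\<dots> \<le> (LINT \<rho>|stable_measure s. \<bar>G \<rho>\<bar>)" by (rule integral_abs_bound)
  also have "\<dots> \<le> (LINT \<rho>|stable_measure s. c * \<rho> powr (- ((real ?n - \<alpha>) / 2)))"
  proof (rule integral_mono)
    fix \<rho> assume "\<rho> \<in> space (stable_measure s)"
    then have \<rho>: "\<rho> > 0" by simp
    have r: "e * sqrt \<rho> > 0" using e \<rho> by simp
    have "\<bar>G \<rho>\<bar> = 1 / (e * sqrt \<rho>) ^ ?n * \<bar>gauss_conv is (e * sqrt \<rho>) f x\<bar>"
      unfolding G_def abs_mult using r by simp
    also have "\<dots> \<le> 1 / (e * sqrt \<rho>) ^ ?n * (K * (e * sqrt \<rho>) powr \<alpha> * gauss_moment is)"
      using gauss_conv_holder_bound[OF fm f(2) H \<alpha> ne, of "e * sqrt \<rho>"] r by (intro mult_left_mono) auto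
    also have "\<dots> = K * gauss_moment is * (e * sqrt \<rho>) powr (\<alpha> - real ?n)"
      using r by (simp add: powr_diff powr_realpow)
    also have "\<dots> = c * \<rho> powr (- ((real ?n - \<alpha>) / 2))"
    proof -
      have "- ((real ?n - \<alpha>) / 2) = 1 / 2 * (\<alpha> - real ?n)" by (simp add: diff_divide_distrib algebra_simps)
      then have "sqrt \<rho> powr (\<alpha> - real ?n) = \<rho> powr (- ((real ?n - \<alpha>) / 2))"
        using \<rho> by (simp only: powr_half_sqrt[symmetric] powr_powr less_imp_le)
      then show ?thesis using e \<rho> by (simp add: c_def powr_mult)
    qed
    finally show "\<bar>G \<rho>\<bar> \<le> c * \<rho> powr (- ((real ?n - \<alpha>) / 2))" .
  qed (use G_int m_int in auto)
  also have "\<dots> = K * frac_const is ((real ?n - \<alpha>) / 2) * e powr (\<alpha> - real ?n)"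
    by (simp add: c_def frac_const_def mult_ac)
  also have "e powr (\<alpha> - real ?n) = t powr (- ((real ?n - \<alpha>) / (2 * s)))"
    using t s by (simp add: e_def time_scale_def powr_powr flip: minus_divide_left) (simp add: minus_divide_left)
  finally show ?thesis .
qed

lemma integrable_frac_semigroup:
  fixes f :: "real ^ 'n \<Rightarrow> real"
  assumes f: "continuous_on UNIV f" "\<And>x. \<bar>f x\<bar> \<le> B"
  shows "integrable (stable_measure s) (\<lambda>\<rho>. gauss_conv [] (c * sqrt \<rho>) f x)"
proof -
  interpret prob_space "stable_measure s" by (rule prob_space_stable_measure[OF s])
  show ?thesis
    by (rule integrable_const_bound[where B=B])
      (use gauss_conv_Nil_bound[OF borel_measurable_continuous_onI[OF f(1)] f(2)] gauss_conv_radius_measurable(1)[OF f] in auto)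
qed

text \<open>The semigroup is an average of translations, so it preserves bounds on difference operators.\<close>
lemma frac_semigroup_diff_bound:
  fixes f :: "real ^ 'n \<Rightarrow> real"
  assumes f: "continuous_on UNIV f" "\<And>x. \<bar>f x\<bar> \<le> B" and t: "t \<ge> 0"
    and K: "\<And>y. \<bar>a * f (y + 2 *\<^sub>R h) + b * f (y + h) + c * f y\<bar> \<le> K"
  shows "\<bar>a * frac_semigroup s t f (x + 2 *\<^sub>R h) + b * frac_semigroup s t f (x + h) + c * frac_semigroup s t f x\<bar> \<le> K"
proof -
  interpret prob_space "stable_measure s" by (rule prob_space_stable_measure[OF s])
  define g where "g y = a * f (y + 2 *\<^sub>R h) + b * f (y + h) + c * f y" for y
  have fm: "f \<in> borel_measurable borel" by (rule borel_measurable_continuous_onI[OF f(1)])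
  have g: "g \<in> borel_measurable borel" unfolding g_def[abs_def] using fm by measurable
  have eq: "a * gauss_conv [] r f (x + 2 *\<^sub>R h) + b * gauss_conv [] r f (x + h) + c * gauss_conv [] r f x = gauss_conv [] r g x" for r
  proof -
    have "gauss_conv [] r g x = (LINT z|lborel. a * (gauss z * f (x + 2 *\<^sub>R h - r *\<^sub>R z)) + b * (gauss z * f (x + h - r *\<^sub>R z)) + c * (gauss z * f (x - r *\<^sub>R z)))"
      unfolding gauss_conv_def g_def by (rule Bochner_Integration.integral_cong) (simp_all add: algebra_simps)
    then show ?thesis
      using gauss_conv_integrable[OF fm f(2), of "[]"] by (simp add: gauss_conv_def)
  qed
  note I = integrable_frac_semigroup[OF f, of "time_scale t"]
  have "a * frac_semigroup s t f (x + 2 *\<^sub>R h) + b * frac_semigroup s t f (x + h) + c * frac_semigroup s t f x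
    = (LINT \<rho>|stable_measure s. gauss_conv [] (time_scale t * sqrt \<rho>) g x)"
    unfolding frac_semigroup_eq[OF f t] eq[symmetric] using I by simp
  also have "\<bar>\<dots>\<bar> \<le> (LINT \<rho>|stable_measure s. K)"
  proof (rule order_trans[OF integral_abs_bound], rule integral_mono)
    show "integrable (stable_measure s) (\<lambda>\<rho>. \<bar>gauss_conv [] (time_scale t * sqrt \<rho>) g x\<bar>)"
      unfolding eq[symmetric] using I by (intro integrable_abs Bochner_Integration.integrable_add integrable_mult_right) auto
    show "\<bar>gauss_conv [] (time_scale t * sqrt \<rho>) g x\<bar> \<le> K" for \<rho>
      by (rule gauss_conv_Nil_bound[OF g]) (use K in \<open>simp add: g_def\<close>)
  qed auto
  finally show ?thesis by (simp add: prob_space[simplified])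
qed

lemma frac_semigroup_bound:
  fixes f :: "real ^ 'n \<Rightarrow> real"
  assumes f: "continuous_on UNIV f" "\<And>x. \<bar>f x\<bar> \<le> B" and t: "t \<ge> 0"
  shows "\<bar>frac_semigroup s t f x\<bar> \<le> B"
  using frac_semigroup_diff_bound[OF f t, of 0 0 0 1 B x] f(2) by simp

text \<open>Here the derivatives fall on the translates of f, so the bounds stay uniform down to t =
  0. This form treats the initial datum; the source, which may lack derivatives, uses the smoothing
  form instead.\<close>

lemma partial_deriv_frac_semigroup_commute:
  fixes f :: "real ^ 'n \<Rightarrow> real"
  assumes f: "f \<in> Cn_space n" and t: "t \<ge> 0"
  shows "length is \<le> n \<Longrightarrow> partial_deriv is (frac_semigroup s t f) = frac_semigroup s t (partial_deriv is f)"
    and "frac_semigroup s t f \<in> Cn_space n"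
proof -
  interpret prob_space "stable_measure s" by (rule prob_space_stable_measure[OF s])
  obtain B where B: "\<And>is x. length is \<le> n \<Longrightarrow> \<bar>partial_deriv is f x\<bar> \<le> B" using Cn_space_bounded[OF f] by blast
  have cont: "continuous_on UNIV (partial_deriv is f)" if "length is \<le> n" for "is" using f that by (auto simp: Cn_space_def)
  have f0: "continuous_on UNIV f" "\<And>x. \<bar>f x\<bar> \<le> B" using cont[of "[]"] B[of "[]"] by auto
  have fm: "partial_deriv is f \<in> borel_measurable borel" if "length is \<le> n" for "is" by (rule borel_measurable_continuous_onI[OF cont[OF that]])
  \<comment> \<open>The Gaussian average at a fixed radius comes before the stable average. Both
    have mass 1, so the bound B of the derivatives survives and serves as majorant for the
    second.\<close>
  have inner: "(length is \<le> n \<longrightarrow> partial_deriv is (gauss_conv [] r f) = gauss_conv [] r (partial_deriv is f)) \<and> gauss_conv [] r f \<in> Cn_space n" for r "is"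
  proof -
    define F where "F z x = gauss z * f (1 *\<^sub>R x + (- r *\<^sub>R z))" for z x
    have smooth: "F z \<in> Cn_space n" for z unfolding F_def by (rule partial_deriv_affine(2)[OF f])
    have deriv: "partial_deriv is (F z) x = gauss z * partial_deriv is f (x - r *\<^sub>R z)" if "length is \<le> n" for z x "is"
      unfolding F_def partial_deriv_affine(1)[OF f that] by simp
    have eq: "gauss_conv [] r f = (\<lambda>x. LINT z|lborel. F z x)" by (simp add: F_def gauss_conv_def fun_eq_iff)
    have meas: "(\<lambda>z. F z x) \<in> borel_measurable lborel" for x
      using gauss_conv_integrable[OF fm[of "[]"] B[of "[]"], of "[]" x r] by (auto simp: F_def)
    have dom: "\<exists>w. integrable lborel w \<and> (\<forall>z\<in>space lborel. \<forall>x\<in>ball x0 1. \<forall>is. length is \<le> n \<longrightarrow> \<bar>partial_deriv is (F z) x\<bar> \<le> w z)" for x0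
    proof (intro exI conjI ballI allI impI)
      show "integrable lborel (\<lambda>z::real^'n. gauss z * B)" by (intro integrable_mult_left gauss_integral)
      fix z x and "is" :: "'n list" assume "length is \<le> n"
      then show "\<bar>partial_deriv is (F z) x\<bar> \<le> gauss z * B"
        using mult_left_mono[OF B[of "is" "x - r *\<^sub>R z"], of "gauss z"] gauss_pos[of z] by (simp add: deriv abs_mult)
    qed
    note L = partial_deriv_LINT[OF meas smooth dom]
    have 1: "partial_deriv is (gauss_conv [] r f) = gauss_conv [] r (partial_deriv is f)" if "length is \<le> n" for "is"
      unfolding eq L(1)[OF that] by (simp add: deriv[OF that] gauss_conv_def fun_eq_iff)
    have "\<bar>partial_deriv is (gauss_conv [] r f) x\<bar> \<le> B" if "length is \<le> n" for "is" x
      unfolding 1[OF that] by (rule gauss_conv_Nil_bound[OF fm[OF that] B[OF that]])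
    then have "gauss_conv [] r f \<in> Cn_space n" unfolding eq by (rule L(5))
    with 1 show ?thesis by blast
  qed
  define F where "F \<rho> = gauss_conv [] (time_scale t * sqrt \<rho>) f" for \<rho>
  have eq: "frac_semigroup s t f = (\<lambda>x. LINT \<rho>|stable_measure s. F \<rho> x)"
    unfolding F_def using frac_semigroup_eq[OF f0 t] by auto
  have meas: "(\<lambda>\<rho>. F \<rho> x) \<in> borel_measurable (stable_measure s)" for x
    unfolding F_def by (rule gauss_conv_radius_measurable(1)[OF f0])
  have smooth: "F \<rho> \<in> Cn_space n" for \<rho> unfolding F_def using inner by blast
  have dom: "\<exists>w. integrable (stable_measure s) w \<and> (\<forall>z\<in>space (stable_measure s). \<forall>x\<in>ball x0 1. \<forall>is. length is \<le> n \<longrightarrow> \<bar>partial_deriv is (F z) x\<bar> \<le> w z)" for x0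
    by (intro exI[of _ "\<lambda>_. B"]) (use inner gauss_conv_Nil_bound[OF fm B] in \<open>auto simp: F_def\<close>)
  note L = partial_deriv_LINT[OF meas smooth dom]
  have 1: "partial_deriv is (frac_semigroup s t f) = frac_semigroup s t (partial_deriv is f)" if "length is \<le> n" for "is"
  proof
    fix x
    show "partial_deriv is (frac_semigroup s t f) x = frac_semigroup s t (partial_deriv is f) x"
      unfolding eq L(1)[OF that] frac_semigroup_eq[OF cont[OF that] B[OF that] t]
      by (simp add: F_def inner[THEN conjunct1, rule_format, OF that])
  qed
  then show "length is \<le> n \<Longrightarrow> partial_deriv is (frac_semigroup s t f) = frac_semigroup s t (partial_deriv is f)" .
  have "\<bar>partial_deriv is (frac_semigroup s t f) x\<bar> \<le> B" if "length is \<le> n" for "is" x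
    unfolding 1[OF that] by (rule frac_semigroup_bound[OF cont[OF that] B[OF that] t])
  then show "frac_semigroup s t f \<in> Cn_space n" unfolding eq by (rule L(5))
qed

section \<open>Families depending continuously on a parameter\<close>

context
  fixes u :: "'p::metric_space \<Rightarrow> real ^ 'n \<Rightarrow> real" and S :: "'p set" and B :: real
  assumes cont: "continuous_on (S \<times> UNIV) (\<lambda>(p, x). u p x)" and B: "\<And>p x. p \<in> S \<Longrightarrow> \<bar>u p x\<bar> \<le> B"
begin

lemma continuous_on_slice: "p \<in> S \<Longrightarrow> continuous_on UNIV (u p)"
  by (rule continuous_on_compose2[OF cont, where f="\<lambda>x. (p, x)", simplified]) (auto intro!: continuous_intros)

text \<open>Time and parameter must vary jointly because Duhamel's integrand moves both, as \<tau>
  and t - \<tau>.\<close>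

lemma continuous_on_frac_semigroup:
  "continuous_on ({0..} \<times> S \<times> UNIV) (\<lambda>(t, p, x). frac_semigroup s t (u p) x)"
proof -
  interpret prob_space "stable_measure s" by (rule prob_space_stable_measure[OF s])
  have ts: "continuous_on ({0..} \<times> S \<times> (UNIV :: (real ^ 'n) set)) (\<lambda>q. time_scale (fst q))"
    by (rule continuous_on_compose2[OF continuous_on_time_scale, of _ fst]) (auto intro: continuous_intros)
  have "continuous_on ({0..} \<times> S \<times> UNIV) (\<lambda>q. LINT \<rho>|stable_measure s. gauss_conv [] (time_scale (fst q) * sqrt \<rho>) (u (fst (snd q))) (snd (snd q)))"
  proof (rule continuous_on_LINT[where w="\<lambda>_. B"])
    fix q :: "real \<times> 'p \<times> (real ^ 'n)" assume q: "q \<in> {0..} \<times> S \<times> UNIV"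
    then have S: "fst (snd q) \<in> S" by auto
    show "(\<lambda>\<rho>. gauss_conv [] (time_scale (fst q) * sqrt \<rho>) (u (fst (snd q))) (snd (snd q))) \<in> borel_measurable (stable_measure s)"
      by (rule gauss_conv_radius_measurable(1)[OF continuous_on_slice[OF S] B[OF S]])
    show "AE \<rho> in stable_measure s. \<bar>gauss_conv [] (time_scale (fst q) * sqrt \<rho>) (u (fst (snd q))) (snd (snd q))\<bar> \<le> B"
      by (intro AE_I2 gauss_conv_Nil_bound B[OF S] borel_measurable_continuous_onI continuous_on_slice S)
    have "continuous_on ({0..} \<times> S \<times> UNIV) (\<lambda>q. gauss_conv [] (time_scale (fst q) * sqrt \<rho>) (u (fst (snd q))) (snd (snd q)))" for \<rho>
      by (rule continuous_on_compose2[OF continuous_on_gauss_conv[OF cont B],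
            where f="\<lambda>q. (fst (snd q), time_scale (fst q) * sqrt \<rho>, snd (snd q))", simplified])
        (auto intro!: continuous_intros ts)
    then show "AE \<rho> in stable_measure s. continuous (at q within {0..} \<times> S \<times> UNIV) (\<lambda>q. gauss_conv [] (time_scale (fst q) * sqrt \<rho>) (u (fst (snd q))) (snd (snd q)))"
      using q by (auto simp: continuous_on_eq_continuous_within)
  qed auto
  then show ?thesis
    by (rule continuous_on_eq) (auto simp: frac_semigroup_eq[OF continuous_on_slice B])
qed

text \<open>For fixed \<tau> Duhamel's integrand depends on t through the source only, so continuity
  is wanted in the parameter and in x at a fixed positive time.\<close>

lemma continuous_on_partial_deriv_frac_semigroup:
  assumes t: "t > 0" and len: "length is \<le> 4"
  shows "continuous_on (S \<times> UNIV) (\<lambda>(p, x). partial_deriv is (frac_semigroup s t (u p)) x)"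
proof -
  interpret prob_space "stable_measure s" by (rule prob_space_stable_measure[OF s])
  let ?n = "length is"
  define e where "e = time_scale t"
  have e: "e > 0" using t by (simp add: e_def time_scale_pos)
  define w where "w \<rho> = (B * gauss_moment is / e ^ ?n) * \<rho> powr (- (real ?n / 2))" for \<rho>
  have "continuous_on (S \<times> UNIV) (\<lambda>q. LINT \<rho>|stable_measure s. 1 / (e * sqrt \<rho>) ^ ?n * gauss_conv is (e * sqrt \<rho>) (u (fst q)) (snd q))"
  proof (rule continuous_on_LINT[where w=w])
    show "integrable (stable_measure s) w"
      unfolding w_def using len by (intro integrable_mult_right integrable_stable_measure_powr s) auto
    fix q :: "'p \<times> (real ^ 'n)" assume q: "q \<in> S \<times> UNIV"
    then have S: "fst q \<in> S" by auto
    show "(\<lambda>\<rho>. 1 / (e * sqrt \<rho>) ^ ?n * gauss_conv is (e * sqrt \<rho>) (u (fst q)) (snd q)) \<in> borel_measurable (stable_measure s)"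
      by (rule gauss_conv_radius_measurable(2)[OF continuous_on_slice[OF S] B[OF S]])
    show "AE \<rho> in stable_measure s. \<bar>1 / (e * sqrt \<rho>) ^ ?n * gauss_conv is (e * sqrt \<rho>) (u (fst q)) (snd q)\<bar> \<le> w \<rho>"
    proof (rule AE_I2)
      fix \<rho> assume "\<rho> \<in> space (stable_measure s)"
      then have \<rho>: "\<rho> > 0" by simp
      have "\<rho> powr (- (real ?n / 2)) = 1 / sqrt \<rho> ^ ?n"
        by (rule powr_minus_half_nat[OF \<rho>])
      then have eq: "w \<rho> = 1 / (e * sqrt \<rho>) ^ ?n * (B * gauss_moment is)"
        by (simp add: w_def power_mult_distrib)
      show "\<bar>1 / (e * sqrt \<rho>) ^ ?n * gauss_conv is (e * sqrt \<rho>) (u (fst q)) (snd q)\<bar> \<le> w \<rho>"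
        unfolding eq abs_mult using e \<rho> gauss_conv_bound[OF borel_measurable_continuous_onI[OF continuous_on_slice[OF S]] B[OF S], of "is" "e * sqrt \<rho>" "snd q"]
        by (intro mult_mono) auto
    qed
    have "continuous_on (S \<times> UNIV) (\<lambda>q. gauss_conv is (e * sqrt \<rho>) (u (fst q)) (snd q))" for \<rho>
      by (rule continuous_on_compose2[OF continuous_on_gauss_conv[OF cont B],
            where f="\<lambda>q. (fst q, e * sqrt \<rho>, snd q)", simplified])
        (auto intro!: continuous_intros)
    then have "continuous_on (S \<times> UNIV) (\<lambda>q. 1 / (e * sqrt \<rho>) ^ ?n * gauss_conv is (e * sqrt \<rho>) (u (fst q)) (snd q))" for \<rho>
      by (intro continuous_on_mult continuous_on_const)
    then show "AE \<rho> in stable_measure s. continuous (at q within S \<times> UNIV) (\<lambda>q. 1 / (e * sqrt \<rho>) ^ ?n * gauss_conv is (e * sqrt \<rho>) (u (fst q)) (snd q))"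
      using q unfolding continuous_on_eq_continuous_within by blast
  qed
  then show ?thesis
    by (rule continuous_on_eq)
      (auto simp: e_def partial_deriv_frac_semigroup(1)[OF continuous_on_slice B t len order_refl])
qed

end

end

section \<open>Duhamel's integral\<close>

lemma has_bochner_integral_powr_from_0:
  fixes b l :: real
  assumes "b < 1" "l \<ge> 0"
  shows "has_bochner_integral lborel (\<lambda>\<tau>. indicator {0<..l} \<tau> * \<tau> powr (- b)) (l powr (1 - b) / (1 - b))"
proof (rule has_bochner_integral_nn_integral)
  have "((\<lambda>\<tau>. \<tau> powr (- b)) has_integral (l powr (- b + 1) / (- b + 1))) {0..l}"
    using assms by (intro has_integral_powr_from_0) auto
  then have "((\<lambda>\<tau>. if \<tau> \<in> {0..l} then \<tau> powr (- b) else 0) has_integral (l powr (- b + 1) / (- b + 1))) UNIV"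
    by (subst has_integral_restrict_UNIV)
  also have "(\<lambda>\<tau>. if \<tau> \<in> {0..l} then \<tau> powr (- b) else 0) = (\<lambda>\<tau>. indicator {0<..l} \<tau> * \<tau> powr (- b))"
    by (auto simp: fun_eq_iff indicator_def)
  finally show "(\<integral>\<^sup>+ x. ennreal (indicator {0<..l} x * x powr (- b)) \<partial>lborel) = ennreal (l powr (1 - b) / (1 - b))"
    by (intro nn_integral_has_integral_lborel) auto
qed (use assms in auto)

lemma has_bochner_integral_powr_to_inf:
  fixes d l :: real
  assumes "d > 1" "l > 0"
  shows "has_bochner_integral lborel (\<lambda>\<tau>. indicator {l..} \<tau> * \<tau> powr (- d)) (l powr (1 - d) / (d - 1))"
proof (rule has_bochner_integral_nn_integral)
  have "((\<lambda>\<tau>. \<tau> powr (- d)) has_integral (- (l powr (- d + 1)) / (- d + 1))) {l..}"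
    using assms by (intro has_integral_powr_to_inf) auto
  moreover have "- (l powr (- d + 1)) / (- d + 1) = l powr (1 - d) / (d - 1)"
    using assms by (simp add: field_simps)
  ultimately have "((\<lambda>\<tau>. if \<tau> \<in> {l..} then \<tau> powr (- d) else 0) has_integral (l powr (1 - d) / (d - 1))) UNIV"
    by (subst has_integral_restrict_UNIV) simp
  also have "(\<lambda>\<tau>. if \<tau> \<in> {l..} then \<tau> powr (- d) else 0) = (\<lambda>\<tau>. indicator {l..} \<tau> * \<tau> powr (- d))"
    by (auto simp: fun_eq_iff indicator_def)
  finally show "(\<integral>\<^sup>+ x. ennreal (indicator {l..} x * x powr (- d)) \<partial>lborel) = ennreal (l powr (1 - d) / (d - 1))"
    by (intro nn_integral_has_integral_lborel) auto
qed (use assms in auto)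

definition time_measure :: "real \<Rightarrow> real measure" where
  "time_measure T = restrict_space lborel {0<..<T}"

lemma space_time_measure [simp]: "space (time_measure T) = {0<..<T}"
  by (simp add: time_measure_def space_restrict_space)

lemma integrable_time_measure_powr:
  fixes b :: real
  assumes "b < 1" "T > 0"
  shows "integrable (time_measure T) (\<lambda>\<tau>. \<tau> powr (- b))"
proof -
  have "set_integrable lborel {0<..T} (\<lambda>\<tau>. \<tau> powr (- b))"
    using integrable.intros[OF has_bochner_integral_powr_from_0[OF assms(1), of T]] assms
    by (simp add: set_integrable_def)
  then have "set_integrable lborel {0<..<T} (\<lambda>\<tau>. \<tau> powr (- b))"
    by (rule set_integrable_subset) auto
  then show ?thesis
    unfolding time_measure_def set_integrable_def by (subst integrable_restrict_space) auto
qed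

lemma integrable_time_measure_const: "T > 0 \<Longrightarrow> integrable (time_measure T) (\<lambda>\<tau>. k :: real)"
  unfolding time_measure_def by (subst integrable_restrict_space) (auto intro!: integrable_mult_left)

text \<open>Split the integral at \<open>\<tau> = \<rho>\<^bsup>2 s\<^esup>\<close>, where the two bounds are comparable.\<close>
lemma time_integral_interpolation:
  fixes \<phi> :: "real \<Rightarrow> real"
  assumes 1: "\<And>\<tau>. 0 < \<tau> \<Longrightarrow> \<tau> < T \<Longrightarrow> \<bar>\<phi> \<tau>\<bar> \<le> A * \<rho> powr a * \<tau> powr (- b)"
    and 2: "\<And>\<tau>. 0 < \<tau> \<Longrightarrow> \<tau> < T \<Longrightarrow> \<bar>\<phi> \<tau>\<bar> \<le> A * \<rho> powr c * \<tau> powr (- d)"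
    and b: "b < 1" and d: "d > 1" and \<rho>: "\<rho> > 0" and A: "A \<ge> 0"
    and e: "e = a + 2 * s * (1 - b)" "e = c - 2 * s * (d - 1)"
  shows "\<bar>LINT \<tau>|time_measure T. \<phi> \<tau>\<bar> \<le> A * (1 / (1 - b) + 1 / (d - 1)) * \<rho> powr e"
proof -
  define l where "l = \<rho> powr (2 * s)"
  have l: "l > 0" using \<rho> by (simp add: l_def)
  define I1 where "I1 \<tau> = indicator {0<..l} \<tau> * \<tau> powr (- b)" for \<tau> :: real
  define I2 where "I2 \<tau> = indicator {l..} \<tau> * \<tau> powr (- d)" for \<tau> :: real
  have I1: "has_bochner_integral lborel I1 (l powr (1 - b) / (1 - b))"
    unfolding I1_def using b l by (intro has_bochner_integral_powr_from_0) auto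
  have I2: "has_bochner_integral lborel I2 (l powr (1 - d) / (d - 1))"
    unfolding I2_def using d l by (intro has_bochner_integral_powr_to_inf) auto
  have "(LINT \<tau>|time_measure T. \<phi> \<tau>) = (LINT \<tau>|lborel. indicator {0<..<T} \<tau> *\<^sub>R \<phi> \<tau>)"
    unfolding time_measure_def by (subst integral_restrict_space) auto
  then have "\<bar>LINT \<tau>|time_measure T. \<phi> \<tau>\<bar> \<le> (LINT \<tau>|lborel. \<bar>indicator {0<..<T} \<tau> *\<^sub>R \<phi> \<tau>\<bar>)"
    by (simp add: integral_abs_bound)
  also have "\<dots> \<le> (LINT \<tau>|lborel. A * \<rho> powr a * I1 \<tau> + A * \<rho> powr c * I2 \<tau>)"
  \<comment> \<open>This rule asks for integrability of the majorant only; a nonintegrable left side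
    has integral 0 by convention.\<close>
  proof (rule integral_mono')
    show "integrable lborel (\<lambda>\<tau>. A * \<rho> powr a * I1 \<tau> + A * \<rho> powr c * I2 \<tau>)"
      using I1 I2 by (intro Bochner_Integration.integrable_add integrable_mult_right integrable.intros)
    fix \<tau> :: real
    have nonneg: "I1 \<tau> \<ge> 0" "I2 \<tau> \<ge> 0" by (auto simp: I1_def I2_def)
    then have nn: "0 \<le> A * \<rho> powr a * I1 \<tau>" "0 \<le> A * \<rho> powr c * I2 \<tau>" using A by auto
    then show "0 \<le> A * \<rho> powr a * I1 \<tau> + A * \<rho> powr c * I2 \<tau>" by simp
    show "\<bar>indicator {0<..<T} \<tau> *\<^sub>R \<phi> \<tau>\<bar> \<le> A * \<rho> powr a * I1 \<tau> + A * \<rho> powr c * I2 \<tau>"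
    proof (cases "0 < \<tau> \<and> \<tau> < T")
      case True
      then have ind: "\<bar>indicator {0<..<T} \<tau> *\<^sub>R \<phi> \<tau>\<bar> = \<bar>\<phi> \<tau>\<bar>" by simp
      show ?thesis
      proof (cases "\<tau> \<le> l")
        case le: True
        have "\<bar>\<phi> \<tau>\<bar> \<le> A * \<rho> powr a * I1 \<tau>" using 1[of \<tau>] True le by (simp add: I1_def)
        then show ?thesis unfolding ind using nn by linarith
      next
        case False
        have "\<bar>\<phi> \<tau>\<bar> \<le> A * \<rho> powr c * I2 \<tau>" using 2[of \<tau>] True False by (simp add: I2_def)
        then show ?thesis unfolding ind using nn by linarith
      qed
    qed (use nn in \<open>auto simp: indicator_def\<close>)
  qed
  also have "\<dots> = A * \<rho> powr a * (l powr (1 - b) / (1 - b)) + A * \<rho> powr c * (l powr (1 - d) / (d - 1))"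
    using I1 I2 by (intro has_bochner_integral_integral_eq has_bochner_integral_add has_bochner_integral_mult_right)
  also have "\<dots> = A * (1 / (1 - b) + 1 / (d - 1)) * \<rho> powr e"
  proof -
    have "\<rho> powr a * l powr (1 - b) = \<rho> powr e"
      using \<rho> by (simp add: l_def powr_powr powr_add[symmetric] e(1))
    moreover have "c + 2 * s * (1 - d) = e" unfolding e(2) by (simp add: algebra_simps)
    then have "\<rho> powr c * l powr (1 - d) = \<rho> powr e"
      using \<rho> by (simp add: l_def powr_powr powr_add[symmetric])
    moreover have "A * \<rho> powr a * (l powr (1 - b) / (1 - b)) + A * \<rho> powr c * (l powr (1 - d) / (d - 1)) =
      A * (1 / (1 - b)) * (\<rho> powr a * l powr (1 - b)) + A * (1 / (d - 1)) * (\<rho> powr c * l powr (1 - d))" by simp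
    ultimately show ?thesis by (simp only: distrib_left distrib_right)
  qed
  finally show ?thesis .
qed

section \<open>First and second differences\<close>

text \<open>The difference operator of order \<open>m\<close>, meant for \<open>m = 1\<close> and \<open>m = 2\<close> only.\<close>
definition ddiff :: "nat \<Rightarrow> (real ^ 'n \<Rightarrow> real) \<Rightarrow> real ^ 'n \<Rightarrow> real ^ 'n \<Rightarrow> real" where
  "ddiff m u h x = (if m = 1 then u (x + h) - u x else u (x + 2 *\<^sub>R h) - 2 * u (x + h) + u x)"

text \<open>A real-valued stand-in for both kinds of norms: m = 1 with \<beta> in (0,1) is the
  Hoelder case, m = 2 with \<beta> = 1 the Zygmund case, with one constant for all
  components.\<close>

definition ddiff_bounded :: "nat \<Rightarrow> nat \<Rightarrow> real \<Rightarrow> real \<Rightarrow> (real ^ 'n \<Rightarrow> real) \<Rightarrow> bool" where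
  "ddiff_bounded n m \<beta> K u \<longleftrightarrow> u \<in> Cn_space n \<and>
    (\<forall>is x. length is \<le> n \<longrightarrow> \<bar>partial_deriv is u x\<bar> \<le> K) \<and>
    (\<forall>is h x. length is = n \<longrightarrow> \<bar>ddiff m (partial_deriv is u) h x\<bar> \<le> K * norm h powr \<beta>)"

text \<open>A second difference is a difference of two first differences, hence the factor 2; for a
  first difference it is slack that keeps the statement uniform in m.\<close>

lemma ddiff_le_diff:
  fixes u :: "real ^ 'n \<Rightarrow> real"
  assumes "\<And>x. \<bar>u (x + h) - u x\<bar> \<le> K"
  shows "\<bar>ddiff m u h x\<bar> \<le> 2 * K"
proof -
  have eq: "x + 2 *\<^sub>R h = (x + h) + h" by (simp only: scaleR_2 add.assoc)
  show ?thesis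
  proof (cases "m = 1")
    case True
    then show ?thesis using assms[of x] by (simp add: ddiff_def)
  next
    case False
    then have "ddiff m u h x = (u (x + h + h) - u (x + h)) - (u (x + h) - u x)" by (simp add: ddiff_def eq)
    then show ?thesis using assms[of x] assms[of "x + h"] by linarith
  qed
qed

lemma ddiff_add: "ddiff m (\<lambda>x. u x + v x) h x = ddiff m u h x + ddiff m v h x"
  by (simp add: ddiff_def algebra_simps)

lemma partial_deriv_append: "partial_deriv js (partial_deriv is f) = partial_deriv (js @ is) f"
  by (induction js) auto

lemma Cn_space_partial_deriv: "f \<in> Cn_space (n + length is) \<Longrightarrow> partial_deriv is f \<in> Cn_space n"
  by (auto simp: Cn_space_def partial_deriv_append)

lemma partial_deriv_add:
  fixes f g :: "real ^ 'n \<Rightarrow> real"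
  assumes f: "f \<in> Cn_space n" and g: "g \<in> Cn_space n"
  shows "length is \<le> n \<Longrightarrow> partial_deriv is (\<lambda>x. f x + g x) = (\<lambda>x. partial_deriv is f x + partial_deriv is g x)"
    and "(\<lambda>x. f x + g x) \<in> Cn_space n"
proof -
  have d: "partial_deriv is f differentiable at x" "partial_deriv is g differentiable at x" if "length is < n" for "is" x
    using f g that by (auto simp: Cn_space_def differentiable_on_eq_differentiable_at)
  have eq: "partial_deriv is (\<lambda>x. f x + g x) = (\<lambda>x. partial_deriv is f x + partial_deriv is g x)" if "length is \<le> n" for "is"
    using that
  proof (induction "is")
    case (Cons i "is")
    then have IH: "partial_deriv is (\<lambda>x. f x + g x) = (\<lambda>x. partial_deriv is f x + partial_deriv is g x)"
      and len: "length is < n" by auto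
    show ?case
    proof
      fix x
      have "((\<lambda>x. partial_deriv is f x + partial_deriv is g x) has_derivative
         (\<lambda>h. frechet_derivative (partial_deriv is f) (at x) h + frechet_derivative (partial_deriv is g) (at x) h)) (at x)"
        using d[OF len] by (intro has_derivative_add) (auto simp: frechet_derivative_works[symmetric])
      from frechet_derivative_at[OF this, symmetric]
      show "partial_deriv (i # is) (\<lambda>x. f x + g x) x = partial_deriv (i # is) f x + partial_deriv (i # is) g x"
        by (simp add: IH)
    qed
  qed simp
  then show "length is \<le> n \<Longrightarrow> partial_deriv is (\<lambda>x. f x + g x) = (\<lambda>x. partial_deriv is f x + partial_deriv is g x)" .
  show "(\<lambda>x. f x + g x) \<in> Cn_space n"
    unfolding Cn_space_def
  proof (intro CollectI conjI allI impI)
    fix "is" :: "'n list"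
    show "partial_deriv is (\<lambda>x. f x + g x) differentiable_on UNIV" if "length is < n"
      using d[OF that] eq[of "is"] that by (auto simp: differentiable_on_eq_differentiable_at intro!: differentiable_add)
    assume len: "length is \<le> n"
    then show "continuous_on UNIV (partial_deriv is (\<lambda>x. f x + g x))"
      unfolding eq[OF len] using f g by (intro continuous_on_add) (auto simp: Cn_space_def)
    show "bounded (range (partial_deriv is (\<lambda>x. f x + g x)))"
      unfolding eq[OF len] using f g len by (intro bounded_plus_comp) (auto simp: Cn_space_def)
  qed
qed

lemma Cn_space_const: "(\<lambda>x :: real ^ 'n. c) \<in> Cn_space n"
proof -
  have "partial_deriv is (\<lambda>x :: real ^ 'n. c) differentiable_on UNIV \<and> continuous_on UNIV (partial_deriv is (\<lambda>x :: real ^ 'n. c))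
     \<and> bounded (range (partial_deriv is (\<lambda>x :: real ^ 'n. c)))" for "is"
  proof -
    obtain k where k: "partial_deriv is (\<lambda>x :: real ^ 'n. c) = (\<lambda>x. k)"
      by (cases "is = []") (auto simp: partial_deriv_const)
    show ?thesis unfolding k by auto
  qed
  then show ?thesis unfolding Cn_space_def by blast
qed

text \<open>For m = 2 the second difference is a first difference of v = u - u(. + h). Its
  derivatives are increments of those of u, so the mean value bound is applied twice and each
  application costs \<open>CARD('n) * norm h\<close>.\<close>

lemma ddiff_le_partial_deriv:
  fixes u :: "real ^ 'n \<Rightarrow> real"
  assumes u: "u \<in> Cn_space m" and m: "m \<in> {1, 2}"
    and K: "\<And>is y. length is = m \<Longrightarrow> \<bar>partial_deriv is u y\<bar> \<le> K"
  shows "\<bar>ddiff m u h x\<bar> \<le> (real CARD('n) * norm h) ^ m * K"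
proof (cases "m = 1")
  case True
  have "u differentiable_on UNIV" using u True by (auto simp: Cn_space_def dest!: spec[of _ "[]"])
  moreover have "\<bar>partial_deriv [i] u y\<bar> \<le> K" for i y using K[of "[i]" y] True by simp
  ultimately have "\<bar>u (x + h) - u x\<bar> \<le> real CARD('n) * K * norm (x + h - x)" by (rule abs_diff_le_partial_deriv)
  then show ?thesis using True by (simp add: ddiff_def mult_ac)
next
  case False
  then have m2: "m = 2" using m by auto
  define v where "v y = u y + (-1) * u (1 *\<^sub>R y + h)" for y
  have u1: "u \<in> Cn_space 1" using Cn_space_mono[of 1 2 u] u m2 by simp
  note A = partial_deriv_affine(1)[OF u1, where a="-1" and c=1 and b=h] partial_deriv_affine(2)[OF u1, where a="-1" and c=1 and b=h]
  have v: "v \<in> Cn_space 1" unfolding v_def by (rule partial_deriv_add(2)[OF u1 A(2)])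
  have "\<bar>partial_deriv [i] v y\<bar> \<le> real CARD('n) * K * norm h" for i y
  proof -
    have "partial_deriv [i] v y = partial_deriv [i] u y - partial_deriv [i] u (y + h)"
      unfolding v_def using fun_cong[OF partial_deriv_add(1)[OF u1 A(2), of "[i]"], of y] fun_cong[OF A(1)[of "[i]"], of y] by simp
    moreover have "\<bar>partial_deriv [i] u y - partial_deriv [i] u (y + h)\<bar> \<le> real CARD('n) * K * norm (y - (y + h))"
    proof (rule abs_diff_le_partial_deriv)
      show "partial_deriv [i] u differentiable_on UNIV" using u m2 by (auto simp: Cn_space_def simp del: partial_deriv.simps)
      show "\<bar>partial_deriv [j] (partial_deriv [i] u) z\<bar> \<le> K" for j z
        using K[of "[j, i]"] m2 by (simp add: partial_deriv_append)
    qed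
    ultimately show ?thesis by simp
  qed
  moreover have "v differentiable_on UNIV" using v by (auto simp: Cn_space_def dest!: spec[of _ "[]"])
  ultimately have "\<bar>v x - v (x + h)\<bar> \<le> real CARD('n) * (real CARD('n) * K * norm h) * norm (x - (x + h))"
    by (intro abs_diff_le_partial_deriv)
  moreover have "ddiff m u h x = v x - v (x + h)"
    using False by (simp add: ddiff_def v_def scaleR_2 algebra_simps)
  ultimately show ?thesis using m2 by (simp add: power2_eq_square mult_ac)
qed

section \<open>Duhamel's integral for a fixed source\<close>

context
  fixes s \<alpha> T B c :: real and g :: "real \<Rightarrow> real ^ 'n \<Rightarrow> real"
  assumes s: "0 < s" "s < 1" and \<alpha>: "0 \<le> \<alpha>" "\<alpha> < 1" and T: "T > 0" and c: "c \<ge> 0"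
    and g_cont: "continuous_on ({0..T} \<times> UNIV) (\<lambda>(r, x). g r x)"
    and g_bound: "\<And>r x. r \<in> {0..T} \<Longrightarrow> \<bar>g r x\<bar> \<le> B"
    and g_holder: "\<And>r x h. r \<in> {0..T} \<Longrightarrow> \<bar>g r (x + h) - g r x\<bar> \<le> 2 * B * norm h powr \<alpha>"
    and smoothing: "\<And>is r \<tau> x. is \<noteq> [] \<Longrightarrow> length is \<le> 3 \<Longrightarrow> r \<in> {0..T} \<Longrightarrow> 0 < \<tau> \<Longrightarrow>
      \<bar>partial_deriv is (frac_semigroup s \<tau> (g r)) x\<bar> \<le> c * B * \<tau> powr (- ((real (length is) - \<alpha>) / (2 * s)))"
begin

lemma source_bound_nonneg: "B \<ge> 0"
  using order_trans[OF abs_ge_zero g_bound[of 0]] T by auto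

lemma source_slice_continuous: "r \<in> {0..T} \<Longrightarrow> continuous_on UNIV (g r)"
  by (rule continuous_on_slice[OF s g_cont g_bound])

text \<open>Duhamel's integral after the substitution \<open>\<tau> = t - r\<close>; the integrand is extended by zero to a
  domain of integration that does not depend on \<open>t\<close>.\<close>
definition duhamel_integrand :: "real \<Rightarrow> real \<Rightarrow> real ^ 'n \<Rightarrow> real" where
  "duhamel_integrand t \<tau> = (if \<tau> < t then frac_semigroup s \<tau> (g (t - \<tau>)) else (\<lambda>_. 0))"

definition duhamel :: "real \<Rightarrow> real ^ 'n \<Rightarrow> real" where
  "duhamel t x = (LINT \<tau>|time_measure T. duhamel_integrand t \<tau> x)"

lemma duhamel_integrand_Cn_space: "t \<in> {0..T} \<Longrightarrow> 0 < \<tau> \<Longrightarrow> n \<le> 4 \<Longrightarrow> duhamel_integrand t \<tau> \<in> Cn_space n"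
  using partial_deriv_frac_semigroup(3)[OF s source_slice_continuous g_bound, of "t - \<tau>" \<tau> n]
  by (auto simp: duhamel_integrand_def Cn_space_const)

lemma duhamel_integrand_bound: "t \<in> {0..T} \<Longrightarrow> 0 < \<tau> \<Longrightarrow> \<bar>duhamel_integrand t \<tau> x\<bar> \<le> B"
  using frac_semigroup_bound[OF s source_slice_continuous g_bound, of "t - \<tau>" \<tau>] source_bound_nonneg
  by (auto simp: duhamel_integrand_def)

lemma duhamel_integrand_smoothing:
  assumes "t \<in> {0..T}" "0 < \<tau>" "is \<noteq> []" "length is \<le> 3"
  shows "\<bar>partial_deriv is (duhamel_integrand t \<tau>) x\<bar> \<le> c * B * \<tau> powr (- ((real (length is) - \<alpha>) / (2 * s)))"
  using smoothing[of "is" "t - \<tau>" \<tau>] assms source_bound_nonneg c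
  by (auto simp: duhamel_integrand_def partial_deriv_const)

lemma frac_semigroup_time_continuous: "t \<in> {0..T} \<Longrightarrow> continuous_on {0..t} (\<lambda>\<tau>. frac_semigroup s \<tau> (g (t - \<tau>)) x)"
  by (rule continuous_on_compose2[OF continuous_on_frac_semigroup[OF s g_cont g_bound],
        where f="\<lambda>\<tau>. (\<tau>, t - \<tau>, x)", simplified])
    (auto intro!: continuous_intros)

lemma duhamel_integrand_measurable:
  assumes t: "t \<in> {0..T}"
  shows "(\<lambda>\<tau>. duhamel_integrand t \<tau> x) \<in> borel_measurable (time_measure T)"
proof -
  have "(\<lambda>\<tau>. indicator {0<..<t} \<tau> *\<^sub>R frac_semigroup s \<tau> (g (t - \<tau>)) x) \<in> borel_measurable borel"
    by (rule borel_measurable_continuous_on_indicator)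
      (auto intro: continuous_on_subset[OF frac_semigroup_time_continuous[OF t]])
  moreover have "(\<lambda>\<tau>. indicator {0<..<t} \<tau> *\<^sub>R frac_semigroup s \<tau> (g (t - \<tau>)) x) = (\<lambda>\<tau>. indicator {0<..<T} \<tau> *\<^sub>R duhamel_integrand t \<tau> x)"
    using t by (auto simp: fun_eq_iff indicator_def duhamel_integrand_def)
  ultimately show ?thesis
    unfolding time_measure_def by (subst borel_measurable_restrict_space_iff) auto
qed

lemma duhamel_eq:
  assumes t: "t \<in> {0..T}"
  shows "(LINT r:{0..t}|lborel. frac_semigroup s (t - r) (g r) x) = duhamel t x"
proof -
  let ?P = "\<lambda>\<tau>. frac_semigroup s \<tau> (g (t - \<tau>)) x"
  have "(LINT r:{0..t}|lborel. frac_semigroup s (t - r) (g r) x) =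
    (LINT \<tau>|lborel. indicator {0..t} (t + (- 1) * \<tau>) *\<^sub>R frac_semigroup s (t - (t + (- 1) * \<tau>)) (g (t + (- 1) * \<tau>)) x)"
    unfolding set_lebesgue_integral_def by (subst lborel_integral_real_affine[where c="-1" and t=t]) auto
  also have "\<dots> = (LINT \<tau>|lborel. indicator {0..t} \<tau> *\<^sub>R ?P \<tau>)"
    by (intro Bochner_Integration.integral_cong) (auto simp: indicator_def)
  \<comment> \<open>The endpoints are null; dropping them leaves only times with \<tau> > 0, where
    the smoothing bounds hold.\<close>
  also have "\<dots> = (LINT \<tau>|lborel. indicator {0<..<t} \<tau> *\<^sub>R ?P \<tau>)"
  proof (rule integral_cong_AE)
    show "AE \<tau> in lborel. indicator {0..t} \<tau> *\<^sub>R ?P \<tau> = indicator {0<..<t} \<tau> *\<^sub>R ?P \<tau>"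
      using AE_lborel_singleton[of 0] AE_lborel_singleton[of t] by eventually_elim (auto simp: indicator_def)
    show "(\<lambda>\<tau>. indicator {0..t} \<tau> *\<^sub>R ?P \<tau>) \<in> borel_measurable lborel"
      using borel_measurable_continuous_on_indicator[OF _ frac_semigroup_time_continuous[OF t]] by simp
    show "(\<lambda>\<tau>. indicator {0<..<t} \<tau> *\<^sub>R ?P \<tau>) \<in> borel_measurable lborel"
    proof -
      have "continuous_on {0<..<t} ?P" by (rule continuous_on_subset[OF frac_semigroup_time_continuous[OF t]]) auto
      from borel_measurable_continuous_on_indicator[OF _ this] show ?thesis by simp
    qed
  qed
  also have "\<dots> = (LINT \<tau>|lborel. indicator {0<..<T} \<tau> *\<^sub>R duhamel_integrand t \<tau> x)"
    using t by (intro Bochner_Integration.integral_cong) (auto simp: indicator_def duhamel_integrand_def)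
  also have "\<dots> = duhamel t x"
    unfolding duhamel_def time_measure_def by (subst integral_restrict_space) auto
  finally show ?thesis .
qed

section \<open>Orders of differentiation below \<alpha> + 2s\<close>

context
  fixes n :: nat
  assumes n: "n \<le> 2" "real n < \<alpha> + 2 * s"
begin

text \<open>One majorant for all orders up to n. The 1 belongs to order 0, where the maximum bound
  applies; the other exponents are below 1 because j \<le> n < \<alpha> + 2s.\<close>

definition time_weight :: "real \<Rightarrow> real" where
  "time_weight \<tau> = 1 + (\<Sum>j\<in>{1..n}. c * \<tau> powr (- ((real j - \<alpha>) / (2 * s))))"

lemma integrable_time_weight: "integrable (time_measure T) time_weight"
proof -
  have "(real j - \<alpha>) / (2 * s) < 1" if "j \<in> {1..n}" for j
  proof -
    have "real j \<le> real n" using that by simp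
    then show ?thesis using n s by (simp add: divide_less_eq)
  qed
  then show ?thesis
    unfolding time_weight_def[abs_def] using T
    by (intro Bochner_Integration.integrable_add Bochner_Integration.integrable_sum integrable_mult_right
        integrable_time_measure_powr integrable_time_measure_const) auto
qed

lemma duhamel_integrand_weight:
  assumes t: "t \<in> {0..T}" and \<tau>: "0 < \<tau>" and len: "length is \<le> n"
  shows "\<bar>partial_deriv is (duhamel_integrand t \<tau>) x\<bar> \<le> B * time_weight \<tau>"
proof (cases "is = []")
  case True
  have "B * 1 \<le> B * time_weight \<tau>"
    unfolding time_weight_def using c source_bound_nonneg by (intro mult_left_mono) (auto intro!: sum_nonneg)
  then show ?thesis using duhamel_integrand_bound[OF t \<tau>, of x] True by simp
next
  case False
  then have "length is \<in> {1..n}" using len by (cases "is") auto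
  then have "c * \<tau> powr (- ((real (length is) - \<alpha>) / (2 * s))) \<le> (\<Sum>j\<in>{1..n}. c * \<tau> powr (- ((real j - \<alpha>) / (2 * s))))"
    using c by (intro member_le_sum[where f="\<lambda>j. c * \<tau> powr (- ((real j - \<alpha>) / (2 * s)))"]) auto
  then have "c * \<tau> powr (- ((real (length is) - \<alpha>) / (2 * s))) \<le> time_weight \<tau>"
    unfolding time_weight_def by linarith
  from mult_left_mono[OF this source_bound_nonneg]
  show ?thesis using duhamel_integrand_smoothing[OF t \<tau> False, of x] len n by (simp add: mult_ac)
qed

lemma partial_deriv_duhamel:
  assumes t: "t \<in> {0..T}"
  shows "length is \<le> n \<Longrightarrow> partial_deriv is (duhamel t) = (\<lambda>x. LINT \<tau>|time_measure T. partial_deriv is (duhamel_integrand t \<tau>) x)"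
    and "length is \<le> n \<Longrightarrow> integrable (time_measure T) (\<lambda>\<tau>. partial_deriv is (duhamel_integrand t \<tau>) x)"
    and "length is \<le> n \<Longrightarrow> \<bar>partial_deriv is (duhamel t) x\<bar> \<le> B * integral\<^sup>L (time_measure T) time_weight"
    and "duhamel t \<in> Cn_space n"
proof -
  have dom: "\<exists>w. integrable (time_measure T) w \<and> (\<forall>\<tau>\<in>space (time_measure T). \<forall>x\<in>ball x0 1. \<forall>is. length is \<le> n \<longrightarrow>
                \<bar>partial_deriv is (duhamel_integrand t \<tau>) x\<bar> \<le> w \<tau>)" for x0
    by (rule exI[of _ "\<lambda>\<tau>. B * time_weight \<tau>"]) (use duhamel_integrand_weight[OF t] integrable_time_weight in auto)
  have smooth: "duhamel_integrand t \<tau> \<in> Cn_space n" if "\<tau> \<in> space (time_measure T)" for \<tau>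
    using duhamel_integrand_Cn_space[OF t, of \<tau> n] that n by simp
  have eq: "duhamel t = (\<lambda>x. LINT \<tau>|time_measure T. duhamel_integrand t \<tau> x)" by (simp add: duhamel_def fun_eq_iff)
  have L: "length is \<le> n \<Longrightarrow> partial_deriv is (duhamel t) = (\<lambda>x. LINT \<tau>|time_measure T. partial_deriv is (duhamel_integrand t \<tau>) x)"
    "length is \<le> n \<Longrightarrow> integrable (time_measure T) (\<lambda>\<tau>. partial_deriv is (duhamel_integrand t \<tau>) x)" for "is" x
    unfolding eq by (rule partial_deriv_LINT[OF duhamel_integrand_measurable[OF t] smooth dom]; assumption)+
  have b: "\<bar>partial_deriv is (duhamel t) x\<bar> \<le> B * integral\<^sup>L (time_measure T) time_weight" if len: "length is \<le> n" for "is" x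
  proof -
    have "\<bar>partial_deriv is (duhamel t) x\<bar> \<le> (LINT \<tau>|time_measure T. B * time_weight \<tau>)"
      unfolding L(1)[OF len]
      by (rule order_trans[OF integral_abs_bound], rule integral_mono)
        (use L(2)[OF len] integrable_time_weight duhamel_integrand_weight[OF t _ len] in auto)
    then show ?thesis by simp
  qed
  show "length is \<le> n \<Longrightarrow> partial_deriv is (duhamel t) = (\<lambda>x. LINT \<tau>|time_measure T. partial_deriv is (duhamel_integrand t \<tau>) x)"
    "length is \<le> n \<Longrightarrow> integrable (time_measure T) (\<lambda>\<tau>. partial_deriv is (duhamel_integrand t \<tau>) x)"
    "length is \<le> n \<Longrightarrow> \<bar>partial_deriv is (duhamel t) x\<bar> \<le> B * integral\<^sup>L (time_measure T) time_weight"
    by (fact L b)+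
  show "duhamel t \<in> Cn_space n"
    unfolding eq by (rule partial_deriv_LINT(5)[OF duhamel_integrand_measurable[OF t] smooth dom b[unfolded eq]])
qed

text \<open>Truncation makes the integrand jump where \<tau> = t, but for a given t this is a single
  \<tau>, hence a null set; at all other \<tau> the integrand is continuous and dominated
  convergence applies.\<close>

lemma continuous_on_partial_deriv_duhamel:
  assumes len: "length is \<le> n"
  shows "continuous_on ({0..T} \<times> UNIV) (\<lambda>(t, x). partial_deriv is (duhamel t) x)"
proof -
  let ?S = "{0..T} \<times> (UNIV :: (real ^ 'n) set)"
  have "continuous_on ?S (\<lambda>q. LINT \<tau>|time_measure T. partial_deriv is (duhamel_integrand (fst q) \<tau>) (snd q))"
  proof (rule continuous_on_LINT[where w="\<lambda>\<tau>. B * time_weight \<tau>"])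
    show "integrable (time_measure T) (\<lambda>\<tau>. B * time_weight \<tau>)" using integrable_time_weight by simp
    fix q assume q: "q \<in> ?S"
    then have t: "fst q \<in> {0..T}" by auto
    show "(\<lambda>\<tau>. partial_deriv is (duhamel_integrand (fst q) \<tau>) (snd q)) \<in> borel_measurable (time_measure T)"
      using partial_deriv_duhamel(2)[OF t len] by (rule borel_measurable_integrable)
    show "AE \<tau> in time_measure T. \<bar>partial_deriv is (duhamel_integrand (fst q) \<tau>) (snd q)\<bar> \<le> B * time_weight \<tau>"
      using duhamel_integrand_weight[OF t _ len] by (intro AE_I2) auto
    have "AE \<tau> in time_measure T. \<tau> \<noteq> fst q"
      unfolding time_measure_def by (subst AE_restrict_space_iff) (use AE_lborel_singleton[of "fst q"] in auto)
    then show "AE \<tau> in time_measure T. continuous (at q within ?S) (\<lambda>q. partial_deriv is (duhamel_integrand (fst q) \<tau>) (snd q))"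
    proof (rule AE_mp, intro AE_I2 impI)
      fix \<tau> assume "\<tau> \<in> space (time_measure T)" and ne: "\<tau> \<noteq> fst q"
      then have \<tau>: "0 < \<tau>" by simp
      \<comment> \<open>Continuity within \<open>?S\<close> is a local matter, and on either side of
        t = \<tau> the integrand is given by a single formula.\<close>
      have localize: "continuous (at q within ?S) F" if "open W" "q \<in> W" "continuous_on (?S \<inter> W) F" 
        for W and F :: "real \<times> (real ^ 'n) \<Rightarrow> real"
      proof -
        have "continuous (at q within ?S \<inter> W) F"
          using that q by (auto simp: continuous_on_eq_continuous_within)
        moreover have "at q within ?S \<inter> W = at q within ?S"
          by (rule at_within_nhd[OF that(2,1)]) auto
        ultimately show ?thesis by simp
      qed
      show "continuous (at q within ?S) (\<lambda>q. partial_deriv is (duhamel_integrand (fst q) \<tau>) (snd q))"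
      proof (cases "\<tau> < fst q")
        case True
        show ?thesis
        proof (rule localize)
          show "open ({\<tau><..} \<times> (UNIV :: (real ^ 'n) set))" by (intro open_Times) auto
          show "q \<in> {\<tau><..} \<times> UNIV" using True by (cases q) auto
          have "continuous_on (?S \<inter> {\<tau><..} \<times> UNIV) (\<lambda>q. partial_deriv is (frac_semigroup s \<tau> (g (fst q - \<tau>))) (snd q))"
            by (rule continuous_on_compose2[OF continuous_on_partial_deriv_frac_semigroup[OF s g_cont g_bound \<tau>, of "is"],
                  where f="\<lambda>q. (fst q - \<tau>, snd q)", simplified])
              (use len n \<tau> in \<open>auto intro!: continuous_intros\<close>)
          then show "continuous_on (?S \<inter> {\<tau><..} \<times> UNIV) (\<lambda>q. partial_deriv is (duhamel_integrand (fst q) \<tau>) (snd q))"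
            by (rule continuous_on_eq) (auto simp: duhamel_integrand_def)
        qed
      next
        case False
        show ?thesis
        proof (rule localize)
          show "open ({..<\<tau>} \<times> (UNIV :: (real ^ 'n) set))" by (intro open_Times) auto
          show "q \<in> {..<\<tau>} \<times> UNIV" using False ne by (cases q) auto
          have "continuous_on UNIV (partial_deriv is (\<lambda>_ :: real ^ 'n. 0))"
            using Cn_space_const[of 0 "length is"] by (auto simp: Cn_space_def)
          then have "continuous_on (?S \<inter> {..<\<tau>} \<times> UNIV) (\<lambda>q. partial_deriv is (\<lambda>_. 0) (snd q))"
            by (rule continuous_on_compose2) (auto intro!: continuous_intros)
          then show "continuous_on (?S \<inter> {..<\<tau>} \<times> UNIV) (\<lambda>q. partial_deriv is (duhamel_integrand (fst q) \<tau>) (snd q))"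
            by (rule continuous_on_eq) (auto simp: duhamel_integrand_def)
        qed
      qed
    qed
  qed
  then show ?thesis
    by (rule continuous_on_eq) (auto simp: partial_deriv_duhamel(1)[OF _ len])
qed

text \<open>For small \<tau> and n = 0 there is no singularity: the semigroup preserves the Hoelder
  modulus, so b = 0 and the power |h|^\<alpha> is gained. For n > 0 the smoothing bound gives
  \<tau>^(-b) and no power of |h|. For large \<tau> the difference is traded for m further
  derivatives and |h|^m. All these lead to the same final exponent.\<close>

lemma ddiff_duhamel:
  assumes t: "t \<in> {0..T}" and len: "length is = n" and m: "m \<in> {1, 2}" "n + m \<le> 3" "\<alpha> + 2 * s < real (n + m)"
    and b_def: "b = (if n = 0 then 0 else (real n - \<alpha>) / (2 * s))" and d_def: "d = (real (n + m) - \<alpha>) / (2 * s)"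
  shows "\<bar>ddiff m (partial_deriv is (duhamel t)) h x\<bar> \<le>
    B * ((4 + 4 * c + real CARD('n) ^ m * c) * (1 / (1 - b) + 1 / (d - 1))) * norm h powr (\<alpha> + 2 * s - real n)"
proof (cases "h = 0")
  case True
  then show ?thesis by (auto simp: ddiff_def)
next
  case False
  then have h: "norm h > 0" by simp
  \<comment> \<open>The term 4 is twice the Hoelder constant 2 B, the term 4 c combines two values
    of a derivative with the factor 2 of a second difference, and the power of
    \<open>CARD('n)\<close> comes from the mean value bound.\<close>
  define A where "A = B * (4 + 4 * c + real CARD('n) ^ m * c)"
  have A: "A \<ge> 0" "4 * B \<le> A" "4 * (c * B) \<le> A" "real CARD('n) ^ m * (c * B) \<le> A"
    unfolding A_def using source_bound_nonneg c by (auto simp: algebra_simps)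
  have b: "b < 1" using n s by (simp add: b_def divide_less_eq)
  have d: "d > 1" using m s by (simp add: d_def less_divide_eq)
  note L = partial_deriv_duhamel[OF t]
  have "ddiff m (partial_deriv is (duhamel t)) h x = (LINT \<tau>|time_measure T. ddiff m (partial_deriv is (duhamel_integrand t \<tau>)) h x)"
    unfolding ddiff_def L(1)[OF eq_refl[OF len]] using L(2)[OF eq_refl[OF len]] by simp
  also have "\<bar>\<dots>\<bar> \<le> A * (1 / (1 - b) + 1 / (d - 1)) * norm h powr (\<alpha> + 2 * s - real n)"
  proof (rule time_integral_interpolation[where a="if n = 0 then \<alpha> else 0" and c="real m" and s=s])
    show "\<alpha> + 2 * s - real n = (if n = 0 then \<alpha> else 0) + 2 * s * (1 - b)"
      using s by (simp add: b_def field_simps)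
    show "\<alpha> + 2 * s - real n = real m - 2 * s * (d - 1)"
      using s by (simp add: d_def field_simps)
    fix \<tau> :: real assume \<tau>: "0 < \<tau>" "\<tau> < T"
    show "\<bar>ddiff m (partial_deriv is (duhamel_integrand t \<tau>)) h x\<bar> \<le> A * norm h powr (if n = 0 then \<alpha> else 0) * \<tau> powr (- b)"
    proof (cases "n = 0")
      case True
      have "\<bar>duhamel_integrand t \<tau> (y + h) - duhamel_integrand t \<tau> y\<bar> \<le> 2 * B * norm h powr \<alpha>" for y
      proof (cases "\<tau> < t")
        case True
        then have r: "t - \<tau> \<in> {0..T}" using t \<tau> by auto
        have "\<bar>0 * frac_semigroup s \<tau> (g (t - \<tau>)) (y + 2 *\<^sub>R h) + 1 * frac_semigroup s \<tau> (g (t - \<tau>)) (y + h) + (- 1) * frac_semigroup s \<tau> (g (t - \<tau>)) y\<bar> \<le> 2 * B * norm h powr \<alpha>"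
          by (rule frac_semigroup_diff_bound[OF s source_slice_continuous[OF r] g_bound[OF r]]) (use g_holder[OF r] \<tau> in auto)
        then show ?thesis using True by (simp add: duhamel_integrand_def)
      qed (use source_bound_nonneg in \<open>simp add: duhamel_integrand_def\<close>)
      then have "\<bar>ddiff m (duhamel_integrand t \<tau>) h x\<bar> \<le> 2 * (2 * B * norm h powr \<alpha>)" by (rule ddiff_le_diff)
      also have "\<dots> \<le> A * norm h powr \<alpha>" using mult_right_mono[OF A(2), of "norm h powr \<alpha>"] by simp
      finally show ?thesis using True len \<tau> by (simp add: b_def)
    next
      case False
      then have ne: "is \<noteq> []" using len by auto
      have "\<bar>partial_deriv is (duhamel_integrand t \<tau>) (y + h) - partial_deriv is (duhamel_integrand t \<tau>) y\<bar> \<le> 2 * (c * B * \<tau> powr (- b))" for y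
        using duhamel_integrand_smoothing[OF t \<tau>(1) ne, of "y + h"] duhamel_integrand_smoothing[OF t \<tau>(1) ne, of y] len n False by (simp add: b_def)
      then have "\<bar>ddiff m (partial_deriv is (duhamel_integrand t \<tau>)) h x\<bar> \<le> 2 * (2 * (c * B * \<tau> powr (- b)))" by (rule ddiff_le_diff)
      also have "\<dots> \<le> A * \<tau> powr (- b)" using mult_right_mono[OF A(3), of "\<tau> powr (- b)"] by simp
      finally show ?thesis using False h by simp
    qed
    have "\<bar>ddiff m (partial_deriv is (duhamel_integrand t \<tau>)) h x\<bar> \<le> (real CARD('n) * norm h) ^ m * (c * B * \<tau> powr (- d))"
    proof (rule ddiff_le_partial_deriv[OF _ m(1)])
      show "partial_deriv is (duhamel_integrand t \<tau>) \<in> Cn_space m"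
        using duhamel_integrand_Cn_space[OF t \<tau>(1), of "m + n"] m len by (intro Cn_space_partial_deriv) (auto simp: add.commute)
      fix js :: "'n list" and y assume js: "length js = m"
      have "js @ is \<noteq> []" "length (js @ is) \<le> 3" using js m len by auto
      from duhamel_integrand_smoothing[OF t \<tau>(1) this, of y]
      show "\<bar>partial_deriv js (partial_deriv is (duhamel_integrand t \<tau>)) y\<bar> \<le> c * B * \<tau> powr (- d)"
        using js len by (simp add: partial_deriv_append d_def add.commute)
    qed
    also have "\<dots> = (real CARD('n) ^ m * (c * B)) * norm h powr real m * \<tau> powr (- d)"
      using h by (simp add: power_mult_distrib powr_realpow mult_ac)
    also have "\<dots> \<le> A * norm h powr real m * \<tau> powr (- d)"
      using A(4) by (intro mult_right_mono) auto
    finally show "\<bar>ddiff m (partial_deriv is (duhamel_integrand t \<tau>)) h x\<bar> \<le> A * norm h powr real m * \<tau> powr (- d)" .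
  qed (use b d h A in auto)
  finally show ?thesis by (simp add: A_def mult.assoc)
qed

end

end

section \<open>Regularity of the mild solution\<close>

text \<open>Fixes the smoothing constant before the data are given, which makes the final constant
  independent of f and g. There are finitely many lists of length at most 3, so the constants can be
  summed.\<close>

lemma ex_smoothing_constant:
  fixes s \<alpha> :: real
  assumes s: "0 < s" "s < 1" and \<alpha>: "0 \<le> \<alpha>" "\<alpha> < 1"
  shows "\<exists>c\<ge>0. \<forall>(u :: real ^ 'n \<Rightarrow> real) B is \<tau> x. continuous_on UNIV u \<longrightarrow> (\<forall>x. \<bar>u x\<bar> \<le> B) \<longrightarrow>
    (\<forall>x h. \<bar>u (x + h) - u x\<bar> \<le> 2 * B * norm h powr \<alpha>) \<longrightarrow> is \<noteq> [] \<longrightarrow> length is \<le> 3 \<longrightarrow> 0 < \<tau> \<longrightarrow>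
    \<bar>partial_deriv is (frac_semigroup s \<tau> u) x\<bar> \<le> c * B * \<tau> powr (- ((real (length is) - \<alpha>) / (2 * s)))"
proof -
  define k where "k is = 2 * frac_const s is ((real (length is) - \<alpha>) / 2)" for "is" :: "'n list"
  have k: "k is \<ge> 0" for "is" using frac_const_nonneg[OF s] by (simp add: k_def)
  define c where "c = (\<Sum>is\<in>{is :: 'n list. length is \<le> 3}. k is)"
  have "\<bar>partial_deriv is (frac_semigroup s \<tau> u) x\<bar> \<le> c * B * \<tau> powr (- ((real (length is) - \<alpha>) / (2 * s)))"
    if u: "continuous_on UNIV u" "\<forall>x. \<bar>u x\<bar> \<le> B" "\<forall>x h. \<bar>u (x + h) - u x\<bar> \<le> 2 * B * norm h powr \<alpha>"
      and l: "is \<noteq> []" "length is \<le> 3" and \<tau>: "0 < \<tau>"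
    for u :: "real ^ 'n \<Rightarrow> real" and B \<tau> x and "is"
  proof -
    have B: "B \<ge> 0" using order_trans[OF abs_ge_zero u(2)[rule_format]] .
    have "\<bar>partial_deriv is (frac_semigroup s \<tau> u) x\<bar> \<le> 2 * B * frac_const s is ((real (length is) - \<alpha>) / 2) * \<tau> powr (- ((real (length is) - \<alpha>) / (2 * s)))"
      by (rule partial_deriv_frac_semigroup_holder_bound[OF s u(1) u(2)[rule_format] \<tau> u(3)[rule_format]])
        (use \<alpha> l in auto)
    also have "\<dots> = k is * (B * \<tau> powr (- ((real (length is) - \<alpha>) / (2 * s))))" by (simp add: k_def mult_ac)
    also have "\<dots> \<le> c * (B * \<tau> powr (- ((real (length is) - \<alpha>) / (2 * s))))"
      unfolding c_def using l B k by (intro mult_right_mono member_le_sum finite_bounded_lists) auto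
    finally show ?thesis by (simp add: mult.assoc)
  qed
  moreover have "c \<ge> 0" unfolding c_def by (intro sum_nonneg k)
  ultimately show ?thesis by blast
qed

text \<open>The initial datum enters with factor exactly 1, since the semigroup commutes with
  derivatives and preserves difference bounds; only Duhamel's term costs a constant. Keeping m as a
  parameter lets one argument serve the Hoelder and the Zygmund case.\<close>

lemma mild_solution_regularity:
  fixes s \<alpha> T :: real
  assumes s: "0 < s" "s < 1" and \<alpha>: "0 \<le> \<alpha>" "\<alpha> < 1" and T: "T > 0"
    and m: "m \<in> {1, 2}" "n + m \<le> 3" and nm: "real n < \<alpha> + 2 * s" "\<alpha> + 2 * s < real (n + m)"
  shows "\<exists>C>0. \<forall>(f :: real ^ 'n \<Rightarrow> real) g F B.
    ddiff_bounded n m (\<alpha> + 2 * s - real n) F f \<longrightarrow>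
    continuous_on ({0..T} \<times> UNIV) (\<lambda>(r, x). g r x) \<longrightarrow> (\<forall>r\<in>{0..T}. \<forall>x. \<bar>g r x\<bar> \<le> B) \<longrightarrow>
    (\<forall>r\<in>{0..T}. \<forall>x h. \<bar>g r (x + h) - g r x\<bar> \<le> 2 * B * norm h powr \<alpha>) \<longrightarrow>
    (\<forall>is. length is \<le> n \<longrightarrow> continuous_on ({0..T} \<times> UNIV) (\<lambda>(t, x). partial_deriv is (mild_solution s f g t) x)) \<and>
    (\<forall>t\<in>{0..T}. ddiff_bounded n m (\<alpha> + 2 * s - real n) (F + C * B) (mild_solution s f g t))"
proof -
  obtain c where c: "c \<ge> 0" and smoothing: "\<And>(u :: real ^ 'n \<Rightarrow> real) B is \<tau> x. continuous_on UNIV u \<Longrightarrow> (\<And>x. \<bar>u x\<bar> \<le> B) \<Longrightarrow>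
    (\<And>x h. \<bar>u (x + h) - u x\<bar> \<le> 2 * B * norm h powr \<alpha>) \<Longrightarrow> is \<noteq> [] \<Longrightarrow> length is \<le> 3 \<Longrightarrow> 0 < \<tau> \<Longrightarrow>
    \<bar>partial_deriv is (frac_semigroup s \<tau> u) x\<bar> \<le> c * B * \<tau> powr (- ((real (length is) - \<alpha>) / (2 * s)))"
    using ex_smoothing_constant[OF s \<alpha>, where 'n='n] by blast
  define K1 where "K1 = integral\<^sup>L (time_measure T) (time_weight s \<alpha> c n)"
  define b where "b = (if n = 0 then 0 else (real n - \<alpha>) / (2 * s))"
  define d where "d = (real (n + m) - \<alpha>) / (2 * s)"
  define K2 where "K2 = (4 + 4 * c + real CARD('n) ^ m * c) * (1 / (1 - b) + 1 / (d - 1))"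
  \<comment> \<open>The absolute values and the 1 make C positive and larger than both constants
    without a look at their signs.\<close>
  define C where "C = 1 + \<bar>K1\<bar> + \<bar>K2\<bar>"
  have C: "C > 0" "K1 \<le> C" "K2 \<le> C" by (auto simp: C_def)
  have n2: "n \<le> 2" using m by auto
  have main: "(\<forall>is. length is \<le> n \<longrightarrow> continuous_on ({0..T} \<times> UNIV) (\<lambda>(t, x). partial_deriv is (mild_solution s f g t) x)) \<and>
    (\<forall>t\<in>{0..T}. ddiff_bounded n m (\<alpha> + 2 * s - real n) (F + C * B) (mild_solution s f g t))"
    if bdd: "ddiff_bounded n m (\<alpha> + 2 * s - real n) F f"
      and g_cont: "continuous_on ({0..T} \<times> UNIV) (\<lambda>(r, x). g r x)"
      and g_bound: "\<And>r x. r \<in> {0..T} \<Longrightarrow> \<bar>g r x\<bar> \<le> B"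
      and g_holder: "\<And>r x h. r \<in> {0..T} \<Longrightarrow> \<bar>g r (x + h) - g r x\<bar> \<le> 2 * B * norm h powr \<alpha>"
    for f :: "real ^ 'n \<Rightarrow> real" and g :: "real \<Rightarrow> real ^ 'n \<Rightarrow> real" and F B
  proof -
    have f: "f \<in> Cn_space n" and F: "\<And>is x. length is \<le> n \<Longrightarrow> \<bar>partial_deriv is f x\<bar> \<le> F"
      and Fd: "\<And>is h x. length is = n \<Longrightarrow> \<bar>ddiff m (partial_deriv is f) h x\<bar> \<le> F * norm h powr (\<alpha> + 2 * s - real n)"
      using bdd by (auto simp: ddiff_bounded_def)
    have B: "B \<ge> 0" using order_trans[OF abs_ge_zero g_bound[of 0]] T by auto
    have sm: "\<bar>partial_deriv is (frac_semigroup s \<tau> (g r)) x\<bar> \<le> c * B * \<tau> powr (- ((real (length is) - \<alpha>) / (2 * s)))"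
      if "is \<noteq> []" "length is \<le> 3" "r \<in> {0..T}" "0 < \<tau>" for "is" r \<tau> x
      using that by (intro smoothing g_bound g_holder continuous_on_slice[OF s g_cont g_bound])
    note P = partial_deriv_frac_semigroup_commute[OF s f]
    note V = partial_deriv_duhamel[OF s \<alpha> T c g_cont g_bound g_holder sm n2 nm(1)]
    have fc: "continuous_on UNIV (partial_deriv is f)" if "length is \<le> n" for "is"
      using f that by (auto simp: Cn_space_def)
    define V where "V = duhamel s T g"
    have V_Cn: "V t \<in> Cn_space n" if "t \<in> {0..T}" for t
      unfolding V_def using that by (intro V(4)) auto
    have V_bound: "\<bar>partial_deriv is (V t) x\<bar> \<le> B * K1" if "t \<in> {0..T}" "length is \<le> n" for t x "is"
      unfolding V_def K1_def using that by (intro V(3)) auto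
    have V_cont: "continuous_on ({0..T} \<times> UNIV) (\<lambda>(t, x). partial_deriv is (V t) x)" if "length is \<le> n" for "is"
      unfolding V_def
      by (rule continuous_on_partial_deriv_duhamel[OF s \<alpha> T c g_cont g_bound g_holder sm n2 nm(1) that])
    have V_ddiff: "\<bar>ddiff m (partial_deriv is (V t)) h x\<bar> \<le> B * K2 * norm h powr (\<alpha> + 2 * s - real n)"
      if "t \<in> {0..T}" "length is = n" for t h x "is"
      unfolding V_def K2_def
      by (rule ddiff_duhamel[OF s \<alpha> T c g_cont g_bound g_holder sm n2 nm(1) that m nm(2) b_def d_def])
    have v: "mild_solution s f g t = (\<lambda>x. frac_semigroup s t f x + V t x)" if "t \<in> {0..T}" for t
      unfolding mild_solution_def V_def
      using duhamel_eq[OF s \<alpha> T c g_cont g_bound g_holder sm that] by (auto simp: fun_eq_iff)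
    have v_deriv: "partial_deriv is (mild_solution s f g t) = (\<lambda>x. frac_semigroup s t (partial_deriv is f) x + partial_deriv is (V t) x)"
      if t: "t \<in> {0..T}" and len: "length is \<le> n" for t "is"
    proof -
      have t0: "t \<ge> 0" using t by simp
      show ?thesis
        unfolding v[OF t] partial_deriv_add(1)[OF P(2)[OF t0] V_Cn[OF t] len] P(1)[OF t0 len] ..
    qed
    show ?thesis
      unfolding ddiff_bounded_def
    proof (intro conjI allI impI ballI)
      fix "is" :: "'n list" assume len: "length is \<le> n"
      have "continuous_on ({0..T} \<times> UNIV) (\<lambda>(t, x). frac_semigroup s t (partial_deriv is f) x)"
      proof -
        \<comment> \<open>The datum does not depend on time, so the parameter set is again a single
          point.\<close>
        have "continuous_on ({0::real} \<times> UNIV) (\<lambda>(p, x). partial_deriv is f x)"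
          unfolding split_beta by (rule continuous_on_compose2[OF fc[OF len]]) (auto intro!: continuous_intros)
        from continuous_on_frac_semigroup[OF s this F[OF len]]
        have "continuous_on ({0..} \<times> {0::real} \<times> UNIV) (\<lambda>(t, p, x). frac_semigroup s t (partial_deriv is f) x)" .
        moreover have "continuous_on ({0..T} \<times> (UNIV :: (real ^ 'n) set)) (\<lambda>q. (fst q, 0::real, snd q))"
          by (intro continuous_intros)
        ultimately have "continuous_on ({0..T} \<times> UNIV) (\<lambda>q. case (fst q, 0::real, snd q) of (t, p, x) \<Rightarrow> frac_semigroup s t (partial_deriv is f) x)"
          by (rule continuous_on_compose2) auto
        then show ?thesis by (simp add: split_beta)
      qed
      then have "continuous_on ({0..T} \<times> UNIV) (\<lambda>q. (case q of (t, x) \<Rightarrow> frac_semigroup s t (partial_deriv is f) x) + (case q of (t, x) \<Rightarrow> partial_deriv is (V t) x))"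
        by (intro continuous_on_add V_cont[OF len])
      then show "continuous_on ({0..T} \<times> UNIV) (\<lambda>(t, x). partial_deriv is (mild_solution s f g t) x)"
        by (rule continuous_on_eq) (auto simp: v_deriv[OF _ len])
    next
      fix t assume t: "t \<in> {0..T}"
      then have t0: "t \<ge> 0" by simp
      show "mild_solution s f g t \<in> Cn_space n"
        unfolding v[OF t] by (rule partial_deriv_add(2)[OF P(2)[OF t0] V_Cn[OF t]])
      have BC: "B * K1 \<le> C * B" "B * K2 \<le> C * B"
        using mult_left_mono[OF C(2) B] mult_left_mono[OF C(3) B] by (simp_all add: mult.commute)
      show "\<bar>partial_deriv is (mild_solution s f g t) x\<bar> \<le> F + C * B" if len: "length is \<le> n" for "is" x
        using frac_semigroup_bound[OF s fc[OF len] F[OF len] t0, of x] V_bound[OF t len, of x] BC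
        unfolding v_deriv[OF t len] by linarith
      show "\<bar>ddiff m (partial_deriv is (mild_solution s f g t)) h x\<bar> \<le> (F + C * B) * norm h powr (\<alpha> + 2 * s - real n)"
        if len: "length is = n" for "is" h x
      proof -
        let ?w = "norm h powr (\<alpha> + 2 * s - real n)"
        have len': "length is \<le> n" using len by simp
        have "\<bar>ddiff m (frac_semigroup s t (partial_deriv is f)) h x\<bar> \<le> F * ?w"
        proof (cases "m = 1")
          case True
          have "\<bar>0 * frac_semigroup s t (partial_deriv is f) (x + 2 *\<^sub>R h) + 1 * frac_semigroup s t (partial_deriv is f) (x + h) + (- 1) * frac_semigroup s t (partial_deriv is f) x\<bar> \<le> F * ?w"
            by (rule frac_semigroup_diff_bound[OF s fc[OF len'] F[OF len'] t0]) (use Fd[OF len] True in \<open>simp add: ddiff_def\<close>)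
          then show ?thesis using True by (simp add: ddiff_def)
        next
          case False
          have "\<bar>1 * frac_semigroup s t (partial_deriv is f) (x + 2 *\<^sub>R h) + (- 2) * frac_semigroup s t (partial_deriv is f) (x + h) + 1 * frac_semigroup s t (partial_deriv is f) x\<bar> \<le> F * ?w"
            by (rule frac_semigroup_diff_bound[OF s fc[OF len'] F[OF len'] t0]) (use Fd[OF len] False in \<open>simp add: ddiff_def\<close>)
          then show ?thesis using False by (simp add: ddiff_def)
        qed
        moreover have "\<bar>ddiff m (partial_deriv is (V t)) h x\<bar> \<le> C * B * ?w"
          using order_trans[OF V_ddiff[OF t len] mult_right_mono[OF BC(2)]] by simp
        ultimately show ?thesis
          unfolding v_deriv[OF t len'] ddiff_add distrib_right by linarith
      qed
    qed
  qed
  show ?thesis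
    by (rule exI[of _ C], rule conjI[OF C(1)], intro allI impI, rule main) auto
qed

section \<open>From pointwise bounds to extended norms\<close>

definition ddiff_seminorm :: "nat \<Rightarrow> real \<Rightarrow> (real ^ 'n \<Rightarrow> real) \<Rightarrow> ennreal" where
  "ddiff_seminorm m \<beta> u = (SUP x. SUP h\<in>-{0}. ennreal (\<bar>ddiff m u h x\<bar> / norm h powr \<beta>))"

definition ddiff_norm :: "nat \<Rightarrow> nat \<Rightarrow> real \<Rightarrow> (real ^ 'n \<Rightarrow> real) \<Rightarrow> ennreal" where
  "ddiff_norm n m \<beta> u = Cn_norm n u + (\<Sum>is | length is = n. ddiff_seminorm m \<beta> (partial_deriv is u))"

lemma holder_seminorm_eq: "holder_seminorm \<beta> u = ddiff_seminorm 1 \<beta> u"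
  by (simp add: holder_seminorm_def ddiff_seminorm_def ddiff_def)

lemma zygmund_seminorm_eq: "zygmund_seminorm u = ddiff_seminorm 2 1 u"
  by (simp add: zygmund_seminorm_def ddiff_seminorm_def ddiff_def)

lemma sup_norm_le_iff: "K \<ge> 0 \<Longrightarrow> sup_norm u \<le> ennreal K \<longleftrightarrow> (\<forall>x. \<bar>u x\<bar> \<le> K)"
  by (auto simp: sup_norm_def SUP_le_iff)

lemma ddiff_seminorm_le_iff:
  fixes u :: "real ^ 'n \<Rightarrow> real"
  assumes "K \<ge> 0"
  shows "ddiff_seminorm m \<beta> u \<le> ennreal K \<longleftrightarrow> (\<forall>h x. \<bar>ddiff m u h x\<bar> \<le> K * norm h powr \<beta>)"
proof -
  have "(\<forall>h\<in>-{0}. ennreal (\<bar>ddiff m u h x\<bar> / norm h powr \<beta>) \<le> ennreal K) \<longleftrightarrow> (\<forall>h. \<bar>ddiff m u h x\<bar> \<le> K * norm h powr \<beta>)" for x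
  proof -
    have "ennreal (\<bar>ddiff m u h x\<bar> / norm h powr \<beta>) \<le> ennreal K \<longleftrightarrow> \<bar>ddiff m u h x\<bar> \<le> K * norm h powr \<beta>" if "h \<noteq> 0" for h
      using that assms by (simp add: pos_divide_le_eq)
    \<comment> \<open>At h = 0 both sides are 0, so the bound may run over all h although the
      supremum leaves 0 out.\<close>
    moreover have "\<bar>ddiff m u 0 x\<bar> \<le> K * norm (0 :: real ^ 'n) powr \<beta>" by (simp add: ddiff_def)
    ultimately show ?thesis by (metis ComplI singletonD ComplD singletonI)
  qed
  then show ?thesis unfolding ddiff_seminorm_def SUP_le_iff by blast
qed

lemma finite_lists_length [simp]: "finite {is :: ('n::finite) list. length is = n}"
  using finite_lists_length_eq[of "UNIV :: 'n set" n] by simp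

lemma ddiff_norm_finite:
  fixes u :: "real ^ 'n \<Rightarrow> real"
  assumes "u \<in> Cn_space n" "\<forall>is. length is = n \<longrightarrow> ddiff_seminorm m \<beta> (partial_deriv is u) < \<infinity>"
  shows "ddiff_norm n m \<beta> u < \<infinity>"
proof -
  obtain B where B: "\<And>is x. length is \<le> n \<Longrightarrow> \<bar>partial_deriv is u x\<bar> \<le> B" using Cn_space_bounded[OF assms(1)] by blast
  have "B \<ge> 0" using order_trans[OF abs_ge_zero B[of "[]"]] by simp
  then have "sup_norm (partial_deriv is u) < \<infinity>" if "length is \<le> n" for "is"
    using sup_norm_le_iff[of B "partial_deriv is u"] B[OF that] ennreal_less_top[of B] by (auto intro: le_less_trans)
  then show ?thesis
    using assms(2) by (simp add: ddiff_norm_def Cn_norm_def finite_bounded_lists)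
qed

lemma ddiff_norm_leD:
  fixes u :: "real ^ 'n \<Rightarrow> real"
  assumes "ddiff_norm n m \<beta> u \<le> ennreal K" "K \<ge> 0"
  shows "length is \<le> n \<Longrightarrow> \<bar>partial_deriv is u x\<bar> \<le> K"
    and "length is = n \<Longrightarrow> \<bar>ddiff m (partial_deriv is u) h x\<bar> \<le> K * norm h powr \<beta>"
proof -
  show "\<bar>partial_deriv is u x\<bar> \<le> K" if "length is \<le> n"
  proof -
    have "sup_norm (partial_deriv is u) \<le> Cn_norm n u"
      unfolding Cn_norm_def using that by (intro member_le_sum finite_bounded_lists) auto
    also have "\<dots> \<le> ddiff_norm n m \<beta> u" unfolding ddiff_norm_def by simp
    finally show ?thesis using assms sup_norm_le_iff[OF assms(2)] order_trans by blast
  qed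
  show "\<bar>ddiff m (partial_deriv is u) h x\<bar> \<le> K * norm h powr \<beta>" if "length is = n"
  proof -
    have "ddiff_seminorm m \<beta> (partial_deriv is u) \<le> (\<Sum>is | length is = n. ddiff_seminorm m \<beta> (partial_deriv is u))"
      using that by (intro member_le_sum) auto
    also have "\<dots> \<le> ddiff_norm n m \<beta> u" unfolding ddiff_norm_def by simp
    finally show ?thesis using assms ddiff_seminorm_le_iff[OF assms(2)] order_trans by blast
  qed
qed

text \<open>Each of the two sums in the norm has at most as many terms as there are lists of length
  \<le> n, and each term is at most K.\<close>

lemma ddiff_norm_leI:
  fixes u :: "real ^ 'n \<Rightarrow> real"
  assumes "ddiff_bounded n m \<beta> K u"
  shows "ddiff_norm n m \<beta> u \<le> ennreal (2 * real (card {is :: 'n list. length is \<le> n}) * K)"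
proof -
  let ?L = "real (card {is :: 'n list. length is \<le> n})"
  have 1: "\<And>is x. length is \<le> n \<Longrightarrow> \<bar>partial_deriv is u x\<bar> \<le> K"
    and 2: "\<And>is h x. length is = n \<Longrightarrow> \<bar>ddiff m (partial_deriv is u) h x\<bar> \<le> K * norm h powr \<beta>"
    using assms by (auto simp: ddiff_bounded_def)
  have K: "K \<ge> 0" using order_trans[OF abs_ge_zero 1[of "[]"]] by simp
  have "Cn_norm n u \<le> (\<Sum>is\<in>{is :: 'n list. length is \<le> n}. ennreal K)"
    unfolding Cn_norm_def using 1 K by (intro sum_mono) (simp add: sup_norm_le_iff)
  moreover have "(\<Sum>is | length is = n. ddiff_seminorm m \<beta> (partial_deriv is u)) \<le> (\<Sum>is\<in>{is :: 'n list. length is = n}. ennreal K)"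
    using 2 K by (intro sum_mono) (simp add: ddiff_seminorm_le_iff)
  moreover have "(\<Sum>is\<in>{is :: 'n list. length is = n}. ennreal K) \<le> (\<Sum>is\<in>{is :: 'n list. length is \<le> n}. ennreal K)"
    by (intro sum_mono2 finite_bounded_lists) auto
  moreover have "(\<Sum>is\<in>{is :: 'n list. length is \<le> n}. ennreal K) = ennreal (?L * K)"
    using K by (simp add: ennreal_mult ennreal_of_nat_eq_real_of_nat)
  ultimately have 1: "Cn_norm n u \<le> ennreal (?L * K)"
    and 2: "(\<Sum>is | length is = n. ddiff_seminorm m \<beta> (partial_deriv is u)) \<le> ennreal (?L * K)"
    by (auto intro: order_trans)
  have "ddiff_norm n m \<beta> u \<le> ennreal (?L * K) + ennreal (?L * K)"
    unfolding ddiff_norm_def by (rule add_mono[OF 1 2])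
  also have "\<dots> = ennreal (?L * K + ?L * K)"
    by (rule ennreal_plus[symmetric]) (use K in auto)
  also have "?L * K + ?L * K = 2 * ?L * K" by simp
  finally show ?thesis .
qed

text \<open>The factor 2 lets \<alpha> = 0 pass as a degenerate Hoelder condition: an increment of a
  function bounded by B is at most 2 B. Both cases of the source then satisfy the same
  hypotheses.\<close>

lemma holder_space_time_bounds:
  fixes g :: "real \<Rightarrow> real ^ 'n \<Rightarrow> real"
  assumes g: "g \<in> holder_space_time T \<alpha>" and \<alpha>: "0 \<le> \<alpha>" "\<alpha> < 1"
  defines "B \<equiv> enn2real (holder_norm_time T \<alpha> g)"
  shows "holder_norm_time T \<alpha> g = ennreal B"
    and "continuous_on ({0..T} \<times> UNIV) (\<lambda>(r, x). g r x)"
    and "r \<in> {0..T} \<Longrightarrow> \<bar>g r x\<bar> \<le> B"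
    and "r \<in> {0..T} \<Longrightarrow> \<bar>g r (x + h) - g r x\<bar> \<le> 2 * B * norm h powr \<alpha>"
proof -
  have fin: "holder_norm_time T \<alpha> g < \<infinity>" using g by (simp add: holder_space_time_def)
  then show eq: "holder_norm_time T \<alpha> g = ennreal B" by (simp add: B_def)
  have B: "B \<ge> 0" by (simp add: B_def)
  have n0: "nat \<lfloor>\<alpha>\<rfloor> = 0" using \<alpha> by (simp add: floor_le_iff)
  show "continuous_on ({0..T} \<times> UNIV) (\<lambda>(r, x). g r x)"
    using g unfolding holder_space_time_def by (auto dest!: spec[of _ "[]"])
  have le: "holder_norm \<alpha> (g r) \<le> ennreal B" if "r \<in> {0..T}" for r
    unfolding eq[symmetric] holder_norm_time_def using that by (rule SUP_upper)
  have Cn0: "Cn_norm 0 u = sup_norm u" for u :: "real ^ 'n \<Rightarrow> real" by (simp add: Cn_norm_def)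
  have bound: "\<bar>g r x\<bar> \<le> B" if "r \<in> {0..T}" for r x
  proof -
    have "sup_norm (g r) \<le> holder_norm \<alpha> (g r)" by (simp add: holder_norm_def Let_def n0 Cn0)
    then have "sup_norm (g r) \<le> ennreal B" using le[OF that] by (rule order_trans)
    then show ?thesis using sup_norm_le_iff[OF B] by blast
  qed
  then show "r \<in> {0..T} \<Longrightarrow> \<bar>g r x\<bar> \<le> B" .
  show "\<bar>g r (x + h) - g r x\<bar> \<le> 2 * B * norm h powr \<alpha>" if r: "r \<in> {0..T}"
  proof (cases "\<alpha> = 0")
    case True
    then show ?thesis using bound[OF r, of "x + h"] bound[OF r, of x] B by (cases "h = 0") auto
  next
    case False
    then have "holder_norm \<alpha> (g r) = ddiff_norm 0 1 \<alpha> (g r)"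
      by (simp add: holder_norm_def Let_def n0 ddiff_norm_def holder_seminorm_eq)
    then have "\<bar>ddiff 1 (partial_deriv [] (g r)) h x\<bar> \<le> B * norm h powr \<alpha>"
      using le[OF r] B by (intro ddiff_norm_leD(2)[where n=0]) auto
    moreover have "0 \<le> B * norm h powr \<alpha>" using B by simp
    ultimately show ?thesis by (simp add: ddiff_def)
  qed
qed

text \<open>Finiteness of the right-hand side is part of the conclusion because membership in the
  spaces of functions of time and space includes a finite norm.\<close>

lemma mild_solution_ddiff_norm:
  fixes s \<alpha> T :: real
  assumes s: "0 < s" "s < 1" and \<alpha>: "0 \<le> \<alpha>" "\<alpha> < 1" and T: "T > 0"
    and m: "m \<in> {1, 2}" "n + m \<le> 3" and nm: "real n < \<alpha> + 2 * s" "\<alpha> + 2 * s < real (n + m)"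
    and \<beta>: "\<beta> = \<alpha> + 2 * s - real n"
  shows "\<exists>C::real. C > 0 \<and> (\<forall>(f :: real ^ 'n \<Rightarrow> real) g.
    f \<in> Cn_space n \<longrightarrow> (\<forall>is. length is = n \<longrightarrow> ddiff_seminorm m \<beta> (partial_deriv is f) < \<infinity>) \<longrightarrow> g \<in> holder_space_time T \<alpha> \<longrightarrow>
    ennreal C * (ddiff_norm n m \<beta> f + holder_norm_time T \<alpha> g) < \<infinity> \<and>
    (\<forall>is. length is \<le> n \<longrightarrow> continuous_on ({0..T} \<times> UNIV) (\<lambda>(t, x). partial_deriv is (mild_solution s f g t) x)) \<and>
    (\<forall>t\<in>{0..T}. mild_solution s f g t \<in> Cn_space n \<and>
      ddiff_norm n m \<beta> (mild_solution s f g t) \<le> ennreal C * (ddiff_norm n m \<beta> f + holder_norm_time T \<alpha> g) \<and>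
      (\<forall>is. length is = n \<longrightarrow> ddiff_seminorm m \<beta> (partial_deriv is (mild_solution s f g t)) < \<infinity>)))"
proof -
  obtain C where C: "C > 0" and reg: "\<And>(f :: real ^ 'n \<Rightarrow> real) g F B.
    ddiff_bounded n m \<beta> F f \<Longrightarrow>
    continuous_on ({0..T} \<times> UNIV) (\<lambda>(r, x). g r x) \<Longrightarrow> (\<forall>r\<in>{0..T}. \<forall>x. \<bar>g r x\<bar> \<le> B) \<Longrightarrow>
    (\<forall>r\<in>{0..T}. \<forall>x h. \<bar>g r (x + h) - g r x\<bar> \<le> 2 * B * norm h powr \<alpha>) \<Longrightarrow>
    (\<forall>is. length is \<le> n \<longrightarrow> continuous_on ({0..T} \<times> UNIV) (\<lambda>(t, x). partial_deriv is (mild_solution s f g t) x)) \<and>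
    (\<forall>t\<in>{0..T}. ddiff_bounded n m \<beta> (F + C * B) (mild_solution s f g t))"
    using mild_solution_regularity[OF s \<alpha> T m nm, where 'n='n] unfolding \<beta> by blast
  define L where "L = real (card {is :: 'n list. length is \<le> n})"
  have "card {is :: 'n list. length is \<le> n} \<noteq> 0" using finite_bounded_lists[where 'n='n, of n] by (auto intro: exI[of _ "[]"])
  then have L: "L > 0" by (simp add: L_def)
  \<comment> \<open>The factor 2 L comes from passing to norms, the factor 1 + C from F + C B \<le>
    (1 + C) (F + B).\<close>
  define C' where "C' = 2 * L * (1 + C)"
  have C': "C' > 0" using L C by (simp add: C'_def)
  have main: "ennreal C' * (ddiff_norm n m \<beta> f + holder_norm_time T \<alpha> g) < \<infinity> \<and>
    (\<forall>is. length is \<le> n \<longrightarrow> continuous_on ({0..T} \<times> UNIV) (\<lambda>(t, x). partial_deriv is (mild_solution s f g t) x)) \<and>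
    (\<forall>t\<in>{0..T}. mild_solution s f g t \<in> Cn_space n \<and>
      ddiff_norm n m \<beta> (mild_solution s f g t) \<le> ennreal C' * (ddiff_norm n m \<beta> f + holder_norm_time T \<alpha> g) \<and>
      (\<forall>is. length is = n \<longrightarrow> ddiff_seminorm m \<beta> (partial_deriv is (mild_solution s f g t)) < \<infinity>))"
    if f: "f \<in> Cn_space n" "\<forall>is. length is = n \<longrightarrow> ddiff_seminorm m \<beta> (partial_deriv is f) < \<infinity>"
      and g: "g \<in> holder_space_time T \<alpha>" for f :: "real ^ 'n \<Rightarrow> real" and g
  proof -
    define F where "F = enn2real (ddiff_norm n m \<beta> f)"
    define B where "B = enn2real (holder_norm_time T \<alpha> g)"
    have F: "ddiff_norm n m \<beta> f = ennreal F" "F \<ge> 0" using ddiff_norm_finite[OF f] by (auto simp: F_def)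
    note G = holder_space_time_bounds[OF g \<alpha>, folded B_def]
    have B: "B \<ge> 0" by (simp add: B_def)
    have rhs: "ennreal C' * (ddiff_norm n m \<beta> f + holder_norm_time T \<alpha> g) = ennreal (C' * (F + B))"
      unfolding F(1) G(1) using F(2) B C' by (simp add: ennreal_mult)
    have R: "(\<forall>is. length is \<le> n \<longrightarrow> continuous_on ({0..T} \<times> UNIV) (\<lambda>(t, x). partial_deriv is (mild_solution s f g t) x)) \<and>
      (\<forall>t\<in>{0..T}. ddiff_bounded n m \<beta> (F + C * B) (mild_solution s f g t))"
      by (rule reg) (use f(1) ddiff_norm_leD[OF eq_refl[OF F(1)] F(2)] G in \<open>auto simp: ddiff_bounded_def\<close>)
    have FCB: "F + C * B \<ge> 0" using F B C by simp
    have le: "2 * L * (F + C * B) \<le> C' * (F + B)"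
    proof -
      have "F + C * B \<le> (1 + C) * (F + B)" using F B C by (simp add: algebra_simps)
      then show ?thesis using L by (simp add: C'_def mult.assoc)
    qed
    show ?thesis
    proof (intro conjI ballI)
      show "ennreal C' * (ddiff_norm n m \<beta> f + holder_norm_time T \<alpha> g) < \<infinity>" unfolding rhs by simp
      show "\<forall>is. length is \<le> n \<longrightarrow> continuous_on ({0..T} \<times> UNIV) (\<lambda>(t, x). partial_deriv is (mild_solution s f g t) x)"
        using R by blast
      fix t assume t: "t \<in> {0..T}"
      have v: "ddiff_bounded n m \<beta> (F + C * B) (mild_solution s f g t)" using R t by blast
      then show "mild_solution s f g t \<in> Cn_space n" by (simp add: ddiff_bounded_def)
      have "ddiff_norm n m \<beta> (mild_solution s f g t) \<le> ennreal (2 * L * (F + C * B))"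
        unfolding L_def by (rule ddiff_norm_leI[OF v])
      also have "\<dots> \<le> ennreal (C' * (F + B))" using le by (rule ennreal_leI)
      finally show "ddiff_norm n m \<beta> (mild_solution s f g t) \<le> ennreal C' * (ddiff_norm n m \<beta> f + holder_norm_time T \<alpha> g)"
        unfolding rhs .
      show "\<forall>is. length is = n \<longrightarrow> ddiff_seminorm m \<beta> (partial_deriv is (mild_solution s f g t)) < \<infinity>"
      proof (intro allI impI)
        fix "is" :: "'n list" assume "length is = n"
        then have "ddiff_seminorm m \<beta> (partial_deriv is (mild_solution s f g t)) \<le> ennreal (F + C * B)"
          unfolding ddiff_seminorm_le_iff[OF FCB] using v by (simp add: ddiff_bounded_def)
        then show "ddiff_seminorm m \<beta> (partial_deriv is (mild_solution s f g t)) < \<infinity>"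
          unfolding infinity_ennreal_def by (rule le_less_trans[OF _ ennreal_less_top])
      qed
    qed
  qed
  show ?thesis using C' main by blast
qed

theorem theorem4p2:
  fixes T s \<alpha> :: real
  assumes "T > 0" and "0 < s" and "s < 1" and "0 \<le> \<alpha>" and "\<alpha> < 1"
  shows
    "(\<alpha> + 2 * s \<notin> {1, 2} \<longrightarrow>
       (\<exists>C::real. C > 0 \<and>
         (\<forall>(f :: real ^ 'n \<Rightarrow> real) (g :: real \<Rightarrow> real ^ 'n \<Rightarrow> real).
            f \<in> holder_space (\<alpha> + 2 * s) \<longrightarrow> g \<in> holder_space_time T \<alpha> \<longrightarrow>
            mild_solution s f g \<in> holder_space_time T (\<alpha> + 2 * s) \<and>
            holder_norm_time T (\<alpha> + 2 * s) (mild_solution s f g)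
              \<le> ennreal C * (holder_norm (\<alpha> + 2 * s) f + holder_norm_time T \<alpha> g))))
     \<and>
     (\<forall>k::nat. k \<in> {1, 2} \<longrightarrow> \<alpha> + 2 * s = real k \<longrightarrow>
       (\<exists>C::real. C > 0 \<and>
         (\<forall>(f :: real ^ 'n \<Rightarrow> real) (g :: real \<Rightarrow> real ^ 'n \<Rightarrow> real).
            f \<in> zygmund_space k \<longrightarrow> g \<in> holder_space_time T \<alpha> \<longrightarrow>
            mild_solution s f g \<in> zygmund_space_time T k \<and>
            zygmund_norm_time T k (mild_solution s f g)
              \<le> ennreal C * (zygmund_norm k f + holder_norm_time T \<alpha> g))))"
proof (intro conjI impI allI)
  note T = assms(1) and s = assms(2,3) and \<alpha> = assms(4,5)
  assume ni: "\<alpha> + 2 * s \<notin> {1, 2}"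
  define n where "n = nat \<lfloor>\<alpha> + 2 * s\<rfloor>"
  have n: "real n \<le> \<alpha> + 2 * s" "\<alpha> + 2 * s < real n + 1" using s \<alpha> by (auto simp: n_def)
  have "n < 3" using n s \<alpha> by linarith
  then have "n \<in> {0, 1, 2}" by auto
  \<comment> \<open>The value 0 is excluded by s > 0, the values 1 and 2 by hypothesis, so the
    Hoelder exponent \<beta> lies strictly between 0 and 1.\<close>
  then have ne: "\<alpha> + 2 * s \<noteq> real n" using ni s \<alpha> by auto
  define \<beta> where "\<beta> = \<alpha> + 2 * s - real n"
  have space: "holder_space (\<alpha> + 2 * s) = {u \<in> Cn_space n. \<forall>is. length is = n \<longrightarrow> ddiff_seminorm 1 \<beta> (partial_deriv is u) < \<infinity>}"
    unfolding holder_space_def Let_def n_def[symmetric] holder_seminorm_eq \<beta>_def using ne by simp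
  have norm: "holder_norm (\<alpha> + 2 * s) u = ddiff_norm n 1 \<beta> u" for u :: "real ^ 'n \<Rightarrow> real"
    unfolding holder_norm_def Let_def n_def[symmetric] holder_seminorm_eq \<beta>_def ddiff_norm_def using ne by simp
  obtain C where C: "C > 0" and main: "\<And>(f :: real ^ 'n \<Rightarrow> real) g.
    f \<in> Cn_space n \<Longrightarrow> (\<forall>is. length is = n \<longrightarrow> ddiff_seminorm 1 \<beta> (partial_deriv is f) < \<infinity>) \<Longrightarrow> g \<in> holder_space_time T \<alpha> \<Longrightarrow>
    ennreal C * (ddiff_norm n 1 \<beta> f + holder_norm_time T \<alpha> g) < \<infinity> \<and>
    (\<forall>is. length is \<le> n \<longrightarrow> continuous_on ({0..T} \<times> UNIV) (\<lambda>(t, x). partial_deriv is (mild_solution s f g t) x)) \<and>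
    (\<forall>t\<in>{0..T}. mild_solution s f g t \<in> Cn_space n \<and>
      ddiff_norm n 1 \<beta> (mild_solution s f g t) \<le> ennreal C * (ddiff_norm n 1 \<beta> f + holder_norm_time T \<alpha> g) \<and>
      (\<forall>is. length is = n \<longrightarrow> ddiff_seminorm 1 \<beta> (partial_deriv is (mild_solution s f g t)) < \<infinity>))"
    using mild_solution_ddiff_norm[OF s \<alpha> T, of 1 n \<beta>, where 'n='n] n ne \<open>n < 3\<close> \<beta>_def by auto
  show "\<exists>C::real. C > 0 \<and>
         (\<forall>(f :: real ^ 'n \<Rightarrow> real) (g :: real \<Rightarrow> real ^ 'n \<Rightarrow> real).
            f \<in> holder_space (\<alpha> + 2 * s) \<longrightarrow> g \<in> holder_space_time T \<alpha> \<longrightarrow>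
            mild_solution s f g \<in> holder_space_time T (\<alpha> + 2 * s) \<and>
            holder_norm_time T (\<alpha> + 2 * s) (mild_solution s f g)
              \<le> ennreal C * (holder_norm (\<alpha> + 2 * s) f + holder_norm_time T \<alpha> g))"
  proof (intro exI[of _ C] conjI C allI impI)
    fix f :: "real ^ 'n \<Rightarrow> real" and g :: "real \<Rightarrow> real ^ 'n \<Rightarrow> real" assume f: "f \<in> holder_space (\<alpha> + 2 * s)" and g: "g \<in> holder_space_time T \<alpha>"
    then have f': "f \<in> Cn_space n" "\<forall>is. length is = n \<longrightarrow> ddiff_seminorm 1 \<beta> (partial_deriv is f) < \<infinity>"
      unfolding space by auto
    note M = main[OF f' g]
    show le: "holder_norm_time T (\<alpha> + 2 * s) (mild_solution s f g) \<le> ennreal C * (holder_norm (\<alpha> + 2 * s) f + holder_norm_time T \<alpha> g)"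
      unfolding holder_norm_time_def[of T "\<alpha> + 2 * s"] norm using M by (intro SUP_least) blast
    show "mild_solution s f g \<in> holder_space_time T (\<alpha> + 2 * s)"
      unfolding holder_space_time_def n_def[symmetric] space
      using M le_less_trans[OF le[unfolded norm]] by blast
  qed
next
  note T = assms(1) and s = assms(2,3) and \<alpha> = assms(4,5)
  fix k :: nat assume k: "k \<in> {1, 2}" and eq: "\<alpha> + 2 * s = real k"
  \<comment> \<open>With m = 2 the orders compared are k - 1 and k + 1, and the exponent of |h|
    becomes k - n = 1, that of the Zygmund seminorm.\<close>
  define n where "n = k - 1"
  have kn: "k = n + 1" "n + 2 \<le> 3" using k by (auto simp: n_def)
  have space: "zygmund_space k = {u \<in> Cn_space n. \<forall>is. length is = n \<longrightarrow> ddiff_seminorm 2 1 (partial_deriv is (u :: real ^ 'n \<Rightarrow> real)) < \<infinity>}"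
    unfolding zygmund_space_def zygmund_seminorm_eq n_def ..
  have norm: "zygmund_norm k u = ddiff_norm n 2 1 u" for u :: "real ^ 'n \<Rightarrow> real"
    unfolding zygmund_norm_def zygmund_seminorm_eq n_def ddiff_norm_def ..
  obtain C where C: "C > 0" and main: "\<And>(f :: real ^ 'n \<Rightarrow> real) g.
    f \<in> Cn_space n \<Longrightarrow> (\<forall>is. length is = n \<longrightarrow> ddiff_seminorm 2 1 (partial_deriv is f) < \<infinity>) \<Longrightarrow> g \<in> holder_space_time T \<alpha> \<Longrightarrow>
    ennreal C * (ddiff_norm n 2 1 f + holder_norm_time T \<alpha> g) < \<infinity> \<and>
    (\<forall>is. length is \<le> n \<longrightarrow> continuous_on ({0..T} \<times> UNIV) (\<lambda>(t, x). partial_deriv is (mild_solution s f g t) x)) \<and>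
    (\<forall>t\<in>{0..T}. mild_solution s f g t \<in> Cn_space n \<and>
      ddiff_norm n 2 1 (mild_solution s f g t) \<le> ennreal C * (ddiff_norm n 2 1 f + holder_norm_time T \<alpha> g) \<and>
      (\<forall>is. length is = n \<longrightarrow> ddiff_seminorm 2 1 (partial_deriv is (mild_solution s f g t)) < \<infinity>))"
    using mild_solution_ddiff_norm[OF s \<alpha> T, of 2 n 1, where 'n='n] kn eq by auto
  show "\<exists>C::real. C > 0 \<and>
         (\<forall>(f :: real ^ 'n \<Rightarrow> real) (g :: real \<Rightarrow> real ^ 'n \<Rightarrow> real).
            f \<in> zygmund_space k \<longrightarrow> g \<in> holder_space_time T \<alpha> \<longrightarrow>
            mild_solution s f g \<in> zygmund_space_time T k \<and>
            zygmund_norm_time T k (mild_solution s f g)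
              \<le> ennreal C * (zygmund_norm k f + holder_norm_time T \<alpha> g))"
  proof (intro exI[of _ C] conjI C allI impI)
    fix f :: "real ^ 'n \<Rightarrow> real" and g :: "real \<Rightarrow> real ^ 'n \<Rightarrow> real" assume f: "f \<in> zygmund_space k" and g: "g \<in> holder_space_time T \<alpha>"
    then have f': "f \<in> Cn_space n" "\<forall>is. length is = n \<longrightarrow> ddiff_seminorm 2 1 (partial_deriv is f) < \<infinity>"
      unfolding space by auto
    note M = main[OF f' g]
    show le: "zygmund_norm_time T k (mild_solution s f g) \<le> ennreal C * (zygmund_norm k f + holder_norm_time T \<alpha> g)"
      unfolding zygmund_norm_time_def norm using M by (intro SUP_least) blast
    have fin: "zygmund_norm_time T k (mild_solution s f g) < \<infinity>"
      using M le_less_trans[OF le[unfolded norm]] by blast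
    \<comment> \<open>For k = 2 the target space also demands membership in the space of integer
      order k - 1, which carries no seminorm; its norm is a summand of the Zygmund norm.\<close>
    have hs: "holder_space (real n) = Cn_space n" "holder_norm (real n) u = Cn_norm n u" for u :: "real ^ 'n \<Rightarrow> real"
      by (simp_all add: holder_space_def holder_norm_def)
    have "holder_norm_time T (real n) (mild_solution s f g) \<le> zygmund_norm_time T k (mild_solution s f g)"
      unfolding holder_norm_time_def zygmund_norm_time_def hs norm ddiff_norm_def
      by (rule SUP_subset_mono[OF order_refl]) simp
    with fin have "mild_solution s f g \<in> holder_space_time T (real n)"
      unfolding holder_space_time_def hs using M by (auto intro: le_less_trans)
    moreover have "continuous_on ({0..T} \<times> UNIV) (\<lambda>(t, x). mild_solution s f g t x)"
      using M by (auto dest!: spec[of _ "[]"])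
    ultimately show "mild_solution s f g \<in> zygmund_space_time T k"
      unfolding zygmund_space_time_def space n_def[symmetric] using fin M by blast
  qed
qed

end
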